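(* Under the standing setting and the order 1.5 method described in the context, there exist constants $C>0$ and $h_0\in(0,1)$ such that for all $h\in(0,h_0)$, \[ \mathbb{E}\big[\mathrm{Cost}(\overline X)\big]\le C\, h^{-1}\log(h^{-1}). \]
   Context: Standing setting. Let $d,m\ge 1$ and $T>0$. For $x\in\mathbb{R}^d$ and non-empty $A\subset\mathbb{R}^d$ write $d(x,A)=\inf_{y\in A}|x-y|$ (Euclidean norm). $D\subset\mathbb{R}^d$ is a non-empty bounded domain whose boundary $\partial D$ is $C^4$. $\mathrm{reach}(D)>0$ denotes the supremum of all $R>0$ such that every $x\in\mathbb{R}^d$ with $d(x,\partial D)<R$ has a unique nearest point on $\partial D$. For $r>0$ let $D_r=\{x\in\mathbb{R}^d: d(x,D)<r\}$. The coefficients $a:\mathbb{R}^d\to\mathbb{R}^d$, $b:\mathbb{R}^d\to\mathbb{R}^{d\times m}$ satisfy: (B1) every component $a_i$, $b_{ij}$ is $C^3$ and it and all its partial derivatives up to order $3$ are bounded on $\mathbb{R}^d$; (B2) there exist $\bar R_D\in(0,\mathrm{reach}(D)/2)$ and $\hat c_b>0$ with $\xi^\top b(x)b(x)^\top\xi\ge \hat c_b|\xi|^2$ for all $x\in D_{\bar R_D}$, $\xi\in\mathbb{R}^d$; (B3) there exists $\widehat C_b>0$ with $\xi^\top b(x)b(x)^\top\xi\le \widehat C_b|\xi|^2$ for all $x,\xi\in\mathbb{R}^d$. $W=(W^1,\dots,W^m)$ is a standard $m$-dimensional Wiener process on a filtered probability space $(\Omega,\mathcal F,(\mathcal F_t)_{t\ge0},\mathbb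 P)$, $x_0\in D$ is deterministic, and $X$ is the strong solution of $\mathrm{d}X=a(X)\,\mathrm{d}t+b(X)\,\mathrm{d}W$, $X(0)=x_0$. The (truncated) exit time is $\tau=\inf\{t\ge0: X(t)\notin D\}\wedge T$. Order 1.5 method. Let $\mathcal L^j=\sum_{i=1}^d b_{ij}\partial_{x_i}$ for $j=1,\dots,m$ and $\mathcal L^0=\sum_{i=1}^d a_i\partial_{x_i}+\frac12\sum_{i,k=1}^d\sum_{j=1}^m b_{ij}b_{kj}\partial_{x_i}\partial_{x_k}$. For a step-size parameter $h\in(0,1)$ set $\delta_1=\sqrt{12\widehat C_b\, d\, h\log(h^{-1})}$, $\delta_2=\sqrt{16\widehat C_b\, d\, h^2\log(h^{-1})}$, and define $\Delta t(x)=h$ if $d(x,\partial D)>\delta_1$, $\Delta t(x)=h^2$ if $d(x,\partial D)\in(\delta_2,\delta_1]$, and $\Delta t(x)=h^3$ if $d(x,\partial D)\le\delta_2$. The numerical solution is defined recursively by $t_0=0$, $\overline X(t_0)=x_0$, $\Delta t_n=\Delta t(\overline X(t_n))$, $t_{n+1}=t_n+\Delta t_n$ and, for $i=1,\dots,d$ (strong Itô–Taylor scheme of order 1.5), with all coefficient functions evaluated at $\overline X(t_n)$, \[ \overline X_i(t_{n+1})=\overline X_i(t_n)+a_i\Delta t_n+\sum_{j=1}^m b_{ij}\,I^n_{(j)}+\tfrac12\mathcal L^0a_i\,\Delta t_n^2+\sum_{j=1}^m\big(\mathcal L^j a_i\, I^n_{(j,0)}+\mathcal L^0 b_{ij}\,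 I^n_{(0,j)}\big)+\sum_{j_1,j_2=1}^m\mathcal L^{j_1}b_{ij_2}\,I^n_{(j_1,j_2)}+\sum_{j_1,j_2,j_3=1}^m\mathcal L^{j_1}\mathcal L^{j_2}b_{ij_3}\,I^n_{(j_1,j_2,j_3)}, \] where, with the convention $W^0(t)=t$, the multiple Itô integrals are $I^n_{(j_1,\dots,j_l)}=\int_{t_n}^{t_{n+1}}\int_{t_n}^{s_l}\cdots\int_{t_n}^{s_2}\mathrm{d}W^{j_1}(s_1)\cdots\mathrm{d}W^{j_l}(s_l)$ (so $I^n_{(j)}=W^j(t_{n+1})-W^j(t_n)$). The numerical solution is extended to continuous time by $\overline X(t)=\overline X(t_n)$ for $t\in[t_n,t_{n+1})$. The numerical exit time is $\nu=\min\{t_n: \overline X(t_n)\notin D\}\wedge T$, and the computational cost is $\mathrm{Cost}(\overline X)=\int_0^{\nu}\frac{1}{\Delta t(\overline X(t))}\,\mathrm{d}t$. *)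

theory Defs
  imports "HOL-Probability.Probability"
begin

definition pd :: "'n::finite \<Rightarrow> (real^'n \<Rightarrow> real) \<Rightarrow> real^'n \<Rightarrow> real" where
  "pd i f x = frechet_derivative f (at x) (axis i 1)"

fun pdl :: "'n::finite list \<Rightarrow> (real^'n \<Rightarrow> real) \<Rightarrow> real^'n \<Rightarrow> real" where
  "pdl [] f = f"
| "pdl (i # is) f = pd i (pdl is f)"

definition Ck_on :: "nat \<Rightarrow> (real^'n::finite) set \<Rightarrow> (real^'n \<Rightarrow> real) \<Rightarrow> bool" where
  "Ck_on k U f \<longleftrightarrow>
     (\<forall>is. length is < k \<longrightarrow> (\<forall>x\<in>U. pdl is f differentiable (at x))) \<and>
     (\<forall>is. length is \<le> k \<longrightarrow> continuous_on U (pdl is f))"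

definition Ck_bounded :: "nat \<Rightarrow> (real^'n::finite \<Rightarrow> real) \<Rightarrow> bool" where
  "Ck_bounded k f \<longleftrightarrow> Ck_on k UNIV f \<and>
     (\<forall>is. length is \<le> k \<longrightarrow> bounded (range (pdl is f)))"

definition Ck_domain :: "nat \<Rightarrow> (real^'n::finite) set \<Rightarrow> bool" where
  "Ck_domain k D \<longleftrightarrow> D \<noteq> {} \<and> open D \<and> connected D \<and> bounded D \<and>
     (\<forall>p\<in>frontier D. \<exists>r>0. \<exists>\<phi>. Ck_on k (ball p r) \<phi> \<and>
        (\<forall>x\<in>ball p r. \<exists>i. pd i \<phi> x \<noteq> 0) \<and>
        D \<inter> ball p r = {x\<in>ball p r. \<phi> x < 0})"

definition reach :: "(real^'n::finite) set \<Rightarrow> real" where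
  "reach D = Sup {R. 0 < R \<and> (\<forall>x. infdist x (frontier D) < R \<longrightarrow>
       (\<exists>!y. y \<in> frontier D \<and> dist x y = infdist x (frontier D)))}"

definition enlarge :: "(real^'n::finite) set \<Rightarrow> real \<Rightarrow> (real^'n) set" where
  "enlarge D r = {x. infdist x D < r}"

definition wiener :: "'a measure \<Rightarrow> (real \<Rightarrow> 'a \<Rightarrow> real^'m::finite) \<Rightarrow> bool" where
  "wiener M W \<longleftrightarrow> prob_space M \<and> (\<forall>t. W t \<in> borel_measurable M) \<and>
     (\<forall>\<omega>\<in>space M. W 0 \<omega> = 0 \<and> continuous_on {0..} (\<lambda>t. W t \<omega>)) \<and>
     (\<forall>ts::real list. sorted_wrt (<) ts \<and> (\<forall>t\<in>set ts. 0 \<le> t) \<longrightarrow>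
        prob_space.indep_vars M (\<lambda>_. borel)
          (\<lambda>(j, k) \<omega>. W (ts ! Suc k) \<omega> $ j - W (ts ! k) \<omega> $ j)
          (UNIV \<times> {k. Suc k < length ts}) \<and>
        (\<forall>j k. Suc k < length ts \<longrightarrow>
          distributed M lborel (\<lambda>\<omega>. W (ts ! Suc k) \<omega> $ j - W (ts ! k) \<omega> $ j)
            (\<lambda>x. ennreal (normal_density 0 (sqrt (ts ! Suc k - ts ! k)) x))))"

text \<open>Index None stands for the time component W^0(t) = t.\<close>
definition incr :: "'m::finite option \<Rightarrow> (real \<Rightarrow> 'a \<Rightarrow> real^'m) \<Rightarrow> real \<Rightarrow> real \<Rightarrow> 'a \<Rightarrow> real" where
  "incr j W u v \<omega> = (case j of None \<Rightarrow> v - u | Some i \<Rightarrow> W v \<omega> $ i - W u \<omega> $ i)"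

text \<open>Iterated left-point Riemann-Ito sums on the uniform partition of [s, s+Delta]
  into N pieces, partial up to grid point k; the index list is given in reversed order
  (last integrator first).\<close>
fun rsum :: "(real \<Rightarrow> 'a \<Rightarrow> real^'m::finite) \<Rightarrow> ('a \<Rightarrow> real) \<Rightarrow> ('a \<Rightarrow> real) \<Rightarrow> nat
     \<Rightarrow> 'm option list \<Rightarrow> nat \<Rightarrow> 'a \<Rightarrow> real" where
  "rsum W s \<Delta> N [] k \<omega> = 1"
| "rsum W s \<Delta> N (j # rjs) k \<omega> =
     (\<Sum>k'<k. rsum W s \<Delta> N rjs k' \<omega> *
        incr j W (s \<omega> + real k' * \<Delta> \<omega> / real N) (s \<omega> + real (Suc k') * \<Delta> \<omega> / real N) \<omega>)"

definition conv_in_prob :: "'a measure \<Rightarrow> (nat \<Rightarrow> 'a \<Rightarrow> real) \<Rightarrow> ('a \<Rightarrow> real) \<Rightarrow> bool" where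
  "conv_in_prob M Y Z \<longleftrightarrow> (\<forall>\<epsilon>>0.
     ((\<lambda>N. measure M {\<omega>\<in>space M. \<epsilon> < \<bar>Y N \<omega> - Z \<omega>\<bar>}) \<longlongrightarrow> 0) sequentially)"

text \<open>The multiple Ito integral I_(j1,...,jl) over [s, s+Delta] (s, Delta random),
  as the limit in probability of iterated Ito sums (unique up to null sets).\<close>
definition itoI :: "'a measure \<Rightarrow> (real \<Rightarrow> 'a \<Rightarrow> real^'m::finite) \<Rightarrow> 'm option list
     \<Rightarrow> ('a \<Rightarrow> real) \<Rightarrow> ('a \<Rightarrow> real) \<Rightarrow> 'a \<Rightarrow> real" where
  "itoI M W js s \<Delta> = (SOME Z. Z \<in> borel_measurable M \<and>
      conv_in_prob M (\<lambda>N. rsum W s \<Delta> N (rev js) N) Z)"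

definition Lj :: "(real^'d::finite \<Rightarrow> real^'m::finite^'d) \<Rightarrow> 'm \<Rightarrow> (real^'d \<Rightarrow> real) \<Rightarrow> real^'d \<Rightarrow> real" where
  "Lj b j g x = (\<Sum>i\<in>UNIV. b x $ i $ j * pd i g x)"

definition L0 :: "(real^'d::finite \<Rightarrow> real^'d) \<Rightarrow> (real^'d \<Rightarrow> real^'m::finite^'d)
     \<Rightarrow> (real^'d \<Rightarrow> real) \<Rightarrow> real^'d \<Rightarrow> real" where
  "L0 a b g x = (\<Sum>i\<in>UNIV. a x $ i * pd i g x) +
     1/2 * (\<Sum>i\<in>UNIV. \<Sum>k\<in>UNIV. \<Sum>j\<in>UNIV. b x $ i $ j * b x $ k $ j * pd i (pd k g) x)"

definition stepsize :: "(real^'d::finite) set \<Rightarrow> real \<Rightarrow> real \<Rightarrow> real^'d \<Rightarrow> real" where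
  "stepsize D Cb h x =
     (let \<delta>1 = sqrt (12 * Cb * real CARD('d) * h * ln (1 / h));
          \<delta>2 = sqrt (16 * Cb * real CARD('d) * h^2 * ln (1 / h))
      in if \<delta>1 < infdist x (frontier D) then h
         else if \<delta>2 < infdist x (frontier D) then h^2 else h^3)"

text \<open>One step of the strong Ito-Taylor scheme of order 1.5; Iv js is the value of I_js.\<close>
definition taylor15 :: "(real^'d::finite \<Rightarrow> real^'d) \<Rightarrow> (real^'d \<Rightarrow> real^'m::finite^'d)
     \<Rightarrow> real^'d \<Rightarrow> real \<Rightarrow> ('m option list \<Rightarrow> real) \<Rightarrow> real^'d" where
  "taylor15 a b x \<Delta> Iv = (\<chi> i.
      x $ i + a x $ i * \<Delta>
      + (\<Sum>j\<in>UNIV. b x $ i $ j * Iv [Some j])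
      + 1/2 * L0 a b (\<lambda>y. a y $ i) x * \<Delta>^2
      + (\<Sum>j\<in>UNIV. Lj b j (\<lambda>y. a y $ i) x * Iv [Some j, None]
                   + L0 a b (\<lambda>y. b y $ i $ j) x * Iv [None, Some j])
      + (\<Sum>j1\<in>UNIV. \<Sum>j2\<in>UNIV. Lj b j1 (\<lambda>y. b y $ i $ j2) x * Iv [Some j1, Some j2])
      + (\<Sum>j1\<in>UNIV. \<Sum>j2\<in>UNIV. \<Sum>j3\<in>UNIV.
           Lj b j1 (Lj b j2 (\<lambda>y. b y $ i $ j3)) x * Iv [Some j1, Some j2, Some j3]))"

primrec scheme :: "'a measure \<Rightarrow> (real \<Rightarrow> 'a \<Rightarrow> real^'m::finite) \<Rightarrow> (real^'d::finite \<Rightarrow> real^'d)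
     \<Rightarrow> (real^'d \<Rightarrow> real^'m^'d) \<Rightarrow> (real^'d) set \<Rightarrow> real \<Rightarrow> real^'d \<Rightarrow> real
     \<Rightarrow> nat \<Rightarrow> 'a \<Rightarrow> real \<times> (real^'d)" where
  "scheme M W a b D Cb x0 h 0 = (\<lambda>\<omega>. (0, x0))"
| "scheme M W a b D Cb x0 h (Suc n) =
     (let s = (\<lambda>\<omega>. fst (scheme M W a b D Cb x0 h n \<omega>));
          \<Delta> = (\<lambda>\<omega>. stepsize D Cb h (snd (scheme M W a b D Cb x0 h n \<omega>)))
      in (\<lambda>\<omega>. (s \<omega> + \<Delta> \<omega>,
                taylor15 a b (snd (scheme M W a b D Cb x0 h n \<omega>)) (\<Delta> \<omega>)
                  (\<lambda>js. itoI M W js s \<Delta> \<omega>))))"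

definition Xbar :: "'a measure \<Rightarrow> (real \<Rightarrow> 'a \<Rightarrow> real^'m::finite) \<Rightarrow> (real^'d::finite \<Rightarrow> real^'d)
     \<Rightarrow> (real^'d \<Rightarrow> real^'m^'d) \<Rightarrow> (real^'d) set \<Rightarrow> real \<Rightarrow> real^'d \<Rightarrow> real
     \<Rightarrow> real \<Rightarrow> 'a \<Rightarrow> real^'d" where
  "Xbar M W a b D Cb x0 h t \<omega> =
     snd (scheme M W a b D Cb x0 h (LEAST n. t < fst (scheme M W a b D Cb x0 h (Suc n) \<omega>)) \<omega>)"

definition num_exit :: "'a measure \<Rightarrow> (real \<Rightarrow> 'a \<Rightarrow> real^'m::finite) \<Rightarrow> (real^'d::finite \<Rightarrow> real^'d)
     \<Rightarrow> (real^'d \<Rightarrow> real^'m^'d) \<Rightarrow> (real^'d) set \<Rightarrow> real \<Rightarrow> real^'d \<Rightarrow> real \<Rightarrow> real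
     \<Rightarrow> 'a \<Rightarrow> real" where
  "num_exit M W a b D Cb x0 T h \<omega> =
     (if \<exists>n. snd (scheme M W a b D Cb x0 h n \<omega>) \<notin> D
      then min (fst (scheme M W a b D Cb x0 h
                  (LEAST n. snd (scheme M W a b D Cb x0 h n \<omega>) \<notin> D) \<omega>)) T
      else T)"

definition cost :: "'a measure \<Rightarrow> (real \<Rightarrow> 'a \<Rightarrow> real^'m::finite) \<Rightarrow> (real^'d::finite \<Rightarrow> real^'d)
     \<Rightarrow> (real^'d \<Rightarrow> real^'m^'d) \<Rightarrow> (real^'d) set \<Rightarrow> real \<Rightarrow> real^'d \<Rightarrow> real \<Rightarrow> real
     \<Rightarrow> 'a \<Rightarrow> real" where
  "cost M W a b D Cb x0 T h \<omega> =
     integral {0 .. num_exit M W a b D Cb x0 T h \<omega>}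
       (\<lambda>t. 1 / stepsize D Cb h (Xbar M W a b D Cb x0 h t \<omega>))"

end

theory Submission
  imports Defs "HOL-Real_Asymp.Real_Asymp"
begin

text \<open>
  The cost is at most the number of steps made before the exit and before \<open>T\<close>. A step of size
  \<open>h\<^sup>2\<close> or \<open>h\<^sup>3\<close> occurs only in a boundary strip of width \<open>\<delta>\<^sub>1\<close> or \<open>\<delta>\<^sub>2\<close>, so the claim reduces to
  a bound of order \<open>\<delta>\<^sup>2\<close> for the expected time that the scheme spends in a strip of width \<open>\<delta>\<close>.

  That bound comes from the barrier \<open>1 / (\<delta> + min r K)\<close>, where \<open>r\<close> is the distance to the boundary,
  continued by \<open>2 / \<delta>\<close> outside \<open>D\<close>. Replacing \<open>r\<close> after the step by the distance to an exterior ball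
  that touches \<open>D\<close> at the nearest boundary point gives a lower bound for the new value, so no
  regularity of the distance function is needed. By ellipticity the second-order term dominates the
  drift, the curvature and the Taylor remainder as soon as the step is small compared with \<open>\<delta>\<^sup>2\<close>:
  the barrier is a submartingale that gains a multiple of \<open>\<Delta> / \<delta>\<^sup>3\<close> per step inside the strip.
  Since it is bounded by \<open>2 / \<delta>\<close>, the expected occupation time is of order \<open>\<delta>\<^sup>2\<close>. Only the second
  moments of the higher multiple integrals enter.
\<close>


section \<open>The uniform exterior ball condition\<close>

text \<open>The step sizes are balanced: with occupation times of order \<open>\<delta>1^2\<close>
  and \<open>\<delta>2^2\<close> the three counts \<open>T / h\<close>,
  \<open>\<delta>1^2 / h^2\<close> and \<open>\<delta>2^2 / h^3\<close> are all at most of order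
  \<open>ln (1 / h) / h\<close>. The logarithm also provides the smallness the barrier needs:
  \<open>h / \<delta>1^2\<close> and \<open>h^2 / \<delta>2^2\<close> decay like
  \<open>1 / ln (1 / h)\<close>, so fixed moments suffice where one might expect Gaussian tail
  estimates. The strips need different caps. Near the boundary at scale \<open>\<delta>1\<close>
  every step is at most \<open>h\<close>, and the cap is a fixed number; at scale
  \<open>\<delta>2\<close> the steps are small enough only inside the first strip, and the cap is
  \<open>\<delta>1\<close>. Two obstacles shape the probabilistic part. \<open>itoI\<close> is
  determined only up to null sets, so the scheme as defined need not be adapted; it is compared with
  one built from pathwise limits. And steps start at random times; as only three step sizes occur,
  the n-th time has finitely many values, and conditioning on it becomes a finite sum over
  deterministic times.\<close>

lemma pd_eqI: "(g has_derivative g') (at x) \<Longrightarrow> pd i g x = g' (axis i 1)"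
  unfolding pd_def by (simp add: frechet_derivative_at[symmetric])

lemma has_derivative_pd:
  fixes f :: "real^'n::finite \<Rightarrow> real"
  assumes "f differentiable (at x)"
  shows "(f has_derivative (\<lambda>h. \<Sum>i\<in>UNIV. h $ i * pd i f x)) (at x)"
proof -
  let ?f' = "frechet_derivative f (at x)"
  have f': "(f has_derivative ?f') (at x)" using assms frechet_derivative_works by blast
  then have lin: "linear ?f'" by (rule has_derivative_linear)
  have "?f' h = (\<Sum>i\<in>UNIV. h $ i * pd i f x)" for h
  proof -
    have "?f' h = ?f' (\<Sum>i\<in>UNIV. h $ i *\<^sub>R axis i 1)"
      by (simp add: basis_expansion[of h, unfolded scalar_mult_eq_scaleR])
    also have "\<dots> = (\<Sum>i\<in>UNIV. h $ i * pd i f x)"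
      by (simp add: linear_sum[OF lin] linear_scale[OF lin] pd_def)
    finally show ?thesis .
  qed
  with f' show ?thesis by (metis (no_types, lifting) ext)
qed

lemma pd_mult:
  fixes u v :: "real^'n::finite \<Rightarrow> real"
  assumes "u differentiable (at x)" "v differentiable (at x)"
  shows "pd i (\<lambda>x. u x * v x) x = u x * pd i v x + pd i u x * v x"
proof -
  have "((\<lambda>x. u x * v x) has_derivative
      (\<lambda>h. u x * frechet_derivative v (at x) h + frechet_derivative u (at x) h * v x)) (at x)"
    using assms by (intro has_derivative_mult) (auto simp: frechet_derivative_works[symmetric])
  from pd_eqI[OF this] show ?thesis by (simp add: pd_def)
qed

lemma pd_sum:
  fixes u :: "'i \<Rightarrow> real^'n::finite \<Rightarrow> real"
  assumes "\<And>k. k \<in> I \<Longrightarrow> u k differentiable (at x)"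
  shows "pd i (\<lambda>x. \<Sum>k\<in>I. u k x) x = (\<Sum>k\<in>I. pd i (u k) x)"
proof -
  have "((\<lambda>x. \<Sum>k\<in>I. u k x) has_derivative (\<lambda>h. \<Sum>k\<in>I. frechet_derivative (u k) (at x) h)) (at x)"
    using assms by (intro has_derivative_sum) (auto simp: frechet_derivative_works[symmetric])
  from pd_eqI[OF this] show ?thesis by (simp add: pd_def)
qed

lemma Ck_onD:
  assumes "Ck_on k U f"
  shows "length is < k \<Longrightarrow> x \<in> U \<Longrightarrow> pdl is f differentiable (at x)"
    and "length is \<le> k \<Longrightarrow> continuous_on U (pdl is f)"
  using assms unfolding Ck_on_def by auto

text \<open>One radius serves all boundary points; this makes the curvature term
  \<open>(norm y)^2 / (2 * R)\<close> of the one-step estimate uniform in the position.\<close>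

definition ball_exterior :: "('v::metric_space) set \<Rightarrow> real \<Rightarrow> bool" where
  "ball_exterior D R \<longleftrightarrow> 0 < R \<and> (\<forall>p\<in>frontier D. \<exists>c. dist p c = R \<and> ball c R \<inter> D = {})"

text \<open>By compactness the second partials are bounded on \<open>K\<close>, so each first
  partial is Lipschitz there. The mean value inequality, applied on the segment to
  \<open>\<phi>\<close> minus its tangent map at \<open>p\<close>, then gives a quadratic error in
  both directions, with one constant for all pairs.\<close>

lemma C2_below_tangent:
  fixes \<phi> :: "real^'n::finite \<Rightarrow> real"
  assumes "Ck_on 2 U \<phi>" "K \<subseteq> U" "compact K" "convex K"
  obtains C where "0 < C"
    "\<And>x p. x \<in> K \<Longrightarrow> p \<in> K \<Longrightarrow> \<bar>\<phi> x - \<phi> p - (\<Sum>i\<in>UNIV. (x - p) $ i * pd i \<phi> p)\<bar> \<le> C * (norm (x - p))\<^sup>2"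
proof -
  let ?n = "real CARD('n)"
  have d0: "\<phi> differentiable (at x)" if "x \<in> U" for x
    using Ck_onD(1)[OF assms(1), of "[]"] that by simp
  have d1: "pd i \<phi> differentiable (at x)" if "x \<in> U" for x i
    using Ck_onD(1)[OF assms(1), of "[i]"] that by simp
  have "continuous_on K (\<lambda>x. \<Sum>k\<in>UNIV. \<Sum>i\<in>UNIV. \<bar>pd k (pd i \<phi>) x\<bar>)"
    using Ck_onD(2)[OF assms(1), of "[_, _]"] continuous_on_subset[OF _ assms(2)]
    by (intro continuous_intros) (auto intro: continuous_on_subset[OF _ assms(2)])
  from compact_continuous_image[OF this assms(3), THEN compact_imp_bounded]
  obtain L0 where L0: "\<forall>x\<in>K. \<bar>\<Sum>k\<in>UNIV. \<Sum>i\<in>UNIV. \<bar>pd k (pd i \<phi>) x\<bar>\<bar> \<le> L0"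
    unfolding bounded_iff by auto
  define L where "L = max L0 1"
  have L: "(\<Sum>k\<in>UNIV. \<bar>pd k (pd i \<phi>) x\<bar>) \<le> L" if "x \<in> K" for x i
  proof -
    have "(\<Sum>k\<in>UNIV. \<bar>pd k (pd i \<phi>) x\<bar>) \<le> (\<Sum>k\<in>UNIV. \<Sum>i\<in>UNIV. \<bar>pd k (pd i \<phi>) x\<bar>)"
      by (intro sum_mono member_le_sum) auto
    with L0 that show ?thesis by (fastforce simp: L_def)
  qed
  have onorm_le: "onorm (\<lambda>h::real^'n. \<Sum>k\<in>UNIV. h $ k * c k) \<le> (\<Sum>k\<in>UNIV. \<bar>c k\<bar>)" for c :: "'n \<Rightarrow> real"
  proof (rule onorm_le)
    fix h :: "real^'n"
    have "norm (\<Sum>k\<in>UNIV. h $ k * c k) \<le> (\<Sum>k\<in>UNIV. \<bar>h $ k * c k\<bar>)" by (simp add: sum_abs)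
    also have "\<dots> \<le> (\<Sum>k\<in>UNIV. norm h * \<bar>c k\<bar>)"
      by (intro sum_mono) (auto simp: abs_mult component_le_norm_cart intro: mult_right_mono)
    finally show "norm (\<Sum>k\<in>UNIV. h $ k * c k) \<le> (\<Sum>k\<in>UNIV. \<bar>c k\<bar>) * norm h"
      by (simp add: sum_distrib_left mult.commute)
  qed
  have lip: "\<bar>pd i \<phi> y - pd i \<phi> p\<bar> \<le> L * norm (y - p)" if "y \<in> K" "p \<in> K" for i y p
  proof -
    have "norm (pd i \<phi> y - pd i \<phi> p) \<le> L * norm (y - p)"
    proof (rule differentiable_bound[OF assms(4)])
      fix x assume x: "x \<in> K"
      show "(pd i \<phi> has_derivative (\<lambda>h. \<Sum>k\<in>UNIV. h $ k * pd k (pd i \<phi>) x)) (at x within K)"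
        using has_derivative_pd[OF d1] x assms(2) by (blast intro: has_derivative_at_withinI)
      show "onorm (\<lambda>h. \<Sum>k\<in>UNIV. h $ k * pd k (pd i \<phi>) x) \<le> L"
        using onorm_le[of "\<lambda>k. pd k (pd i \<phi>) x"] L[OF x, of i] by linarith
    qed (use that in auto)
    then show ?thesis by simp
  qed
  show thesis
  proof (rule that[of "?n * L"])
    show "0 < ?n * L" by (simp add: L_def)
    fix x p assume xp: "x \<in> K" "p \<in> K"
    define \<psi> where "\<psi> = (\<lambda>y. \<phi> y - (\<Sum>i\<in>UNIV. (y - p) $ i * pd i \<phi> p))"
    have seg: "closed_segment p x \<subseteq> K" using assms(4) xp by (simp add: closed_segment_subset)
    have "norm (\<psi> x - \<psi> p) \<le> (?n * (L * norm (x - p))) * norm (x - p)"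
    proof (rule differentiable_bound[OF convex_closed_segment[of p x]])
      fix y assume y: "y \<in> closed_segment p x"
      then have yK: "y \<in> K" using seg by auto
      show "(\<psi> has_derivative (\<lambda>h. \<Sum>i\<in>UNIV. h $ i * (pd i \<phi> y - pd i \<phi> p))) (at y within closed_segment p x)"
      proof -
        define l where "l = (\<lambda>y::real^'n. \<Sum>i\<in>UNIV. y $ i * pd i \<phi> p)"
        have "linear l"
          by (rule linearI) (simp_all add: l_def distrib_right sum.distrib sum_distrib_left mult.assoc)
        then have "(l has_derivative l) (at y)" by (rule linear_imp_has_derivative)
        then have "((\<lambda>y. \<phi> y - (l y - l p)) has_derivative (\<lambda>h. (\<Sum>i\<in>UNIV. h $ i * pd i \<phi> y) - (l h - 0))) (at y)"
          using has_derivative_pd[OF d0] yK assms(2) by (intro has_derivative_diff has_derivative_const) auto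
        moreover have "(\<lambda>y. \<phi> y - (l y - l p)) = \<psi>"
          by (auto simp: l_def \<psi>_def left_diff_distrib sum_subtractf)
        ultimately have "(\<psi> has_derivative (\<lambda>h. (\<Sum>i\<in>UNIV. h $ i * pd i \<phi> y) - (\<Sum>i\<in>UNIV. h $ i * pd i \<phi> p))) (at y)"
          by (simp add: l_def)
        moreover have "(\<Sum>i\<in>UNIV. h $ i * (pd i \<phi> y - pd i \<phi> p)) =
            (\<Sum>i\<in>UNIV. h $ i * pd i \<phi> y) - (\<Sum>i\<in>UNIV. h $ i * pd i \<phi> p)" for h
          by (simp only: right_diff_distrib sum_subtractf)
        ultimately show ?thesis by (simp only: has_derivative_at_withinI)
      qed
      have "norm (y - p) \<le> norm (x - p)"
        using segment_bound(1)[OF y] by (simp add: norm_minus_commute)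
      then have "\<bar>pd i \<phi> y - pd i \<phi> p\<bar> \<le> L * norm (x - p)" for i
        using order_trans[OF lip[OF yK xp(2), of i] mult_left_mono] by (simp add: L_def)
      then have "(\<Sum>i\<in>UNIV. \<bar>pd i \<phi> y - pd i \<phi> p\<bar>) \<le> ?n * (L * norm (x - p))"
        using sum_bounded_above[of UNIV "\<lambda>i. \<bar>pd i \<phi> y - pd i \<phi> p\<bar>" "L * norm (x - p)"] by simp
      with onorm_le[of "\<lambda>i. pd i \<phi> y - pd i \<phi> p"]
      show "onorm (\<lambda>h. \<Sum>i\<in>UNIV. h $ i * (pd i \<phi> y - pd i \<phi> p)) \<le> ?n * (L * norm (x - p))" by linarith
    qed auto
    then show "\<bar>\<phi> x - \<phi> p - (\<Sum>i\<in>UNIV. (x - p) $ i * pd i \<phi> p)\<bar> \<le> ?n * L * (norm (x - p))\<^sup>2"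
      by (simp add: \<psi>_def power2_eq_square mult.assoc)
  qed
qed

text \<open>The centre is \<open>p + R n\<close> with \<open>n\<close> the normalised gradient.
  Membership of \<open>x\<close> in the ball, squared, reads
  \<open>|x - p|^2 < 2 R (n \<bullet> (x - p))\<close>: the linear term of \<open>\<phi>\<close> at
  \<open>p\<close> beats the quadratic Taylor error once \<open>R\<close> is small. Only
  \<open>0 \<le> \<phi> p\<close> enters, so the argument covers all nearby points outside
  \<open>D\<close>.\<close>

lemma exterior_ball_local:
  fixes D :: "(real^'n::finite) set"
  assumes "Ck_on 2 (ball p0 r) \<phi>" "0 < r" "\<And>x. x \<in> ball p0 r \<Longrightarrow> \<exists>i. pd i \<phi> x \<noteq> 0"
    and D: "D \<inter> ball p0 r = {x\<in>ball p0 r. \<phi> x < 0}"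
  obtains R0 where "0 < R0" "\<And>p R. p \<in> ball p0 (r/4) \<Longrightarrow> p \<notin> D \<Longrightarrow> 0 < R \<Longrightarrow> R \<le> R0 \<Longrightarrow>
     \<exists>c. dist p c = R \<and> ball c R \<inter> D = {}"
proof -
  let ?K = "cball p0 (r/2)"
  have KU: "?K \<subseteq> ball p0 r" using assms(2) by auto
  obtain C where C: "0 < C" "\<And>x p. x \<in> ?K \<Longrightarrow> p \<in> ?K \<Longrightarrow>
      \<bar>\<phi> x - \<phi> p - (\<Sum>i\<in>UNIV. (x - p) $ i * pd i \<phi> p)\<bar> \<le> C * (norm (x - p))\<^sup>2"
    by (rule C2_below_tangent[OF assms(1) KU]) auto
  define g where "g = (\<lambda>x. (\<chi> i. pd i \<phi> x))"
  have "continuous_on ?K (\<lambda>x. norm (g x))"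
    unfolding g_def using Ck_onD(2)[OF assms(1), of "[_]"]
    by (intro continuous_intros) (auto intro: continuous_on_subset[OF _ KU])
  moreover have "?K \<noteq> {}" using assms(2) by auto
  ultimately obtain x1 where x1: "x1 \<in> ?K" "\<And>x. x \<in> ?K \<Longrightarrow> norm (g x1) \<le> norm (g x)"
    using continuous_attains_inf[of ?K "\<lambda>x. norm (g x)"] by auto
  define m where "m = norm (g x1)"
  have "g x1 \<noteq> 0" using assms(3)[of x1] x1(1) KU by (auto simp: g_def vec_eq_iff)
  then have m: "0 < m" by (simp add: m_def)
  \<comment> \<open>The bound \<open>r/8\<close> keeps the ball inside \<open>?K\<close>, as
    \<open>r/4 + r/8 + r/8 = r/2\<close>; the bound \<open>m / (2 * C)\<close> makes the gradient,
    of norm at least \<open>m\<close>, dominate the Taylor error.\<close>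
  show thesis
  proof (rule that[of "min (r/8) (m / (2 * C))"])
    show "0 < min (r/8) (m / (2 * C))" using assms(2) m C by simp
    fix p R assume p: "p \<in> ball p0 (r/4)" "p \<notin> D" and R: "0 < R" "R \<le> min (r/8) (m / (2 * C))"
    define n where "n = (1 / norm (g p)) *\<^sub>R g p"
    have pK: "p \<in> ?K" using p assms(2) by auto
    have gp: "m \<le> norm (g p)" using x1(2)[OF pK] by (simp add: m_def)
    then have "g p \<noteq> 0" using m by auto
    then have n: "norm n = 1" "g p = norm (g p) *\<^sub>R n" by (auto simp: n_def)
    define c where "c = p + R *\<^sub>R n"
    have "x \<notin> D" if x: "x \<in> ball c R" for x
    proof -
      have "norm (x - p - R *\<^sub>R n) < R"
        using x by (simp add: c_def dist_norm norm_minus_commute algebra_simps)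
      then have "(norm (x - p - R *\<^sub>R n))\<^sup>2 < R\<^sup>2" using R by (intro power_strict_mono) auto
      moreover have "(norm (u - R *\<^sub>R n))\<^sup>2 = (norm u)\<^sup>2 - 2 * R * (n \<bullet> u) + R\<^sup>2" for u
        using n(1) unfolding power2_norm_eq_inner norm_eq_1
        by (simp add: inner_diff_left inner_diff_right inner_commute power2_eq_square)
      ultimately have q: "(norm (x - p))\<^sup>2 < 2 * R * (n \<bullet> (x - p))" by simp
      have dc: "dist p c = R" using n R by (simp add: c_def dist_norm)
      have "dist p0 x \<le> dist p0 p + (dist p c + dist c x)"
        by (meson add_left_mono dist_triangle order_trans)
      then have xK: "x \<in> ?K" using p x R dc by auto
      have "p \<in> ball p0 r" using pK KU by auto
      then have "0 \<le> \<phi> p" using p(2) D by force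
      have "R * (2 * C) \<le> m" using R C by (simp add: pos_le_divide_eq)
      then have "C * (norm (x - p))\<^sup>2 * (2 * R) \<le> m * (norm (x - p))\<^sup>2"
        using mult_right_mono[of "R * (2 * C)" m "(norm (x - p))\<^sup>2"] by (simp add: mult_ac)
      also have "\<dots> \<le> norm (g p) * (2 * R * (n \<bullet> (x - p)))"
        using gp q m by (intro mult_mono) auto
      finally have "C * (norm (x - p))\<^sup>2 * (2 * R) \<le> (norm (g p) * (n \<bullet> (x - p))) * (2 * R)" by (simp add: mult_ac)
      then have "C * (norm (x - p))\<^sup>2 \<le> norm (g p) * (n \<bullet> (x - p))" using R by simp
      also have "\<dots> = g p \<bullet> (x - p)" by (subst (2) n(2)) simp
      also have "\<dots> = (\<Sum>i\<in>UNIV. (x - p) $ i * pd i \<phi> p)"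
        by (simp add: inner_vec_def g_def mult.commute)
      finally have "0 \<le> \<phi> x" using C(2)[OF xK pK] \<open>0 \<le> \<phi> p\<close> by linarith
      moreover have "x \<in> ball p0 r" using xK KU by auto
      ultimately show ?thesis using D by force
    qed
    moreover have "dist p c = R" using n R by (simp add: c_def dist_norm)
    ultimately show "\<exists>c. dist p c = R \<and> ball c R \<inter> D = {}" by blast
  qed
qed

text \<open>The local lemma allows every radius up to its bound, so the minimum over a finite
  subcover of the compact boundary works everywhere.\<close>

lemma Ck_domain_ball_exterior:
  fixes D :: "(real^'n::finite) set"
  assumes "Ck_domain 4 D"
  obtains R where "ball_exterior D R"
proof -
  have D: "open D" "bounded D" using assms by (auto simp: Ck_domain_def)
  have "\<exists>e R0. 0 < e \<and> 0 < R0 \<and> (\<forall>p R. p \<in> ball p0 e \<longrightarrow> p \<notin> D \<longrightarrow> 0 < R \<longrightarrow> R \<le> R0 \<longrightarrow>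
     (\<exists>c. dist p c = R \<and> ball c R \<inter> D = {}))" if "p0 \<in> frontier D" for p0
  proof -
    from assms that obtain r \<phi> where r: "0 < r" "Ck_on 4 (ball p0 r) \<phi>"
      "\<forall>x\<in>ball p0 r. \<exists>i. pd i \<phi> x \<noteq> 0" "D \<inter> ball p0 r = {x\<in>ball p0 r. \<phi> x < 0}"
      unfolding Ck_domain_def by blast
    have "Ck_on 2 (ball p0 r) \<phi>" using r(2) by (auto simp: Ck_on_def)
    then show ?thesis
    proof (rule exterior_ball_local[OF _ r(1) _ r(4)])
      show "\<exists>i. pd i \<phi> x \<noteq> 0" if "x \<in> ball p0 r" for x using r(3) that by blast
      fix R0 assume "0 < R0" "\<And>p R. p \<in> ball p0 (r/4) \<Longrightarrow> p \<notin> D \<Longrightarrow> 0 < R \<Longrightarrow> R \<le> R0 \<Longrightarrow>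
        \<exists>c. dist p c = R \<and> ball c R \<inter> D = {}"
      then show ?thesis using r(1) by (intro exI[of _ "r/4"] exI[of _ R0]) auto
    qed
  qed
  then obtain e R0 where eR: "\<And>p0. p0 \<in> frontier D \<Longrightarrow> 0 < e p0 \<and> 0 < R0 p0 \<and>
     (\<forall>p R. p \<in> ball p0 (e p0) \<longrightarrow> p \<notin> D \<longrightarrow> 0 < R \<longrightarrow> R \<le> R0 p0 \<longrightarrow> (\<exists>c. dist p c = R \<and> ball c R \<inter> D = {}))"
    by metis
  have cpt: "compact (frontier D)" using D by (simp add: compact_frontier_bounded)
  have cov: "frontier D \<subseteq> (\<Union>p\<in>frontier D. ball p (e p))" using eR by force
  obtain P where P: "P \<subseteq> frontier D" "finite P" "frontier D \<subseteq> (\<Union>p\<in>P. ball p (e p))"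
    by (rule compactE_image[OF cpt _ cov]) auto
  define R where "R = Min (insert 1 (R0 ` P))"
  have "0 < R" unfolding R_def using P eR by (subst Min_gr_iff) auto
  moreover have "\<exists>c. dist p c = R \<and> ball c R \<inter> D = {}" if p: "p \<in> frontier D" for p
  proof -
    obtain p0 where p0: "p0 \<in> P" "p \<in> ball p0 (e p0)" using P p by blast
    have "R \<le> R0 p0" unfolding R_def using P p0 by (intro Min_le) auto
    moreover have "p \<notin> D" using p D by (simp add: frontier_def interior_open)
    ultimately show ?thesis using eR[of p0] p0 P \<open>0 < R\<close> by blast
  qed
  ultimately have "ball_exterior D R" by (auto simp: ball_exterior_def)
  then show thesis by (rule that)
qed

text \<open>A segment from a point of \<open>D\<close> to the centre \<open>c\<close> crosses the
  boundary, at a point outside the exterior ball; this costs at least the distance to the boundary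
  plus \<open>R\<close>. At \<open>x\<close> there is equality, because \<open>c\<close> belongs to
  the boundary point nearest to \<open>x\<close>. So \<open>dist _ c - R\<close> is a smooth
  majorant of the boundary distance on \<open>D\<close> that touches it at \<open>x\<close>.\<close>

lemma ball_exterior_infdist:
  fixes D :: "('v::euclidean_space) set"
  assumes R: "ball_exterior D R" and D: "open D" "bounded D" and x: "x \<in> D"
  obtains c where "dist x c = infdist x (frontier D) + R"
    "\<And>y. y \<in> D \<Longrightarrow> infdist y (frontier D) + R \<le> dist y c"
proof -
  have "D \<noteq> UNIV" using D(2) by auto
  then have ne: "frontier D \<noteq> {}" using x by (auto simp: frontier_eq_empty)
  obtain p where p: "p \<in> frontier D" "infdist x (frontier D) = dist x p"
    using infdist_attains_inf[OF frontier_closed ne, of x] by auto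
  obtain c where c: "dist p c = R" "ball c R \<inter> D = {}" using R p(1) by (auto simp: ball_exterior_def)
  have R0: "0 < R" using R by (simp add: ball_exterior_def)
  have far: "infdist y (frontier D) + R \<le> dist y c" if y: "y \<in> D" for y
  proof -
    have "c \<notin> D" using c R0 by (metis centre_in_ball disjoint_iff)
    then have "closed_segment y c \<inter> frontier D \<noteq> {}"
      using y by (intro connected_Int_frontier) auto
    then obtain f where f: "f \<in> closed_segment y c" "f \<in> frontier D" by auto
    have "ball c R \<inter> closure D = {}" using c(2) open_Int_closure_eq_empty[of "ball c R" D] by auto
    then have "f \<notin> ball c R" using f(2) by (auto simp: frontier_def)
    then have "R \<le> dist f c" by (simp add: dist_commute)
    moreover have "dist y c = dist y f + dist f c"
      using f(1) by (metis between between_mem_segment)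
    moreover have "infdist y (frontier D) \<le> dist y f" using f(2) by (rule infdist_le)
    ultimately show ?thesis by linarith
  qed
  have "dist x c \<le> infdist x (frontier D) + R" using dist_triangle[of x c p] c p by simp
  with far[OF x] have "dist x c = infdist x (frontier D) + R" by simp
  with far show thesis using that by blast
qed

section \<open>Coefficients and the Taylor remainder\<close>

lemma C3_simps:
  assumes "Ck_on 3 UNIV f"
  shows "continuous_on UNIV f" "continuous_on UNIV (pd i f)" "continuous_on UNIV (pd i (pd k f))"
    "f differentiable (at x)" "pd i f differentiable (at x)"
  using Ck_onD[OF assms, of "[]"] Ck_onD[OF assms, of "[i]"] Ck_onD[OF assms, of "[i, k]"] by auto

lemma borel_measurable_vec_iff:
  fixes f :: "'a \<Rightarrow> real^'n::finite"
  shows "f \<in> borel_measurable M \<longleftrightarrow> (\<forall>i. (\<lambda>x. f x $ i) \<in> borel_measurable M)"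
proof -
  have "f \<in> borel_measurable M \<longleftrightarrow> (\<forall>i\<in>(Basis::(real^'n) set). (\<lambda>x. f x \<bullet> i) \<in> borel_measurable M)"
    by (rule borel_measurable_euclidean_space)
  also have "\<dots> \<longleftrightarrow> (\<forall>i. (\<lambda>x. f x $ i) \<in> borel_measurable M)"
    by (auto simp: Basis_vec_def inner_axis)
  finally show ?thesis .
qed

lemma borel_measurable_vec_nth [measurable (raw)]:
  fixes f :: "'a \<Rightarrow> real^'n::finite"
  assumes "f \<in> borel_measurable M"
  shows "(\<lambda>x. f x $ i) \<in> borel_measurable M"
  using assms borel_measurable_vec_iff by blast

locale smooth_coefficients =
  fixes a :: "real^'d::finite \<Rightarrow> real^'d"
    and b :: "real^'d \<Rightarrow> real^'m::finite^'d"
  assumes a_C3: "Ck_on 3 UNIV (\<lambda>x. a x $ i)"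
    and b_C3: "Ck_on 3 UNIV (\<lambda>x. b x $ i $ j)"
begin

lemma continuous_a: "continuous_on UNIV (\<lambda>x. a x $ i)"
  by (rule C3_simps[OF a_C3])

lemma continuous_b: "continuous_on UNIV (\<lambda>x. b x $ i $ j)"
  by (rule C3_simps[OF b_C3])

lemma continuous_Lj:
  assumes "Ck_on 3 UNIV f"
  shows "continuous_on UNIV (Lj b j f)"
  unfolding Lj_def[abs_def]
  by (intro continuous_intros continuous_b C3_simps[OF assms])

lemma continuous_L0:
  assumes "Ck_on 3 UNIV f"
  shows "continuous_on UNIV (L0 a b f)"
  unfolding L0_def[abs_def]
  by (intro continuous_intros continuous_a continuous_b C3_simps[OF assms])

lemma continuous_Lj_Lj:
  assumes f: "Ck_on 3 UNIV f"
  shows "continuous_on UNIV (Lj b j (Lj b l f))"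
proof -
  note b_diff = C3_simps(4)[OF b_C3]
  have "pd i (Lj b l f) x = (\<Sum>k\<in>UNIV. b x $ k $ l * pd i (pd k f) x + pd i (\<lambda>x. b x $ k $ l) x * pd k f x)" for i x
    unfolding Lj_def[abs_def]
    by (subst pd_sum) (auto intro!: differentiable_mult b_diff C3_simps[OF f] sum.cong pd_mult)
  then show ?thesis
    unfolding Lj_def[of b j, abs_def]
    by (simp, intro continuous_intros continuous_b C3_simps[OF f] C3_simps[OF b_C3])
qed

lemma taylor15_measurable:
  assumes X: "X \<in> N \<rightarrow>\<^sub>M borel" and [measurable]: "\<Delta> \<in> borel_measurable N" "\<And>js. I js \<in> borel_measurable N"
  shows "(\<lambda>\<omega>. taylor15 a b (X \<omega>) (\<Delta> \<omega>) (\<lambda>js. I js \<omega>)) \<in> N \<rightarrow>\<^sub>M borel"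
proof -
  note X[measurable]
  have comp: "(\<lambda>\<omega>. g (X \<omega>)) \<in> borel_measurable N" if "continuous_on UNIV g" for g :: "real^'d \<Rightarrow> real"
    using measurable_compose[OF X borel_measurable_continuous_onI[OF that]] .
  note [measurable] = comp[OF continuous_a] comp[OF continuous_b] comp[OF continuous_Lj[OF a_C3]]
    comp[OF continuous_Lj[OF b_C3]] comp[OF continuous_L0[OF a_C3]] comp[OF continuous_L0[OF b_C3]]
    comp[OF continuous_Lj_Lj[OF b_C3]]
  have [measurable]: "(\<lambda>\<omega>. X \<omega> $ i) \<in> borel_measurable N" for i
    by (rule comp) (intro continuous_intros)
  have "(\<lambda>\<omega>. taylor15 a b (X \<omega>) (\<Delta> \<omega>) (\<lambda>js. I js \<omega>) $ i) \<in> borel_measurable N" for i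
    unfolding taylor15_def by simp measurable
  then show ?thesis by (simp add: borel_measurable_vec_iff)
qed

section \<open>Size of the non-Gaussian part of a step\<close>

definition remainder_bound :: "real^'d \<Rightarrow> real" where
  "remainder_bound x = (\<Sum>i\<in>UNIV. \<bar>a x $ i\<bar> + \<bar>1/2 * L0 a b (\<lambda>y. a y $ i) x\<bar>
      + (\<Sum>j\<in>UNIV. \<bar>Lj b j (\<lambda>y. a y $ i) x\<bar> + \<bar>L0 a b (\<lambda>y. b y $ i $ j) x\<bar>)
      + (\<Sum>j1\<in>UNIV. \<Sum>j2\<in>UNIV. \<bar>Lj b j1 (\<lambda>y. b y $ i $ j2) x\<bar>)
      + (\<Sum>j1\<in>UNIV. \<Sum>j2\<in>UNIV. \<Sum>j3\<in>UNIV. \<bar>Lj b j1 (Lj b j2 (\<lambda>y. b y $ i $ j3)) x\<bar>))"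

lemma continuous_remainder_bound: "continuous_on UNIV remainder_bound"
  unfolding remainder_bound_def[abs_def]
  by (intro continuous_intros continuous_a continuous_Lj_Lj continuous_Lj continuous_L0 a_C3 b_C3)

definition higher :: "'m option list set" where
  "higher = {js. length js = 2} \<union> {js. length js = 3}"

lemma finite_higher: "finite higher"
  using finite_lists_length_eq[of "UNIV :: 'm option set"] by (auto simp: higher_def)

text \<open>Apart from the diffusion term, which is the Gaussian part and is treated exactly, every
  summand is a coefficient times \<open>\<Delta>\<close>, \<open>\<Delta>^2\<close> or an integral
  with at least two indices. Each of these factors is dominated by the one sum on the right, whose
  mean is of order \<open>\<Delta>\<close> and whose mean square is of order
  \<open>\<Delta>^2\<close>.\<close>

lemma taylor15_remainder:
  assumes "0 \<le> \<Delta>" "\<Delta> \<le> 1"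
  shows "norm (taylor15 a b x \<Delta> Iv - x - b x *v (\<chi> j. Iv [Some j]))
    \<le> remainder_bound x * (\<Delta> + (\<Sum>js\<in>higher. \<bar>Iv js\<bar>))"
proof -
  define S where "S = \<Delta> + (\<Sum>js\<in>higher. \<bar>Iv js\<bar>)"
  have D: "\<bar>\<Delta>\<bar> \<le> S" "\<bar>\<Delta>\<^sup>2\<bar> \<le> S"
  proof -
    have "0 \<le> (\<Sum>js\<in>higher. \<bar>Iv js\<bar>)" by (intro sum_nonneg) auto
    moreover have "\<Delta>\<^sup>2 \<le> \<Delta>" using assms by (simp add: power2_eq_square mult_left_le)
    moreover have "\<bar>\<Delta>\<^sup>2\<bar> = \<Delta>\<^sup>2" by simp
    ultimately show "\<bar>\<Delta>\<bar> \<le> S" "\<bar>\<Delta>\<^sup>2\<bar> \<le> S" using assms unfolding S_def by linarith+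
  qed
  have I: "\<bar>Iv js\<bar> \<le> S" if "js \<in> higher" for js
    using member_le_sum[OF that, of "\<lambda>js. \<bar>Iv js\<bar>"] finite_higher assms by (auto simp: S_def)
  have m: "\<bar>c * t\<bar> \<le> \<bar>c\<bar> * S" if "\<bar>t\<bar> \<le> S" for c t
    using that by (simp add: abs_mult mult_left_mono)
  let ?v = "taylor15 a b x \<Delta> Iv - x - b x *v (\<chi> j. Iv [Some j])"
  have "\<bar>?v $ i\<bar> \<le> \<bar>a x $ i\<bar> * S + \<bar>1/2 * L0 a b (\<lambda>y. a y $ i) x\<bar> * S
      + (\<Sum>j\<in>UNIV. \<bar>Lj b j (\<lambda>y. a y $ i) x\<bar> * S + \<bar>L0 a b (\<lambda>y. b y $ i $ j) x\<bar> * S)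
      + (\<Sum>j1\<in>UNIV. \<Sum>j2\<in>UNIV. \<bar>Lj b j1 (\<lambda>y. b y $ i $ j2) x\<bar> * S)
      + (\<Sum>j1\<in>UNIV. \<Sum>j2\<in>UNIV. \<Sum>j3\<in>UNIV. \<bar>Lj b j1 (Lj b j2 (\<lambda>y. b y $ i $ j3)) x\<bar> * S)" (is "_ \<le> ?r i") for i
  proof -
    have "?v $ i = a x $ i * \<Delta> + 1/2 * L0 a b (\<lambda>y. a y $ i) x * \<Delta>\<^sup>2
      + (\<Sum>j\<in>UNIV. Lj b j (\<lambda>y. a y $ i) x * Iv [Some j, None]
                   + L0 a b (\<lambda>y. b y $ i $ j) x * Iv [None, Some j])
      + (\<Sum>j1\<in>UNIV. \<Sum>j2\<in>UNIV. Lj b j1 (\<lambda>y. b y $ i $ j2) x * Iv [Some j1, Some j2])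
      + (\<Sum>j1\<in>UNIV. \<Sum>j2\<in>UNIV. \<Sum>j3\<in>UNIV.
           Lj b j1 (Lj b j2 (\<lambda>y. b y $ i $ j3)) x * Iv [Some j1, Some j2, Some j3])"
      by (simp add: taylor15_def matrix_vector_mult_def)
    then show ?thesis
      by (simp only:) (intro order_trans[OF abs_triangle_ineq] add_mono order_trans[OF sum_abs] sum_mono m D I; simp add: higher_def)
  qed
  then have "(\<Sum>i\<in>UNIV. \<bar>?v $ i\<bar>) \<le> (\<Sum>i\<in>UNIV. ?r i)" by (intro sum_mono)
  also have "\<dots> = remainder_bound x * S"
    unfolding remainder_bound_def by (simp only: sum_distrib_right distrib_right)
  finally show ?thesis
    using norm_le_l1_cart[of ?v] unfolding S_def by linarith
qed

lemma diffusion_bound: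
  "norm (b x *v w) \<le> (\<Sum>i\<in>UNIV. \<Sum>j\<in>UNIV. \<bar>b x $ i $ j\<bar>) * (\<Sum>j\<in>UNIV. \<bar>w $ j\<bar>)"
proof -
  have "\<bar>(b x *v w) $ i\<bar> \<le> (\<Sum>j\<in>UNIV. \<bar>b x $ i $ j\<bar>) * (\<Sum>j\<in>UNIV. \<bar>w $ j\<bar>)" for i
  proof -
    have "\<bar>(b x *v w) $ i\<bar> \<le> (\<Sum>j\<in>UNIV. \<bar>b x $ i $ j * w $ j\<bar>)"
      unfolding matrix_vector_mult_def by (simp add: sum_abs)
    also have "\<dots> \<le> (\<Sum>j\<in>UNIV. \<bar>b x $ i $ j\<bar> * (\<Sum>j\<in>UNIV. \<bar>w $ j\<bar>))"
      unfolding abs_mult by (intro sum_mono mult_left_mono member_le_sum) auto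
    finally show ?thesis by (simp add: sum_distrib_right)
  qed
  then have "(\<Sum>i\<in>UNIV. \<bar>(b x *v w) $ i\<bar>) \<le> (\<Sum>i\<in>UNIV. (\<Sum>j\<in>UNIV. \<bar>b x $ i $ j\<bar>) * (\<Sum>j\<in>UNIV. \<bar>w $ j\<bar>))"
    by (intro sum_mono)
  with norm_le_l1_cart[of "b x *v w"] show ?thesis by (simp add: sum_distrib_right)
qed

lemma coefficient_bound:
  assumes "bounded D"
  obtains B where "1 \<le> B" "\<And>x. x \<in> D \<Longrightarrow> remainder_bound x \<le> B"
    "\<And>x. x \<in> D \<Longrightarrow> (\<Sum>i\<in>UNIV. \<Sum>j\<in>UNIV. \<bar>b x $ i $ j\<bar>) \<le> B"
proof -
  have cpt: "compact (closure D)" using assms by (simp add: compact_closure)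
  let ?g = "\<lambda>x. \<bar>remainder_bound x\<bar> + (\<Sum>i\<in>UNIV. \<Sum>j\<in>UNIV. \<bar>b x $ i $ j\<bar>)"
  have "continuous_on (closure D) ?g"
    by (rule continuous_on_subset[where s=UNIV]) (auto intro!: continuous_intros continuous_remainder_bound continuous_b)
  from compact_continuous_image[OF this cpt, THEN compact_imp_bounded]
  obtain B where B: "\<forall>x\<in>closure D. \<bar>?g x\<bar> \<le> B" unfolding bounded_iff by auto
  have 0: "0 \<le> (\<Sum>i\<in>UNIV. \<Sum>j\<in>UNIV. \<bar>b x $ i $ j\<bar>)" for x by (intro sum_nonneg) auto
  show thesis
  proof (rule that[of "max B 1"])
    fix x assume "x \<in> D"
    then have "\<bar>?g x\<bar> \<le> B" using B closure_subset by blast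
    with 0[of x] show "remainder_bound x \<le> max B 1" "(\<Sum>i\<in>UNIV. \<Sum>j\<in>UNIV. \<bar>b x $ i $ j\<bar>) \<le> max B 1"
      by linarith+
  qed simp
qed

end

section \<open>A barrier near the boundary\<close>

text \<open>The cap \<open>K\<close> makes the barrier minimal where the step need not be small compared with \<open>\<delta>\<^sup>2\<close>, so that
  it cannot decrease there; it only increases the value after a step.\<close>

definition pot :: "('v::metric_space) set \<Rightarrow> real \<Rightarrow> real \<Rightarrow> 'v \<Rightarrow> real" where
  "pot D \<delta> K x = (if x \<in> D then 1 / (\<delta> + min (infdist x (frontier D)) K) else 2 / \<delta>)"

lemma pot_bounds:
  assumes "0 < \<delta>" "0 < K"
  shows "0 \<le> pot D \<delta> K x" "pot D \<delta> K x \<le> 2 / \<delta>"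
proof -
  have "0 \<le> min (infdist x (frontier D)) K" using assms infdist_nonneg[of x "frontier D"] by simp
  then have "1 / (\<delta> + min (infdist x (frontier D)) K) \<le> 2 / \<delta>"
    using assms by (intro frac_le) auto
  moreover have "0 \<le> 1 / (\<delta> + min (infdist x (frontier D)) K)"
    using \<open>0 \<le> min _ _\<close> assms by simp
  ultimately show "0 \<le> pot D \<delta> K x" "pot D \<delta> K x \<le> 2 / \<delta>"
    using assms by (auto simp: pot_def)
qed

lemma pot_min:
  assumes "0 < \<delta>" "0 < K"
  shows "1 / (\<delta> + K) \<le> pot D \<delta> K x"
proof -
  have "0 \<le> min (infdist x (frontier D)) K" using assms infdist_nonneg[of x "frontier D"] by simp
  then have "1 / (\<delta> + K) \<le> 1 / (\<delta> + min (infdist x (frontier D)) K)" using assms by (intro frac_le) auto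
  moreover have "1 / (\<delta> + K) \<le> 2 / \<delta>" using assms by (intro frac_le) auto
  ultimately show ?thesis by (auto simp: pot_def)
qed

lemma pot_measurable [measurable]:
  fixes D :: "('v::euclidean_space) set"
  assumes "open D"
  shows "pot D \<delta> K \<in> borel_measurable borel"
proof -
  have [measurable]: "D \<in> sets borel" using assms by simp
  have [measurable]: "(\<lambda>x. infdist x (frontier D)) \<in> borel_measurable borel"
    by (intro borel_measurable_continuous_onI continuous_intros)
  show ?thesis unfolding pot_def[abs_def] by measurable
qed

text \<open>\<open>q\<close> stands for the barrier after the step. For small \<open>\<eta>\<close>
  the identity \<open>1 / (z + \<eta>) = 1 / z - \<eta> / z^2 + \<eta>^2 / (z^2 (z +
  \<eta>))\<close> and \<open>z + \<eta> \<le> 2 z\<close> give the quadratic gain. For large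
  \<open>\<eta>\<close> nothing but \<open>0 \<le> q\<close> is known, and the correction makes the
  left side nonpositive: \<open>z \<le> 2 |\<eta>|\<close> bounds \<open>z^2\<close> by
  \<open>4 \<eta>^2\<close> and \<open>- \<eta> z\<close> by \<open>2 \<eta>^2\<close>, and one more
  \<open>\<eta>^2\<close> pays for the gain, whence 7.\<close>

lemma reciprocal_expansion:
  fixes z \<eta> q :: real
  assumes "0 < z" "0 \<le> q" "\<bar>\<eta>\<bar> \<le> z / 2 \<Longrightarrow> 1 / (z + \<eta>) \<le> q"
  shows "1 / z - \<eta> / z^2 + \<eta>^2 / (2 * z^3) - (if \<bar>\<eta>\<bar> \<le> z / 2 then 0 else 7 * \<eta>^2 / z^3) \<le> q"
proof (cases "\<bar>\<eta>\<bar> \<le> z / 2")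
  case True
  then have p: "0 < z + \<eta>" "z + \<eta> \<le> 2 * z" using assms(1) by auto
  have "1 / (z + \<eta>) = 1 / z - \<eta> / z^2 + \<eta>^2 / (z^2 * (z + \<eta>))"
    using assms(1) p by (simp add: divide_simps power2_eq_square) (simp add: algebra_simps)
  moreover have "\<eta>^2 / (2 * z^3) \<le> \<eta>^2 / (z^2 * (z + \<eta>))"
    using p assms(1) by (intro divide_left_mono) (auto simp: power3_eq_cube power2_eq_square)
  ultimately show ?thesis using assms(3)[OF True] True by simp
next
  case False
  then have n: "z \<le> 2 * \<bar>\<eta>\<bar>" by simp
  have "1 / z - \<eta> / z^2 \<le> 6 * \<eta>^2 / z^3"
  proof -
    have "z * z \<le> (2 * \<bar>\<eta>\<bar>) * (2 * \<bar>\<eta>\<bar>)" using n assms(1) by (intro mult_mono) auto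
    moreover have "- \<eta> * z \<le> \<bar>\<eta>\<bar> * (2 * \<bar>\<eta>\<bar>)" using n assms(1) by (intro mult_mono) auto
    ultimately have "z * z - \<eta> * z \<le> 6 * \<eta>^2" by (simp add: power2_eq_square)
    then have "(z * z - \<eta> * z) / z^3 \<le> 6 * \<eta>^2 / z^3" using assms(1) by (intro divide_right_mono) auto
    moreover have "(z * z - \<eta> * z) / z^3 = 1 / z - \<eta> / z^2"
      using assms(1) by (simp add: field_simps power2_eq_square power3_eq_cube)
    ultimately show ?thesis by simp
  qed
  moreover have "7 * \<eta>^2 / z^3 = 6 * \<eta>^2 / z^3 + \<eta>^2 / z^3" "\<eta>^2 / (2 * z^3) \<le> \<eta>^2 / z^3"
    using assms(1) by (auto simp: field_simps)
  ultimately show ?thesis using False assms(2) by simp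
qed

text \<open>The Gaussian part \<open>G\<close> of the displacement is cut off through its fourth moment, the remaining
  part \<open>U\<close> only needs a second moment.\<close>

lemma reciprocal_lower_bound:
  fixes z G U q :: real
  assumes "0 < z" "0 \<le> q" "\<bar>G + U\<bar> \<le> z / 2 \<Longrightarrow> 1 / (z + (G + U)) \<le> q"
  shows "1 / z - (G + U) / z^2 + G^2 / (4 * z^3) - 29 * U^2 / z^3 - 448 * G^4 / z^5 \<le> q"
proof -
  let ?\<eta> = "G + U"
  have "1 / z - ?\<eta> / z^2 + ?\<eta>^2 / (2 * z^3) - (if \<bar>?\<eta>\<bar> \<le> z / 2 then 0 else 7 * ?\<eta>^2 / z^3) \<le> q"
    by (rule reciprocal_expansion[OF assms])
  moreover have "G^2 / (4 * z^3) - U^2 / z^3 \<le> ?\<eta>^2 / (2 * z^3)"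
  proof -
    have "G^2 - 4 * U^2 \<le> 2 * ?\<eta>^2"
    proof -
      have "(G + 2 * U)^2 = G^2 + 4 * (G * U) + 4 * U^2" "?\<eta>^2 = G^2 + 2 * (G * U) + U^2"
        by (simp_all add: power2_eq_square algebra_simps)
      then show ?thesis using zero_le_power2[of "G + 2 * U"] zero_le_power2[of U] by linarith
    qed
    then have "(G^2 - 4 * U^2) / (4 * z^3) \<le> 2 * ?\<eta>^2 / (4 * z^3)" using assms(1) by (intro divide_right_mono) auto
    then show ?thesis by (simp add: diff_divide_distrib)
  qed
  \<comment> \<open>On \<open>|G + U| > z / 2\<close> the larger of \<open>G\<close> and
    \<open>U\<close> carries the displacement. If it is \<open>U\<close>, then
    \<open>(G + U)^2 \<le> 4 U^2\<close>; if it is \<open>G\<close>, then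
    \<open>z \<le> 4 |G|\<close>, and \<open>4 G^2\<close> is at most \<open>64 G^4 / z^2\<close>.
    Multiplying by 7 gives 28 and 448; the 29 of the statement includes the \<open>U^2\<close> lost
    in the quadratic term above.\<close>
  moreover have "(if \<bar>?\<eta>\<bar> \<le> z / 2 then 0 else 7 * ?\<eta>^2 / z^3) \<le> 28 * U^2 / z^3 + 448 * G^4 / z^5"
  proof (cases "\<bar>?\<eta>\<bar> \<le> z / 2")
    case True then show ?thesis using assms(1) by simp
  next
    case False
    have "?\<eta>^2 \<le> 4 * U^2 + 64 * G^4 / z^2"
    proof (cases "\<bar>G\<bar> \<le> \<bar>U\<bar>")
      case True
      then have "\<bar>?\<eta>\<bar> \<le> \<bar>2 * U\<bar>" by auto
      then have "?\<eta>^2 \<le> (2 * U)^2" by (simp add: abs_le_square_iff)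
      moreover have "0 \<le> 64 * G^4 / z^2" by simp
      moreover have "(2 * U)^2 = 4 * U^2" by (simp add: power_mult_distrib)
      ultimately show ?thesis by linarith
    next
      case False2: False
      then have le: "\<bar>?\<eta>\<bar> \<le> \<bar>2 * G\<bar>" by auto
      with False have "\<bar>z\<bar> \<le> \<bar>4 * G\<bar>" using assms(1) by linarith
      then have "z^2 \<le> 16 * G^2" by (simp add: abs_le_square_iff power_mult_distrib)
      then have "4 * G^2 * z^2 \<le> 4 * G^2 * (16 * G^2)" by (intro mult_left_mono) auto
      then have "4 * G^2 \<le> 64 * G^4 / z^2"
        using assms(1) by (simp add: pos_le_divide_eq power2_eq_square power4_eq_xxxx mult_ac)
      moreover have "?\<eta>^2 \<le> 4 * G^2" using le by (simp add: abs_le_square_iff power_mult_distrib)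
      ultimately show ?thesis using zero_le_power2[of U] by linarith
    qed
    then have "7 * ?\<eta>^2 / z^3 \<le> 7 * (4 * U^2 + 64 * G^4 / z^2) / z^3"
      using assms(1) by (intro divide_right_mono mult_left_mono) auto
    also have "\<dots> = 28 * U^2 / z^3 + 448 * G^4 / z^5"
      using assms(1) by (simp add: field_simps eval_nat_numeral)
    finally show ?thesis using False by simp
  qed
  moreover have "29 * U^2 / z^3 = 28 * U^2 / z^3 + U^2 / z^3" by (simp add: field_simps)
  ultimately show ?thesis by linarith
qed

text \<open>From \<open>2 s t \<le> s^2 + t^2\<close> with \<open>s = norm (v + y)\<close> and
  \<open>t = norm v\<close>: the norm lies below its second-order expansion, with curvature
  \<open>1 / norm v \<le> 1 / R\<close>.\<close>

lemma norm_add_le_quadratic: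
  fixes v y :: "'v::real_inner"
  assumes "0 < R" "R \<le> norm v"
  shows "norm (v + y) \<le> norm v + (1 / norm v) * (v \<bullet> y) + (norm y)\<^sup>2 / (2 * R)"
proof -
  have v: "0 < norm v" using assms by linarith
  have "norm (v + y) * (2 * norm v) \<le> (norm (v + y))\<^sup>2 + (norm v)\<^sup>2"
    using zero_le_power2[of "norm (v + y) - norm v"] by (simp add: power2_diff algebra_simps)
  also have "\<dots> = 2 * (norm v)\<^sup>2 + 2 * (v \<bullet> y) + (norm y)\<^sup>2"
    by (simp add: power2_norm_eq_inner inner_add_left inner_add_right inner_commute)
  finally have "norm (v + y) \<le> (2 * (norm v)\<^sup>2 + 2 * (v \<bullet> y) + (norm y)\<^sup>2) / (2 * norm v)"
    using v by (simp add: pos_le_divide_eq)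
  also have "\<dots> = norm v + (1 / norm v) * (v \<bullet> y) + (norm y)\<^sup>2 / (2 * norm v)"
    using v by (simp add: field_simps power2_eq_square)
  also have "(norm y)\<^sup>2 / (2 * norm v) \<le> (norm y)\<^sup>2 / (2 * R)"
    using assms v by (intro divide_left_mono) auto
  finally show ?thesis by simp
qed

text \<open>\<open>n\<close> points from the centre of the exterior ball to \<open>x\<close> and is
  chosen before \<open>y\<close> and \<open>u\<close>. The distance to that centre bounds the new
  boundary distance by the old one plus \<open>G + U\<close>: the first-order effect of
  \<open>y\<close> is \<open>G\<close>, while \<open>U\<close> collects the curvature of the ball
  and the remainder \<open>u\<close>.\<close>

lemma pot_lower_bound:
  fixes D :: "('v::euclidean_space) set"
  assumes D: "ball_exterior D R" "open D" "bounded D" "x \<in> D"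
    and "0 < \<delta>" "0 < K" "infdist x (frontier D) < K"
  obtains n where "norm n = 1"
    "\<And>y u. let z = \<delta> + infdist x (frontier D); G = n \<bullet> y; U = (norm y)\<^sup>2 / (2 * R) + norm u in
      pot D \<delta> K x - (G + U) / z^2 + G^2 / (4 * z^3) - 29 * U^2 / z^3 - 448 * G^4 / z^5 \<le> pot D \<delta> K (x + y + u)"
proof -
  have R: "0 < R" using D by (simp add: ball_exterior_def)
  obtain c where c: "dist x c = infdist x (frontier D) + R"
    "\<And>y. y \<in> D \<Longrightarrow> infdist y (frontier D) + R \<le> dist y c"
    using ball_exterior_infdist[OF D] by metis
  define r where "r = infdist x (frontier D)"
  have r: "0 \<le> r" by (simp add: r_def infdist_nonneg)
  define v where "v = x - c"
  have v: "norm v = r + R" using c(1) by (simp add: v_def r_def dist_norm)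
  define n where "n = (1 / norm v) *\<^sub>R v"
  have "norm n = 1" using v r R by (simp add: n_def)
  moreover have "let z = \<delta> + r; G = n \<bullet> y; U = (norm y)\<^sup>2 / (2 * R) + norm u in
      pot D \<delta> K x - (G + U) / z^2 + G^2 / (4 * z^3) - 29 * U^2 / z^3 - 448 * G^4 / z^5 \<le> pot D \<delta> K (x + y + u)" for y u
  proof -
    define z G U where "z = \<delta> + r" "G = n \<bullet> y" "U = (norm y)\<^sup>2 / (2 * R) + norm u"
    have z: "0 < z" using r assms by (simp add: z_G_U_def)
    have "1 / (z + (G + U)) \<le> pot D \<delta> K (x + y + u)" if "\<bar>G + U\<bar> \<le> z / 2"
    proof (cases "x + y + u \<in> D")
      case True
      let ?i = "infdist (x + y + u) (frontier D)"
      have "?i + R \<le> norm ((v + y) + u)" using c(2)[OF True] by (simp add: v_def dist_norm algebra_simps)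
      also have "\<dots> \<le> norm (v + y) + norm u" by (rule norm_triangle_ineq)
      also have "norm (v + y) \<le> norm v + (1 / norm v) * (v \<bullet> y) + (norm y)\<^sup>2 / (2 * R)"
        using R r v by (intro norm_add_le_quadratic) auto
      finally have "?i \<le> r + (G + U)" using v by (simp add: z_G_U_def n_def)
      then have "\<delta> + min ?i K \<le> z + (G + U)" by (simp add: z_G_U_def)
      moreover have "0 < \<delta> + min ?i K" using assms infdist_nonneg[of "x + y + u" "frontier D"] by (simp add: add_pos_nonneg)
      ultimately show ?thesis using True by (simp add: pot_def frac_le)
    next
      case False
      \<comment> \<open>The exterior value \<open>2 / \<delta>\<close> of the barrier is chosen for
        this case: displacements up to \<open>z / 2\<close> give a reciprocal of at most
        \<open>2 / z \<le> 2 / \<delta>\<close>.\<close>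
      have "z / 2 \<le> z + (G + U)" using abs_le_D2[OF that] by linarith
      then have "1 / (z + (G + U)) \<le> 1 / (z / 2)" using z by (intro frac_le) auto
      also have "\<dots> \<le> 2 / \<delta>" using r assms by (auto simp: z_G_U_def intro!: divide_left_mono)
      finally show ?thesis using False by (simp add: pot_def)
    qed
    from reciprocal_lower_bound[OF z _ this] pot_bounds(1)[of \<delta> K D] assms
    have "1 / z - (G + U) / z^2 + G^2 / (4 * z^3) - 29 * U^2 / z^3 - 448 * G^4 / z^5 \<le> pot D \<delta> K (x + y + u)"
      by auto
    moreover have "pot D \<delta> K x = 1 / z" using assms by (simp add: pot_def z_G_U_def r_def)
    ultimately show ?thesis by (simp add: z_G_U_def Let_def)
  qed
  ultimately show thesis using that by (simp add: r_def)
qed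

section \<open>Past and future of a Brownian motion\<close>

locale brownian = prob_space M for M :: "'a measure" +
  fixes W :: "real \<Rightarrow> 'a \<Rightarrow> real^'m::finite"
  assumes wiener: "wiener M W"
begin

lemma W_measurable [measurable]: "W t \<in> borel_measurable M"
  using wiener by (auto simp: wiener_def)

lemma W_0: "\<omega> \<in> space M \<Longrightarrow> W 0 \<omega> = 0"
  using wiener by (auto simp: wiener_def)

lemma increments_indep:
  assumes "sorted_wrt (<) ts" "\<forall>t\<in>set ts. 0 \<le> t"
  shows "indep_vars (\<lambda>_. borel)
          (\<lambda>(j, k) \<omega>. W (ts ! Suc k) \<omega> $ j - W (ts ! k) \<omega> $ j)
          (UNIV \<times> {k. Suc k < length ts})"
  using wiener assms by (auto simp: wiener_def)

lemma increment_normal: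
  assumes "0 \<le> s" "s < t"
  shows "distributed M lborel (\<lambda>\<omega>. W t \<omega> $ j - W s \<omega> $ j)
            (\<lambda>x. ennreal (normal_density 0 (sqrt (t - s)) x))"
proof -
  have "\<forall>j k. Suc k < length [s, t] \<longrightarrow>
          distributed M lborel (\<lambda>\<omega>. W ([s,t] ! Suc k) \<omega> $ j - W ([s,t] ! k) \<omega> $ j)
            (\<lambda>x. ennreal (normal_density 0 (sqrt ([s,t] ! Suc k - [s,t] ! k)) x))"
    using wiener assms unfolding wiener_def by (elim conjE allE[of _ "[s,t]"]) auto
  from this[rule_format, of 0 j] show ?thesis by simp
qed

text \<open>Only the sigma-algebra matters; it is packed as a measure so that adaptedness and
  dependence on later increments become ordinary measurability statements.\<close>

definition obs :: "(real \<Rightarrow> 'a \<Rightarrow> real^'m) \<Rightarrow> real set \<Rightarrow> 'a measure" where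
  "obs X J = sigma (space M) (\<Union>u\<in>J. {X u -` B \<inter> space M |B. B \<in> sets borel})"

abbreviation past :: "real \<Rightarrow> 'a measure" where
  "past s \<equiv> obs W {0..s}"

abbreviation future :: "real \<Rightarrow> 'a measure" where
  "future s \<equiv> obs (\<lambda>v \<omega>. W v \<omega> - W s \<omega>) {s..}"

lemma space_obs [simp]: "space (obs X J) = space M"
  unfolding obs_def by (rule space_measure_of) auto

lemma sets_obs: "sets (obs X J) = sigma_sets (space M) (\<Union>u\<in>J. {X u -` B \<inter> space M |B. B \<in> sets borel})"
  unfolding obs_def by (rule sets_measure_of) auto

lemma measurable_obs: "u \<in> J \<Longrightarrow> X u \<in> obs X J \<rightarrow>\<^sub>M borel"
  by (rule measurableI) (auto simp: sets_obs)

lemma obs_subset: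
  assumes "space N = space M" "\<And>u. u \<in> J \<Longrightarrow> X u \<in> N \<rightarrow>\<^sub>M borel"
  shows "sets (obs X J) \<subseteq> sets N"
  unfolding sets_obs
proof (rule sets.sigma_sets_subset[of _ N, unfolded assms(1)], safe)
  fix u and B :: "(real^'m) set" assume "u \<in> J" "B \<in> sets borel"
  then show "X u -` B \<inter> space M \<in> sets N"
    using measurable_sets[OF assms(2)] assms(1) by metis
qed

lemma obs_mono: "J \<subseteq> K \<Longrightarrow> sets (obs X J) \<subseteq> sets (obs X K)"
  by (rule obs_subset) (auto intro: measurable_obs)

lemma past_mono: "s \<le> t \<Longrightarrow> sets (past s) \<subseteq> sets (past t)"
  by (rule obs_mono) auto

lemma past_subset_M: "sets (past s) \<subseteq> sets M"
  by (rule obs_subset) auto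

lemma future_subset_M: "sets (future s) \<subseteq> sets M"
  by (rule obs_subset) auto

lemma measurable_past_mono: "s \<le> t \<Longrightarrow> f \<in> past s \<rightarrow>\<^sub>M N \<Longrightarrow> f \<in> past t \<rightarrow>\<^sub>M N"
  using past_mono[of s t] by (auto simp: measurable_def)

lemma measurable_past_M: "f \<in> past s \<rightarrow>\<^sub>M N \<Longrightarrow> f \<in> M \<rightarrow>\<^sub>M N"
  using past_subset_M[of s] by (auto simp: measurable_def)

lemma measurable_future_M: "f \<in> future s \<rightarrow>\<^sub>M N \<Longrightarrow> f \<in> M \<rightarrow>\<^sub>M N"
  using future_subset_M[of s] by (auto simp: measurable_def)

text \<open>Any two finite index sets lie in a third, so this generator is stable under
  intersection, and independence of past and future reduces to finitely many times.\<close>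

lemma obs_eq_finite:
  "sets (obs X J) = sigma_sets (space M) (\<Union>K\<in>{K. finite K \<and> K \<subseteq> J}. sets (obs X K))" (is "_ = sigma_sets _ ?E")
proof
  show "sets (obs X J) \<subseteq> sigma_sets (space M) ?E"
    unfolding sets_obs[of X J]
  proof (rule sigma_sets_mono', safe)
    fix u and B :: "(real^'m) set" assume *: "u \<in> J" "B \<in> sets borel"
    then have "X u -` B \<inter> space M \<in> sets (obs X {u})"
      by (auto simp: sets_obs)
    with * show "X u -` B \<inter> space M \<in> ?E"
      by (intro UN_I[of "{u}"]) auto
  qed
  have "?E \<subseteq> sets (obs X J)"
    using obs_mono by blast
  then show "sigma_sets (space M) ?E \<subseteq> sets (obs X J)"
    by (metis sets.sigma_sets_subset space_obs)
qed

lemma Int_stable_obs_finite: "Int_stable (\<Union>K\<in>{K. finite K \<and> K \<subseteq> J}. sets (obs X K))"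
proof (rule Int_stableI, safe)
  fix A B K L assume *: "A \<in> sets (obs X K)" "B \<in> sets (obs X L)" "finite K" "K \<subseteq> J" "finite L" "L \<subseteq> J"
  then have "A \<in> sets (obs X (K \<union> L))" "B \<in> sets (obs X (K \<union> L))"
    using obs_mono[of K "K \<union> L"] obs_mono[of L "K \<union> L"] by blast+
  then show "A \<inter> B \<in> (\<Union>K\<in>{K. finite K \<and> K \<subseteq> J}. sets (obs X K))"
    using * by (intro UN_I[of "K \<union> L"]) auto
qed

text \<open>All times are merged into one grid. Values up to \<open>s\<close> and increments after
  \<open>s\<close> are then telescoping sums over two disjoint blocks of the independent grid
  increments.\<close>

lemma indep_finite_past_future:
  assumes J: "finite J" "J \<subseteq> {0..s}" and K: "finite K" "K \<subseteq> {s..}" and s: "0 \<le> s"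
  shows "indep_set (sets (obs W J)) (sets (obs (\<lambda>v \<omega>. W v \<omega> - W s \<omega>) K))"
proof -
  \<comment> \<open>The point 0, where \<open>W\<close> vanishes, turns values of \<open>W\<close>
    into sums of increments; the point \<open>s\<close> prevents an increment from straddling
    \<open>s\<close>.\<close>
  define S where "S = J \<union> K \<union> {0, s}"
  define ts where "ts = sorted_list_of_set S"
  have S: "finite S" "\<And>t. t \<in> S \<Longrightarrow> 0 \<le> t"
    using J K s by (auto simp: S_def)
  have set_ts: "set ts = S" using S by (simp add: ts_def)
  have srt: "sorted_wrt (<) ts" by (simp add: ts_def)
  have pos: "\<forall>t\<in>set ts. 0 \<le> t" using S set_ts by auto
  define X where "X = (\<lambda>(j, k) \<omega>. W (ts ! Suc k) \<omega> $ j - W (ts ! k) \<omega> $ j)"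
  have ind: "indep_vars (\<lambda>_. borel) X (UNIV \<times> {k. Suc k < length ts})"
    unfolding X_def by (rule increments_indep[OF srt pos])
  have idx: "\<exists>i<length ts. ts ! i = u" if "u \<in> S" for u
    using that set_ts in_set_conv_nth[of u ts] by auto
  obtain k0 where k0: "k0 < length ts" "ts ! k0 = s"
    using idx[of s] by (auto simp: S_def)
  have less: "i < i' \<Longrightarrow> i' < length ts \<Longrightarrow> ts ! i < ts ! i'" for i i'
    using srt by (rule sorted_wrt_nth_less)
  have ts0: "ts ! 0 = 0"
  proof -
    obtain i where i: "i < length ts" "ts ! i = 0"
      using idx[of 0] by (auto simp: S_def)
    then have "ts ! 0 \<in> set ts" by (cases ts) auto
    with pos have "0 \<le> ts ! 0" by blast
    with less[of 0 i] i show ?thesis by (cases i) auto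
  qed
  have tele: "W (ts ! i) \<omega> $ j - W (ts ! l) \<omega> $ j = (\<Sum>k\<in>{l..<i}. X (j, k) \<omega>)" if "l \<le> i" for i l j \<omega>
    using that unfolding X_def by (induction i rule: dec_induct) auto
  define A where "A = (UNIV :: 'm set) \<times> {k. k < k0}"
  define B where "B = (UNIV :: 'm set) \<times> {k. k0 \<le> k \<and> Suc k < length ts}"
  define N1 where "N1 = vimage_algebra (space M) (\<lambda>\<omega>. restrict (\<lambda>i. X i \<omega>) A) (PiM A (\<lambda>_. borel :: real measure))"
  define N2 where "N2 = vimage_algebra (space M) (\<lambda>\<omega>. restrict (\<lambda>i. X i \<omega>) B) (PiM B (\<lambda>_. borel :: real measure))"
  have "indep_var (PiM A (\<lambda>_. borel)) (\<lambda>\<omega>. restrict (\<lambda>i. X i \<omega>) A) (PiM B (\<lambda>_. borel)) (\<lambda>\<omega>. restrict (\<lambda>i. X i \<omega>) B)"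
    by (rule indep_var_restrict[OF ind]) (use k0 in \<open>auto simp: A_def B_def\<close>)
  then have iN: "indep_set (sets N1) (sets N2)"
    unfolding indep_var_eq N1_def N2_def sets_vimage_algebra by auto
  have "(\<lambda>\<omega>. restrict (\<lambda>i. X i \<omega>) A) \<in> N1 \<rightarrow>\<^sub>M PiM A (\<lambda>_. borel)"
    unfolding N1_def by (rule measurable_vimage_algebra1) (auto simp: space_PiM)
  from measurable_compose[OF this measurable_component_singleton]
  have X1: "X i \<in> N1 \<rightarrow>\<^sub>M borel" if "i \<in> A" for i
    using that by (auto simp: restrict_def)
  have "(\<lambda>\<omega>. restrict (\<lambda>i. X i \<omega>) B) \<in> N2 \<rightarrow>\<^sub>M PiM B (\<lambda>_. borel)"
    unfolding N2_def by (rule measurable_vimage_algebra1) (auto simp: space_PiM)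
  from measurable_compose[OF this measurable_component_singleton]
  have X2: "X i \<in> N2 \<rightarrow>\<^sub>M borel" if "i \<in> B" for i
    using that by (auto simp: restrict_def)
  have sp: "space N1 = space M" "space N2 = space M" by (auto simp: N1_def N2_def)
  have "sets (obs W J) \<subseteq> sets N1"
  proof (rule obs_subset)
    fix u assume "u \<in> J"
    then obtain i where i: "i < length ts" "ts ! i = u"
      using idx[of u] by (auto simp: S_def)
    have "i \<le> k0" using less[of k0 i] i k0 \<open>u \<in> J\<close> J(2) by (meson atLeastAtMost_iff leD not_le subsetD)
    have "(\<lambda>\<omega>. W u \<omega> $ j) \<in> borel_measurable N1" for j
    proof -
      have "(\<lambda>\<omega>. \<Sum>k\<in>{0..<i}. X (j, k) \<omega>) \<in> borel_measurable N1"
        using \<open>i \<le> k0\<close> by (intro borel_measurable_sum X1) (auto simp: A_def)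
      then show ?thesis
        by (rule measurable_cong[THEN iffD1, rotated]) (use W_0 i ts0 sp in \<open>auto simp: tele[of 0 i, symmetric]\<close>)
    qed
    then show "W u \<in> borel_measurable N1" by (simp add: borel_measurable_vec_iff)
  qed (use sp in auto)
  moreover have "sets (obs (\<lambda>v \<omega>. W v \<omega> - W s \<omega>) K) \<subseteq> sets N2"
  proof (rule obs_subset)
    fix u assume "u \<in> K"
    then obtain i where i: "i < length ts" "ts ! i = u"
      using idx[of u] by (auto simp: S_def)
    have "k0 \<le> i" using less[of i k0] i k0 \<open>u \<in> K\<close> K(2) by (meson atLeast_iff leD not_le subsetD)
    have "(\<lambda>\<omega>. (W u \<omega> - W s \<omega>) $ j) \<in> borel_measurable N2" for j
    proof -
      have "(\<lambda>\<omega>. \<Sum>k\<in>{k0..<i}. X (j, k) \<omega>) \<in> borel_measurable N2"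
        using i by (intro borel_measurable_sum X2) (auto simp: B_def)
      then show ?thesis
        by (rule measurable_cong[THEN iffD1, rotated]) (use tele[OF \<open>k0 \<le> i\<close>] i k0 in auto)
    qed
    then show "(\<lambda>\<omega>. W u \<omega> - W s \<omega>) \<in> borel_measurable N2" by (simp add: borel_measurable_vec_iff)
  qed (use sp in auto)
  ultimately show ?thesis
    using iN unfolding indep_sets2_eq by (meson subset_iff)
qed

lemma indep_set_past_future:
  assumes "0 \<le> s"
  shows "indep_set (sets (past s)) (sets (future s))"
  unfolding obs_eq_finite[of _ "{0..s}"] obs_eq_finite[of _ "{s..}"]
proof (rule indep_set_sigma_sets[OF _ Int_stable_obs_finite Int_stable_obs_finite])
  show "indep_set (\<Union>K\<in>{K. finite K \<and> K \<subseteq> {0..s}}. sets (obs W K))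
     (\<Union>K\<in>{K. finite K \<and> K \<subseteq> {s..}}. sets (obs (\<lambda>v \<omega>. W v \<omega> - W s \<omega>) K))"
  proof (rule indep_setI)
    show "(\<Union>K\<in>{K. finite K \<and> K \<subseteq> {0..s}}. sets (obs W K)) \<subseteq> events"
      using past_subset_M obs_mono by blast
    show "(\<Union>K\<in>{K. finite K \<and> K \<subseteq> {s..}}. sets (obs (\<lambda>v \<omega>. W v \<omega> - W s \<omega>) K)) \<subseteq> events"
      using future_subset_M obs_mono by blast
  next
    fix a b
    assume "a \<in> (\<Union>K\<in>{K. finite K \<and> K \<subseteq> {0..s}}. sets (obs W K))"
      and "b \<in> (\<Union>K\<in>{K. finite K \<and> K \<subseteq> {s..}}. sets (obs (\<lambda>v \<omega>. W v \<omega> - W s \<omega>) K))"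
    then show "prob (a \<inter> b) = prob a * prob b"
      using indep_setD[OF indep_finite_past_future[OF _ _ _ _ assms]] by auto
  qed
qed

lemma indep_var_past_future:
  assumes "0 \<le> s" and X: "X \<in> past s \<rightarrow>\<^sub>M S" and Y: "Y \<in> future s \<rightarrow>\<^sub>M T"
  shows "indep_var S X T Y"
proof -
  have "sigma_sets (space M) {X -` A \<inter> space M |A. A \<in> sets S} \<subseteq> sets (past s)"
    by (rule sets.sigma_sets_subset[of _ "past s", simplified])
       (use measurable_sets[OF X] in auto)
  moreover have "sigma_sets (space M) {Y -` A \<inter> space M |A. A \<in> sets T} \<subseteq> sets (future s)"
    by (rule sets.sigma_sets_subset[of _ "future s", simplified])
       (use measurable_sets[OF Y] in auto)
  ultimately show ?thesis
    using indep_set_past_future[OF assms(1)] measurable_past_M[OF X] measurable_future_M[OF Y]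
    unfolding indep_var_eq indep_sets2_eq by (meson subset_iff)
qed

end

section \<open>Ito sums in mean square\<close>

context prob_space
begin

lemma integrable_mult_of_squares:
  fixes X Y :: "'a \<Rightarrow> real"
  assumes [measurable]: "X \<in> borel_measurable M" "Y \<in> borel_measurable M"
    and "integrable M (\<lambda>\<omega>. (X \<omega>)\<^sup>2)" "integrable M (\<lambda>\<omega>. (Y \<omega>)\<^sup>2)"
  shows "integrable M (\<lambda>\<omega>. X \<omega> * Y \<omega>)"
proof (rule Bochner_Integration.integrable_bound)
  show "integrable M (\<lambda>\<omega>. (X \<omega>)\<^sup>2 + (Y \<omega>)\<^sup>2)" using assms by simp
  have "\<bar>x * y\<bar> \<le> x\<^sup>2 + y\<^sup>2" for x y :: real
  proof -
    have "0 \<le> (\<bar>x\<bar> - \<bar>y\<bar>)\<^sup>2" "0 \<le> \<bar>x\<bar> * \<bar>y\<bar>" by auto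
    then have "\<bar>x\<bar> * \<bar>y\<bar> \<le> x\<^sup>2 + y\<^sup>2" unfolding power2_diff power2_abs by linarith
    then show ?thesis by (simp add: abs_mult)
  qed
  then show "AE x in M. norm (X x * Y x) \<le> norm ((X x)\<^sup>2 + (Y x)\<^sup>2)" by simp
qed measurable

lemma integrable_of_square:
  fixes X :: "'a \<Rightarrow> real"
  assumes "X \<in> borel_measurable M" "integrable M (\<lambda>\<omega>. (X \<omega>)\<^sup>2)"
  shows "integrable M X"
  using integrable_mult_of_squares[of X "\<lambda>_. 1"] assms by simp

lemma integrable_square_add:
  fixes X Y :: "'a \<Rightarrow> real"
  assumes "X \<in> borel_measurable M" "Y \<in> borel_measurable M"
    and "integrable M (\<lambda>\<omega>. (X \<omega>)\<^sup>2)" "integrable M (\<lambda>\<omega>. (Y \<omega>)\<^sup>2)"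
  shows "integrable M (\<lambda>\<omega>. (X \<omega> + Y \<omega>)\<^sup>2)"
  using integrable_mult_of_squares[OF assms] assms(3,4)
  by (simp add: power2_sum mult.assoc)

lemma square_sum_expectation:
  fixes X Y :: "'a \<Rightarrow> real"
  assumes "X \<in> borel_measurable M" "Y \<in> borel_measurable M"
    and "integrable M (\<lambda>\<omega>. (X \<omega>)\<^sup>2)" "integrable M (\<lambda>\<omega>. (Y \<omega>)\<^sup>2)"
  shows "expectation (\<lambda>\<omega>. (X \<omega> + Y \<omega>)\<^sup>2) \<le> 2 * expectation (\<lambda>\<omega>. (X \<omega>)\<^sup>2) + 2 * expectation (\<lambda>\<omega>. (Y \<omega>)\<^sup>2)"
proof -
  have "expectation (\<lambda>\<omega>. (X \<omega> + Y \<omega>)\<^sup>2) \<le> expectation (\<lambda>\<omega>. 2 * (X \<omega>)\<^sup>2 + 2 * (Y \<omega>)\<^sup>2)"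
  proof (rule integral_mono[OF integrable_square_add[OF assms]])
    show "(X \<omega> + Y \<omega>)\<^sup>2 \<le> 2 * (X \<omega>)\<^sup>2 + 2 * (Y \<omega>)\<^sup>2" for \<omega>
      using zero_le_power2[of "X \<omega> - Y \<omega>"] by (simp add: power2_sum power2_diff)
  qed (use assms in auto)
  also have "\<dots> = 2 * expectation (\<lambda>\<omega>. (X \<omega>)\<^sup>2) + 2 * expectation (\<lambda>\<omega>. (Y \<omega>)\<^sup>2)"
    using assms by simp
  finally show ?thesis .
qed

text \<open>Fatou's lemma; it carries second-moment bounds over to the pathwise limits that define
  the multiple integrals.\<close>

lemma square_expectation_lim:
  fixes X :: "nat \<Rightarrow> 'a \<Rightarrow> real"
  assumes [measurable]: "\<And>k. X k \<in> borel_measurable M" "Z \<in> borel_measurable M"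
    and lim: "AE \<omega> in M. (\<lambda>k. X k \<omega>) \<longlonglongrightarrow> Z \<omega>"
    and int: "\<And>k. integrable M (\<lambda>\<omega>. (X k \<omega>)\<^sup>2)"
    and bnd: "\<And>k. expectation (\<lambda>\<omega>. (X k \<omega>)\<^sup>2) \<le> B"
  shows "integrable M (\<lambda>\<omega>. (Z \<omega>)\<^sup>2)" "expectation (\<lambda>\<omega>. (Z \<omega>)\<^sup>2) \<le> B"
proof -
  have "0 \<le> expectation (\<lambda>\<omega>. (X 0 \<omega>)\<^sup>2)" by simp
  with bnd[of 0] have B: "0 \<le> B" by linarith
  have "(\<integral>\<^sup>+ \<omega>. ennreal ((Z \<omega>)\<^sup>2) \<partial>M) = (\<integral>\<^sup>+ \<omega>. liminf (\<lambda>k. ennreal ((X k \<omega>)\<^sup>2)) \<partial>M)"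
  proof (rule nn_integral_cong_AE, use lim in eventually_elim)
    fix \<omega> assume "(\<lambda>k. X k \<omega>) \<longlonglongrightarrow> Z \<omega>"
    then have "(\<lambda>k. ennreal ((X k \<omega>)\<^sup>2)) \<longlonglongrightarrow> ennreal ((Z \<omega>)\<^sup>2)"
      by (intro tendsto_intros)
    then show "ennreal ((Z \<omega>)\<^sup>2) = liminf (\<lambda>k. ennreal ((X k \<omega>)\<^sup>2))"
      by (metis lim_imp_Liminf trivial_limit_sequentially)
  qed
  also have "\<dots> \<le> liminf (\<lambda>k. \<integral>\<^sup>+ \<omega>. ennreal ((X k \<omega>)\<^sup>2) \<partial>M)"
    by (rule nn_integral_liminf) auto
  also have "\<dots> \<le> liminf (\<lambda>k::nat. ennreal B)"
  proof (rule Liminf_mono, rule always_eventually, rule allI)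
    fix k
    show "(\<integral>\<^sup>+ \<omega>. ennreal ((X k \<omega>)\<^sup>2) \<partial>M) \<le> ennreal B"
      using bnd[of k] int[of k] by (subst nn_integral_eq_integral) (auto intro: ennreal_leI)
  qed
  finally have *: "(\<integral>\<^sup>+ \<omega>. ennreal ((Z \<omega>)\<^sup>2) \<partial>M) \<le> ennreal B"
    by (simp add: Liminf_const)
  show i: "integrable M (\<lambda>\<omega>. (Z \<omega>)\<^sup>2)"
  proof (rule integrableI_bounded)
    show "(\<integral>\<^sup>+ x. ennreal (norm ((Z x)\<^sup>2)) \<partial>M) < \<infinity>"
      using le_less_trans[OF *, of \<infinity>] by (simp add: ennreal_less_top)
  qed measurable
  show "expectation (\<lambda>\<omega>. (Z \<omega>)\<^sup>2) \<le> B"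
    using * B by (subst (asm) nn_integral_eq_integral[OF i]) auto
qed

text \<open>The increments have \<open>L^1\<close> norm of order \<open>2^-k\<close>, so their
  absolute values have an integrable, hence almost surely finite, sum.\<close>

lemma AE_convergent_of_square_increments:
  fixes X :: "nat \<Rightarrow> 'a \<Rightarrow> real"
  assumes [measurable]: "\<And>k. X k \<in> borel_measurable M"
    and int: "\<And>k. integrable M (\<lambda>\<omega>. (X (Suc k) \<omega> - X k \<omega>)\<^sup>2)"
    and bnd: "\<And>k. expectation (\<lambda>\<omega>. (X (Suc k) \<omega> - X k \<omega>)\<^sup>2) \<le> c / 4 ^ k"
  shows "AE \<omega> in M. convergent (\<lambda>k. X k \<omega>)"
proof -
  let ?d = "\<lambda>k \<omega>. X (Suc k) \<omega> - X k \<omega>"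
  have intd: "integrable M (?d k)" for k
    using integrable_of_square[of "?d k"] int by simp
  have le: "expectation (\<lambda>\<omega>. \<bar>?d k \<omega>\<bar>) \<le> (1 + c) * (1/2)^k" for k
  proof -
    \<comment> \<open>A weighted mean inequality: with \<open>x^2\<close> of order
      \<open>4^-k\<close> in expectation, both terms are of order \<open>2^-k\<close>.\<close>
    have "\<bar>x\<bar> \<le> (1/2)^k + 2^k * x\<^sup>2" for x :: real
    proof -
      have "0 \<le> ((1/2)^k - \<bar>x\<bar>)\<^sup>2" by simp
      then have "2 * (1/2)^k * \<bar>x\<bar> \<le> ((1/2)^k)\<^sup>2 + x\<^sup>2" by (simp add: power2_diff)
      then have "2^k * (2 * (1/2)^k * \<bar>x\<bar>) \<le> 2^k * (((1/2)^k)\<^sup>2 + x\<^sup>2)" by (rule mult_left_mono) simp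
      moreover have "(2::real)^k * (1/2)^k = 1" by (simp flip: power_mult_distrib)
      then have "2^k * (2 * (1/2)^k * \<bar>x\<bar>) = 2 * \<bar>x\<bar>" "2^k * (((1/2)^k)\<^sup>2 + x\<^sup>2) = (1/2)^k + 2^k * x\<^sup>2"
        by (simp_all add: distrib_left power2_eq_square flip: mult.assoc)
      ultimately have "2 * \<bar>x\<bar> \<le> (1/2)^k + 2^k * x\<^sup>2" by simp
      then show ?thesis by linarith
    qed
    then have "expectation (\<lambda>\<omega>. \<bar>?d k \<omega>\<bar>) \<le> expectation (\<lambda>\<omega>. (1/2)^k + 2^k * (?d k \<omega>)\<^sup>2)"
      using intd int by (intro integral_mono) auto
    also have "\<dots> = (1/2)^k + 2^k * expectation (\<lambda>\<omega>. (?d k \<omega>)\<^sup>2)"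
      using int by (simp add: prob_space)
    also have "\<dots> \<le> (1/2)^k + 2^k * (c / 4^k)"
      using bnd[of k] by (intro add_left_mono mult_left_mono) auto
    also have "2^k * (c / 4^k) = c * (1/2)^k"
      by (simp add: field_simps flip: power_mult_distrib)
    finally show ?thesis by (simp add: algebra_simps)
  qed
  have "(\<integral>\<^sup>+ \<omega>. (\<Sum>k. ennreal \<bar>?d k \<omega>\<bar>) \<partial>M) = (\<Sum>k. \<integral>\<^sup>+ \<omega>. ennreal \<bar>?d k \<omega>\<bar> \<partial>M)"
    by (rule nn_integral_suminf) auto
  also have "\<dots> \<le> (\<Sum>k. ennreal ((1 + c) * (1/2)^k))"
  proof (rule suminf_le)
    show "(\<integral>\<^sup>+ \<omega>. ennreal \<bar>?d k \<omega>\<bar> \<partial>M) \<le> ennreal ((1 + c) * (1/2)^k)" for k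
      using le[of k] intd by (subst nn_integral_eq_integral) (auto intro: ennreal_leI)
  qed auto
  also have "\<dots> < \<infinity>"
  proof -
    have "0 \<le> (1 + c) * (1/2)^k" for k
      using le[of k] by (rule order_trans[rotated]) simp
    moreover have "summable (\<lambda>k. (1 + c) * (1/2)^k)" by (intro summable_mult summable_geometric) simp
    ultimately show ?thesis
      by (metis ennreal_less_top infinity_ennreal_def suminf_ennreal2)
  qed
  finally have "AE \<omega> in M. (\<Sum>k. ennreal \<bar>?d k \<omega>\<bar>) \<noteq> \<infinity>"
    by (intro nn_integral_noteq_infinite) auto
  then show ?thesis
  proof eventually_elim
    fix \<omega> assume "(\<Sum>k. ennreal \<bar>?d k \<omega>\<bar>) \<noteq> \<infinity>"
    then have "summable (\<lambda>k. \<bar>?d k \<omega>\<bar>)" by (intro summable_suminf_not_top) auto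
    then have "summable (\<lambda>k. ?d k \<omega>)" by (rule summable_rabs_cancel)
    then have "convergent (\<lambda>k. X k \<omega> - X 0 \<omega>)"
      by (simp add: summable_iff_convergent sum_lessThan_telescope[of "\<lambda>i. X i \<omega>"])
    then have "convergent (\<lambda>k. (X k \<omega> - X 0 \<omega>) + X 0 \<omega>)"
      by (intro convergent_add convergent_const)
    then show "convergent (\<lambda>k. X k \<omega>)" by simp
  qed
qed

end

section \<open>Discrete Ito isometry\<close>

context brownian
begin

lemma increment_moments:
  assumes "0 \<le> s" "s < t"
  shows "integrable M (\<lambda>\<omega>. (W t \<omega> $ j - W s \<omega> $ j)^k)"
    and "expectation (\<lambda>\<omega>. W t \<omega> $ j - W s \<omega> $ j) = 0"
    and "expectation (\<lambda>\<omega>. (W t \<omega> $ j - W s \<omega> $ j)\<^sup>2) = t - s"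
    and "expectation (\<lambda>\<omega>. (W t \<omega> $ j - W s \<omega> $ j)^4) = 3 * (t - s)\<^sup>2"
proof -
  have pos: "0 < sqrt (t - s)" using assms by simp
  note D = increment_normal[OF assms, of j]
  show "integrable M (\<lambda>\<omega>. (W t \<omega> $ j - W s \<omega> $ j)^k)"
    using distributed_integrable[OF D, of "\<lambda>x. x^k"] integrable_normal_moment[OF pos, of 0 k] by simp
  show "expectation (\<lambda>\<omega>. W t \<omega> $ j - W s \<omega> $ j) = 0"
    by (rule normal_distributed_expectation[OF pos D])
  have "(\<integral>x. normal_density 0 (sqrt (t - s)) x * x\<^sup>2 \<partial>lborel) = t - s"
    using integral_normal_moment_even[OF pos, of 0 1] assms by (simp add: fact_numeral)
  then show "expectation (\<lambda>\<omega>. (W t \<omega> $ j - W s \<omega> $ j)\<^sup>2) = t - s"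
    using distributed_integral[OF D, of "\<lambda>x. x^2"] by simp
  have "(\<integral>x. normal_density 0 (sqrt (t - s)) x * x^4 \<partial>lborel) = 3 * (t - s)\<^sup>2"
    using integral_normal_moment_even[OF pos, of 0 2] assms by (simp add: fact_numeral power_divide)
  then show "expectation (\<lambda>\<omega>. (W t \<omega> $ j - W s \<omega> $ j)^4) = 3 * (t - s)\<^sup>2"
    using distributed_integral[OF D, of "\<lambda>x. x^4"] by simp
qed

lemma W_past_measurable: "0 \<le> u \<Longrightarrow> u \<le> t \<Longrightarrow> W u \<in> past t \<rightarrow>\<^sub>M borel"
  by (rule measurable_obs) simp

lemma incr_past_measurable:
  assumes "0 \<le> u" "0 \<le> v" "u \<le> t" "v \<le> t"
  shows "incr j W u v \<in> borel_measurable (past t)"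
proof (cases j)
  case None then show ?thesis by (simp add: incr_def[abs_def])
next
  case (Some i)
  have [measurable]: "W u \<in> past t \<rightarrow>\<^sub>M borel" "W v \<in> past t \<rightarrow>\<^sub>M borel"
    using assms by (auto intro!: W_past_measurable)
  have "(\<lambda>\<omega>. W v \<omega> $ i - W u \<omega> $ i) \<in> borel_measurable (past t)" by measurable
  with Some show ?thesis by (simp add: incr_def[abs_def])
qed

lemma incr_future_measurable:
  assumes "s \<le> u" "s \<le> v"
  shows "incr j W u v \<in> borel_measurable (future s)"
proof (cases j)
  case None then show ?thesis by (simp add: incr_def[abs_def])
next
  case (Some i)
  have [measurable]: "(\<lambda>\<omega>. W u \<omega> - W s \<omega>) \<in> future s \<rightarrow>\<^sub>M borel" "(\<lambda>\<omega>. W v \<omega> - W s \<omega>) \<in> future s \<rightarrow>\<^sub>M borel"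
    using assms by (auto intro!: measurable_obs[where X="\<lambda>v \<omega>. W v \<omega> - W s \<omega>"])
  have "(\<lambda>\<omega>. (W v \<omega> - W s \<omega>) $ i - (W u \<omega> - W s \<omega>) $ i) \<in> borel_measurable (future s)" by measurable
  with Some show ?thesis by (simp add: incr_def[abs_def])
qed

lemma incr_measurable [measurable]: "incr j W u v \<in> borel_measurable M"
  by (cases j) (auto simp: incr_def[abs_def])

lemma expectation_past_mult_future:
  assumes "0 \<le> s" "X \<in> borel_measurable (past s)" "Y \<in> borel_measurable (future s)"
    and "integrable M X" "integrable M Y"
  shows "integrable M (\<lambda>\<omega>. X \<omega> * Y \<omega>)"
    and "expectation (\<lambda>\<omega>. X \<omega> * Y \<omega>) = expectation X * (expectation Y :: real)"
  using indep_var_integrable[OF indep_var_past_future[OF assms(1-3)] assms(4,5)]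
    indep_var_lebesgue_integral[OF indep_var_past_future[OF assms(1-3)] assms(4,5)] by auto

text \<open>In the square of the sum the cross terms vanish, since each increment is centred and
  independent of everything before it, and the diagonal terms factor. Measurability in the past is
  part of the induction because the next cross term needs it.\<close>

lemma ito_sum_Some:
  fixes i :: 'm
  assumes s: "0 \<le> s" and w: "0 < w"
    and A: "\<And>k. k < n \<Longrightarrow> A k \<in> borel_measurable (past (s + real k * w))"
    and int: "\<And>k. k < n \<Longrightarrow> integrable M (\<lambda>\<omega>. (A k \<omega>)\<^sup>2)"
  defines "S \<equiv> \<lambda>n \<omega>. \<Sum>k<n. A k \<omega> * incr (Some i) W (s + real k * w) (s + real (Suc k) * w) \<omega>"
  shows "S n \<in> borel_measurable (past (s + real n * w)) \<and> integrable M (\<lambda>\<omega>. (S n \<omega>)\<^sup>2) \<and>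
    expectation (\<lambda>\<omega>. (S n \<omega>)\<^sup>2) = w * (\<Sum>k<n. expectation (\<lambda>\<omega>. (A k \<omega>)\<^sup>2))"
  using A int
proof (induction n)
  case 0 then show ?case by (simp add: S_def)
next
  case (Suc n)
  define t where "t = s + real n * w"
  define B where "B = incr (Some i) W t (s + real (Suc n) * w)"
  have t: "0 \<le> t" "t < s + real (Suc n) * w" using s w by (auto simp: t_def algebra_simps)
  have IH: "S n \<in> borel_measurable (past t)" "integrable M (\<lambda>\<omega>. (S n \<omega>)\<^sup>2)"
    "expectation (\<lambda>\<omega>. (S n \<omega>)\<^sup>2) = w * (\<Sum>k<n. expectation (\<lambda>\<omega>. (A k \<omega>)\<^sup>2))"
    using Suc.IH[OF Suc.prems] by (auto simp: t_def)
  have An: "A n \<in> borel_measurable (past t)" "integrable M (\<lambda>\<omega>. (A n \<omega>)\<^sup>2)"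
    using Suc.prems[of n] by (auto simp: t_def)
  note [measurable] = measurable_past_M[OF IH(1)] measurable_past_M[OF An(1)]
  have "B \<in> borel_measurable (future t)"
    unfolding B_def using t by (intro incr_future_measurable) auto
  moreover have "s + real (Suc n) * w - t = w" by (simp add: t_def algebra_simps)
  ultimately have B: "B \<in> borel_measurable (future t)" "integrable M B" "expectation B = 0"
    "integrable M (\<lambda>\<omega>. (B \<omega>)\<^sup>2)" "expectation (\<lambda>\<omega>. (B \<omega>)\<^sup>2) = w"
    using increment_moments(2,3)[OF t, of i] increment_moments(1)[OF t, of i 1] increment_moments(1)[OF t, of i 2]
    by (simp_all add: B_def incr_def[abs_def])
  have Sn: "S (Suc n) \<omega> = S n \<omega> + A n \<omega> * B \<omega>" for \<omega> by (simp add: S_def B_def t_def)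
  have "(\<lambda>\<omega>. (A n \<omega>)\<^sup>2) \<in> borel_measurable (past t)" "(\<lambda>\<omega>. (B \<omega>)\<^sup>2) \<in> borel_measurable (future t)"
    using An(1) B(1) by measurable
  from expectation_past_mult_future[OF t(1) this An(2) B(4)]
  have AB: "integrable M (\<lambda>\<omega>. (A n \<omega> * B \<omega>)\<^sup>2)"
    "expectation (\<lambda>\<omega>. (A n \<omega> * B \<omega>)\<^sup>2) = expectation (\<lambda>\<omega>. (A n \<omega>)\<^sup>2) * w"
    by (auto simp: power_mult_distrib B)
  have SA: "(\<lambda>\<omega>. S n \<omega> * A n \<omega>) \<in> borel_measurable (past t)" "integrable M (\<lambda>\<omega>. S n \<omega> * A n \<omega>)"
    using IH An by (auto intro!: integrable_mult_of_squares)
  from expectation_past_mult_future[OF t(1) SA(1) B(1) SA(2) B(2)]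
  have SAB: "integrable M (\<lambda>\<omega>. S n \<omega> * (A n \<omega> * B \<omega>))" "expectation (\<lambda>\<omega>. S n \<omega> * (A n \<omega> * B \<omega>)) = 0"
    by (auto simp: B mult.assoc)
  have sq: "(S (Suc n) \<omega>)\<^sup>2 = (S n \<omega>)\<^sup>2 + 2 * (S n \<omega> * (A n \<omega> * B \<omega>)) + (A n \<omega> * B \<omega>)\<^sup>2" for \<omega>
    unfolding Sn by (simp add: power2_sum)
  have "integrable M (\<lambda>\<omega>. (S (Suc n) \<omega>)\<^sup>2)"
    unfolding sq using IH AB SAB by auto
  moreover have "expectation (\<lambda>\<omega>. (S (Suc n) \<omega>)\<^sup>2) = w * (\<Sum>k<Suc n. expectation (\<lambda>\<omega>. (A k \<omega>)\<^sup>2))"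
    unfolding sq using IH AB SAB by (simp add: distrib_left mult.commute[of _ w])
  moreover have "S (Suc n) \<in> borel_measurable (past (s + real (Suc n) * w))"
  proof -
    have m: "f \<in> borel_measurable (past (s + real (Suc n) * w))" if "f \<in> borel_measurable (past t)" for f :: "'a \<Rightarrow> real"
      using measurable_past_mono[OF _ that] t by simp
    have "B \<in> borel_measurable (past (s + real (Suc n) * w))"
      unfolding B_def using t by (intro incr_past_measurable) auto
    with m[OF IH(1)] m[OF An(1)] show ?thesis unfolding Sn[abs_def] by measurable
  qed
  ultimately show ?case by blast
qed

text \<open>Treats time and Wiener integrators alike: the isometry for the latter, the
  Cauchy-Schwarz inequality together with \<open>n * w \<le> 1\<close> for the former.\<close>

lemma ito_sum_bound:
  fixes j :: "'m option"
  assumes s: "0 \<le> s" and w: "0 < w" and n: "real n * w \<le> 1"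
    and A: "\<And>k. k < n \<Longrightarrow> A k \<in> borel_measurable (past (s + real k * w))"
    and int: "\<And>k. k < n \<Longrightarrow> integrable M (\<lambda>\<omega>. (A k \<omega>)\<^sup>2)"
  defines "S \<equiv> \<lambda>\<omega>. \<Sum>k<n. A k \<omega> * incr j W (s + real k * w) (s + real (Suc k) * w) \<omega>"
  shows "integrable M (\<lambda>\<omega>. (S \<omega>)\<^sup>2)" (is ?int)
    and "expectation (\<lambda>\<omega>. (S \<omega>)\<^sup>2) \<le> w * (\<Sum>k<n. expectation (\<lambda>\<omega>. (A k \<omega>)\<^sup>2))" (is ?bnd)
proof -
  have "?int \<and> ?bnd"
  proof (cases j)
    case (Some i)
    then show ?thesis
      using ito_sum_Some[OF s w, of n A i] A int unfolding S_def by auto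
  next
    case None
    have Am[measurable]: "k < n \<Longrightarrow> A k \<in> borel_measurable M" for k
      using measurable_past_M[OF A] .
    have S: "S = (\<lambda>\<omega>. w * (\<Sum>k<n. A k \<omega>))"
      unfolding S_def None by (auto simp: incr_def sum_distrib_left algebra_simps)
    have le: "(S \<omega>)\<^sup>2 \<le> w * (\<Sum>k<n. (A k \<omega>)\<^sup>2)" for \<omega>
    proof -
      have "(S \<omega>)\<^sup>2 = w\<^sup>2 * (\<Sum>k<n. A k \<omega>)\<^sup>2" by (simp add: S power_mult_distrib)
      also have "\<dots> \<le> w\<^sup>2 * (real n * (\<Sum>k<n. (A k \<omega>)\<^sup>2))"
        using sum_squared_le_sum_of_squares[of "\<lambda>k. A k \<omega>" "{..<n}"]
        by (intro mult_left_mono) (auto simp: mult.commute)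
      also have "\<dots> = (real n * w) * (w * (\<Sum>k<n. (A k \<omega>)\<^sup>2))" by (simp add: power2_eq_square)
      also have "\<dots> \<le> 1 * (w * (\<Sum>k<n. (A k \<omega>)\<^sup>2))"
        using n w by (intro mult_right_mono mult_nonneg_nonneg sum_nonneg) auto
      finally show ?thesis by simp
    qed
    have i1: "integrable M (\<lambda>\<omega>. w * (\<Sum>k<n. (A k \<omega>)\<^sup>2))"
      using int by auto
    have [measurable]: "S \<in> borel_measurable M" unfolding S by (intro borel_measurable_times borel_measurable_sum) auto
    have i2: "integrable M (\<lambda>\<omega>. (S \<omega>)\<^sup>2)"
      by (rule Bochner_Integration.integrable_bound[OF i1]) (use order_trans[OF le abs_ge_self] in auto)
    have "expectation (\<lambda>\<omega>. (S \<omega>)\<^sup>2) \<le> expectation (\<lambda>\<omega>. w * (\<Sum>k<n. (A k \<omega>)\<^sup>2))"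
      by (rule integral_mono[OF i2 i1 le])
    also have "\<dots> = w * (\<Sum>k<n. expectation (\<lambda>\<omega>. (A k \<omega>)\<^sup>2))"
      using int by simp
    finally show ?thesis using i2 by blast
  qed
  then show ?int ?bnd by auto
qed

end

section \<open>Multiple Ito integrals\<close>

context brownian
begin

text \<open>The sums \<open>rsum\<close> for a deterministic start. The width \<open>w\<close> is a
  parameter separate from the number of summands, so that inner partial sums and sums over refined
  grids are again instances.\<close>

fun dsum :: "real \<Rightarrow> real \<Rightarrow> 'm option list \<Rightarrow> nat \<Rightarrow> 'a \<Rightarrow> real" where
  "dsum s w [] k \<omega> = 1"
| "dsum s w (j # rjs) k \<omega> =
     (\<Sum>i<k. dsum s w rjs i \<omega> * incr j W (s + real i * w) (s + real (Suc i) * w) \<omega>)"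

lemma rsum_eq_dsum: "rsum W s \<Delta> N rjs k \<omega> = dsum (s \<omega>) (\<Delta> \<omega> / real N) rjs k \<omega>"
  by (induction rjs arbitrary: k) (auto intro!: sum.cong)

lemma dsum_past_measurable:
  assumes "0 \<le> s" "0 \<le> w"
  shows "dsum s w r k \<in> borel_measurable (past (s + real k * w))"
proof (induction r arbitrary: k)
  case Nil
  then show ?case by simp
next
  case (Cons j r)
  have "(\<lambda>\<omega>. \<Sum>i<k. dsum s w r i \<omega> * incr j W (s + real i * w) (s + real (Suc i) * w) \<omega>)
    \<in> borel_measurable (past (s + real k * w))"
  proof (intro borel_measurable_sum borel_measurable_times)
    fix i assume "i \<in> {..<k}"
    then have "real (Suc i) * w \<le> real k * w" "real i * w \<le> real k * w"
      using assms by (auto intro!: mult_right_mono)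
    then show "dsum s w r i \<in> borel_measurable (past (s + real k * w))"
      "incr j W (s + real i * w) (s + real (Suc i) * w) \<in> borel_measurable (past (s + real k * w))"
      using assms by (auto intro!: measurable_past_mono[OF _ Cons.IH] incr_past_measurable)
  qed
  then show ?case by simp
qed

lemma dsum_future_measurable:
  assumes "0 \<le> w"
  shows "dsum s w r k \<in> borel_measurable (future s)"
proof (induction r arbitrary: k)
  case Nil
  then show ?case by simp
next
  case (Cons j r)
  have "(\<lambda>\<omega>. \<Sum>i<k. dsum s w r i \<omega> * incr j W (s + real i * w) (s + real (Suc i) * w) \<omega>)
    \<in> borel_measurable (future s)"
    using assms by (intro borel_measurable_sum borel_measurable_times Cons.IH incr_future_measurable) auto
  then show ?case by simp
qed

lemma dsum_measurable [measurable]: "dsum s w r k \<in> borel_measurable M"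
proof (induction r arbitrary: k)
  case (Cons j r)
  have "(\<lambda>\<omega>. \<Sum>i<k. dsum s w r i \<omega> * incr j W (s + real i * w) (s + real (Suc i) * w) \<omega>)
    \<in> borel_measurable M"
    by (intro borel_measurable_sum borel_measurable_times Cons.IH incr_measurable)
  then show ?case by simp
next
  case Nil
  have "dsum s w [] k = (\<lambda>_. 1)" by (rule ext) simp
  then show ?case by simp
qed

text \<open>One application of \<open>ito_sum_bound\<close> per integrator, each contributing a
  factor \<open>k * w\<close>.\<close>

lemma dsum_second_moment:
  assumes "0 \<le> s" "0 < w" "real k * w \<le> 1"
  shows "integrable M (\<lambda>\<omega>. (dsum s w r k \<omega>)\<^sup>2)" (is ?int)
    and "expectation (\<lambda>\<omega>. (dsum s w r k \<omega>)\<^sup>2) \<le> (real k * w) ^ length r" (is ?bnd)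
proof -
  have "?int \<and> ?bnd"
    using assms(3)
  proof (induction r arbitrary: k)
    case Nil
    then show ?case by (simp add: prob_space)
  next
    case (Cons j r)
    have le: "real i * w \<le> real k * w" if "i < k" for i
      using that assms by (auto intro!: mult_right_mono)
    have IH: "integrable M (\<lambda>\<omega>. (dsum s w r i \<omega>)\<^sup>2)"
      "expectation (\<lambda>\<omega>. (dsum s w r i \<omega>)\<^sup>2) \<le> (real k * w) ^ length r" if "i < k" for i
    proof -
      have "real i * w \<le> 1" using le[OF that] Cons.prems by simp
      note Cons.IH[OF this]
      moreover have "(real i * w) ^ length r \<le> (real k * w) ^ length r"
        using le[OF that] assms by (intro power_mono) auto
      ultimately show "integrable M (\<lambda>\<omega>. (dsum s w r i \<omega>)\<^sup>2)"
        "expectation (\<lambda>\<omega>. (dsum s w r i \<omega>)\<^sup>2) \<le> (real k * w) ^ length r" by auto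
    qed
    have m: "dsum s w r i \<in> borel_measurable (past (s + real i * w))" for i
      using assms by (intro dsum_past_measurable) auto
    note * = ito_sum_bound[OF assms(1,2) Cons.prems m IH(1), of j]
    have "w * (\<Sum>i<k. expectation (\<lambda>\<omega>. (dsum s w r i \<omega>)\<^sup>2)) \<le> w * (\<Sum>i<k. (real k * w) ^ length r)"
      using IH(2) assms by (intro mult_left_mono sum_mono) auto
    also have "\<dots> = (real k * w) ^ length (j # r)" by simp
    finally show ?case using * by auto
  qed
  then show ?int ?bnd by auto
qed

lemma dsum_increment_second_moment:
  assumes "0 \<le> s" "0 < w" "real k * w \<le> 1" "l \<le> k"
  shows "integrable M (\<lambda>\<omega>. (dsum s w r k \<omega> - dsum s w r l \<omega>)\<^sup>2)" (is ?int)
    and "expectation (\<lambda>\<omega>. (dsum s w r k \<omega> - dsum s w r l \<omega>)\<^sup>2) \<le> real (k - l) * w" (is ?bnd)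
proof -
  have "?int \<and> ?bnd"
  proof (cases r)
    case Nil
    then show ?thesis using assms by simp
  next
    case (Cons j r')
    \<comment> \<open>Switching the integrand off before index \<open>l\<close> presents the
      increment as an Ito sum over the whole range \<open>{..<k}\<close>, to which the isometry
      bound applies.\<close>
    define A where "A = (\<lambda>i \<omega>. if i < l then 0 else dsum s w r' i \<omega>)"
    have m: "A i \<in> borel_measurable (past (s + real i * w))" for i
      using dsum_past_measurable[of s w r' i] assms by (auto simp: A_def)
    have le: "real i * w \<le> 1" if "i < k" for i
      using mult_right_mono[of "real i" "real k" w, OF _ less_imp_le[OF assms(2)]] that assms(3) by linarith
    have int: "integrable M (\<lambda>\<omega>. (A i \<omega>)\<^sup>2)" if "i < k" for i
      using dsum_second_moment(1)[OF assms(1,2) le[OF that], of r'] by (cases "i < l") (auto simp: A_def)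
    have eq: "dsum s w r k \<omega> - dsum s w r l \<omega> =
      (\<Sum>i<k. A i \<omega> * incr j W (s + real i * w) (s + real (Suc i) * w) \<omega>)" (is "_ = (\<Sum>i<k. ?f i)") for \<omega>
    proof -
      let ?g = "\<lambda>i. dsum s w r' i \<omega> * incr j W (s + real i * w) (s + real (Suc i) * w) \<omega>"
      have "{..<k} = {..<l} \<union> {l..<k}" "{..<l} \<inter> {l..<k} = {}" using assms(4) by auto
      then have "sum h {..<k} = sum h {..<l} + sum h {l..<k}" for h :: "nat \<Rightarrow> real"
        by (metis finite_atLeastLessThan finite_lessThan sum.union_disjoint)
      moreover have "sum ?f {..<l} = 0" by (simp add: A_def)
      moreover have "sum ?f {l..<k} = sum ?g {l..<k}" by (rule sum.cong) (auto simp: A_def)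
      ultimately show ?thesis by (simp add: Cons)
    qed
    have E1: "expectation (\<lambda>\<omega>. (A i \<omega>)\<^sup>2) \<le> (if i < l then 0 else 1)" if "i < k" for i
    proof (cases "i < l")
      case False
      have "(real i * w) ^ length r' \<le> 1" using le[OF that] assms by (intro power_le_one) auto
      with dsum_second_moment(2)[OF assms(1,2) le[OF that], of r'] False show ?thesis
        by (simp add: A_def)
    qed (simp add: A_def)
    have "(\<Sum>i<k. expectation (\<lambda>\<omega>. (A i \<omega>)\<^sup>2)) \<le> (\<Sum>i<k. if i < l then 0 else 1)"
      by (rule sum_mono) (use E1 in auto)
    also have "\<dots> = real (k - l)"
      by (subst sum.If_cases) (auto simp: Int_def card_atLeastLessThan[symmetric] simp del: card_atLeastLessThan intro!: arg_cong[where f=card])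
    finally have "w * (\<Sum>i<k. expectation (\<lambda>\<omega>. (A i \<omega>)\<^sup>2)) \<le> real (k - l) * w"
      using assms(2) by (simp add: mult.commute)
    with ito_sum_bound[OF assms(1,2,3) m int, of j]
    show ?thesis unfolding eq by auto
  qed
  then show ?int ?bnd by auto
qed

lemma sum_incr:
  assumes "m \<le> n"
  shows "(\<Sum>i=m..<n. incr j W (f i) (f (Suc i)) \<omega>) = incr j W (f m) (f n) \<omega>"
  using assms by (induction n rule: dec_induct) (auto simp: incr_def split: option.splits)

text \<open>A coarse increment is the sum of its fine increments. Hence coarse and fine sums share
  their integrators, and their difference is an Ito sum on the fine grid; the coarse integrand is
  frozen at the last coarse grid point.\<close>

lemma dsum_coarse:
  assumes "0 < N"
  shows "dsum s (real N * w) (j # r) k \<omega> =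
    (\<Sum>m<k * N. dsum s (real N * w) r (m div N) \<omega> * incr j W (s + real m * w) (s + real (Suc m) * w) \<omega>)"
    (is "_ = (\<Sum>m<k * N. ?f m)")
proof -
  have "(\<Sum>m<k * N. ?f m) = (\<Sum>i<k. \<Sum>m=i*N..<i*N+N. ?f m)"
    by (rule sum.nat_group[symmetric])
  also have "\<dots> = (\<Sum>i<k. dsum s (real N * w) r i \<omega> *
      incr j W (s + real i * (real N * w)) (s + real (Suc i) * (real N * w)) \<omega>)"
  proof (rule sum.cong[OF refl])
    fix i
    have "(\<Sum>m=i*N..<i*N+N. ?f m) = (\<Sum>m=i*N..<i*N+N. dsum s (real N * w) r i \<omega> *
        incr j W (s + real m * w) (s + real (Suc m) * w) \<omega>)"
    proof (rule sum.cong[OF refl])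
      fix m assume "m \<in> {i*N..<i*N+N}"
      then have "m div N = i" by (intro div_nat_eqI) (auto simp: mult.commute)
      then show "?f m = dsum s (real N * w) r i \<omega> * incr j W (s + real m * w) (s + real (Suc m) * w) \<omega>"
        by simp
    qed
    also have "\<dots> = dsum s (real N * w) r i \<omega> * incr j W (s + real (i*N) * w) (s + real (i*N+N) * w) \<omega>"
      by (simp only: sum_incr[where f="\<lambda>m. s + real m * w", OF le_add1] flip: sum_distrib_left)
    also have "real (i*N) * w = real i * (real N * w)" by simp
    also have "real (i*N+N) * w = real (Suc i) * (real N * w)" by (simp add: algebra_simps)
    finally show "(\<Sum>m=i*N..<i*N+N. ?f m) = dsum s (real N * w) r i \<omega> *
      incr j W (s + real i * (real N * w)) (s + real (Suc i) * (real N * w)) \<omega>" .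
  qed
  finally show ?thesis by simp
qed

text \<open>The factor 2 comes from \<open>(x + y)^2 \<le> 2 x^2 + 2 y^2\<close>, the summand 1 from
  the oscillation of the inner fine sum within one coarse cell.\<close>

primrec refine_const :: "nat \<Rightarrow> real" where
  "refine_const 0 = 0"
| "refine_const (Suc l) = 2 * (refine_const l + 1)"

lemma refine_const_nonneg: "0 \<le> refine_const l"
  by (induction l) auto

text \<open>Induction on the integrators. By \<open>dsum_coarse\<close> the difference is an Ito sum
  whose integrand \<open>A m\<close> splits at the last coarse grid point: the inner refinement
  error there is covered by the induction hypothesis, and the increment of the inner fine sum since
  then spans at most one coarse cell.\<close>

lemma dsum_refine:
  assumes s: "0 \<le> s" and w: "0 < w" and N: "0 < N" and k: "real k * (real N * w) \<le> 1"
  shows "integrable M (\<lambda>\<omega>. (dsum s (real N * w) r k \<omega> - dsum s w r (k * N) \<omega>)\<^sup>2)" (is ?int)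
    and "expectation (\<lambda>\<omega>. (dsum s (real N * w) r k \<omega> - dsum s w r (k * N) \<omega>)\<^sup>2)
      \<le> refine_const (length r) * (real N * w)" (is ?bnd)
proof -
  have "?int \<and> ?bnd"
    using k
  proof (induction r arbitrary: k)
    case Nil
    then show ?case by simp
  next
    case (Cons j r)
    let ?c = "refine_const (length r)"
    define A where "A = (\<lambda>m \<omega>. dsum s (real N * w) r (m div N) \<omega> - dsum s w r m \<omega>)"
    have eq: "dsum s (real N * w) (j # r) k \<omega> - dsum s w (j # r) (k * N) \<omega> =
      (\<Sum>m<k * N. A m \<omega> * incr j W (s + real m * w) (s + real (Suc m) * w) \<omega>)" for \<omega>
      unfolding dsum_coarse[OF N] dsum.simps(2)[of s w j r] by (simp add: A_def sum_subtractf left_diff_distrib)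
    have kN: "real (k * N) * w \<le> 1" using Cons.prems by (simp add: mult.assoc)
    have m: "A m \<in> borel_measurable (past (s + real m * w))" for m
    proof -
      have "real (m div N) * real N \<le> real m"
        by (metis of_nat_mult of_nat_mono div_times_less_eq_dividend)
      then have "real (m div N) * (real N * w) \<le> real m * w"
        using mult_right_mono[of "real (m div N) * real N" "real m" w] w by (simp add: mult.assoc)
      then have "dsum s (real N * w) r (m div N) \<in> borel_measurable (past (s + real m * w))"
        using s w by (intro measurable_past_mono[OF _ dsum_past_measurable]) auto
      moreover have "dsum s w r m \<in> borel_measurable (past (s + real m * w))"
        using s w by (intro dsum_past_measurable) auto
      ultimately show ?thesis unfolding A_def by measurable
    qed
    have E: "integrable M (\<lambda>\<omega>. (A m \<omega>)\<^sup>2) \<and> expectation (\<lambda>\<omega>. (A m \<omega>)\<^sup>2) \<le> 2 * (?c + 1) * (real N * w)"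
      if m: "m < k * N" for m
    proof -
      let ?q = "m div N"
      have q: "?q < k" using m N by (simp add: div_less_iff_less_mult)
      then have "real ?q * (real N * w) \<le> real k * (real N * w)" using w by (intro mult_right_mono) auto
      with Cons.prems have "real ?q * (real N * w) \<le> 1" by linarith
      note 1 = Cons.IH[OF this]
      have le: "?q * N \<le> m" by simp
      have mw: "real m * w \<le> 1"
        using mult_right_mono[of "real m" "real (k * N)" w, OF _ less_imp_le[OF w]] kN m by linarith
      note 2 = dsum_increment_second_moment[OF s w mw le, of r]
      have eqA: "A m \<omega> = (dsum s (real N * w) r ?q \<omega> - dsum s w r (?q * N) \<omega>) + (- (dsum s w r m \<omega> - dsum s w r (?q * N) \<omega>))" for \<omega>
        by (simp add: A_def)
      have "m - ?q * N \<le> N" using N by (simp add: minus_div_mult_eq_mod less_imp_le)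
      then have "real (m - ?q * N) * w \<le> real N * w" using w by (intro mult_right_mono of_nat_mono) auto
      with 2(2) have "expectation (\<lambda>\<omega>. (dsum s w r m \<omega> - dsum s w r (?q * N) \<omega>)\<^sup>2) \<le> real N * w" by linarith
      moreover have "expectation (\<lambda>\<omega>. (A m \<omega>)\<^sup>2) \<le>
        2 * expectation (\<lambda>\<omega>. (dsum s (real N * w) r ?q \<omega> - dsum s w r (?q * N) \<omega>)\<^sup>2) +
        2 * expectation (\<lambda>\<omega>. (- (dsum s w r m \<omega> - dsum s w r (?q * N) \<omega>))\<^sup>2)"
        unfolding eqA by (rule square_sum_expectation) (use 1 2 in \<open>auto simp: power2_commute\<close>)
      ultimately have "expectation (\<lambda>\<omega>. (A m \<omega>)\<^sup>2) \<le> 2 * (?c + 1) * (real N * w)"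
        using 1 by (simp add: power2_commute algebra_simps)
      moreover have "integrable M (\<lambda>\<omega>. (A m \<omega>)\<^sup>2)"
        unfolding eqA by (rule integrable_square_add) (use 1 2 in \<open>auto simp: power2_commute\<close>)
      ultimately show ?thesis by blast
    qed
    note * = ito_sum_bound[OF s w kN m conjunct1[OF E], of j]
    have "w * (\<Sum>m<k*N. expectation (\<lambda>\<omega>. (A m \<omega>)\<^sup>2)) \<le> w * (\<Sum>m<k*N. 2 * (?c + 1) * (real N * w))"
      using E w by (intro mult_left_mono sum_mono) auto
    also have "\<dots> = (real (k * N) * w) * (2 * (?c + 1) * (real N * w))" by simp
    also have "\<dots> \<le> 1 * (2 * (?c + 1) * (real N * w))"
      using kN w refine_const_nonneg[of "length r"] by (intro mult_right_mono) auto
    finally show ?case using * unfolding eq by auto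
  qed
  then show ?int ?bnd by auto
qed

lemma dsum_refine_unit:
  assumes "0 \<le> s" "0 < \<Delta>" "\<Delta> \<le> 1" "0 < L" "0 < N"
  shows "integrable M (\<lambda>\<omega>. (dsum s (\<Delta> / real L) r L \<omega> - dsum s (\<Delta> / real (L * N)) r (L * N) \<omega>)\<^sup>2)"
    and "expectation (\<lambda>\<omega>. (dsum s (\<Delta> / real L) r L \<omega> - dsum s (\<Delta> / real (L * N)) r (L * N) \<omega>)\<^sup>2)
      \<le> refine_const (length r) / real L"
proof -
  have eq: "\<Delta> / real L = real N * (\<Delta> / real (L * N))" using assms by (simp add: field_simps)
  have 1: "real L * (real N * (\<Delta> / real (L * N))) \<le> 1" using assms by simp
  have "refine_const (length r) * (real N * (\<Delta> / real (L * N))) \<le> refine_const (length r) * (1 / real L)"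
    using assms refine_const_nonneg by (intro mult_left_mono) (auto simp: divide_right_mono simp flip: eq)
  with dsum_refine[OF assms(1) _ assms(5) 1, of r] assms
  show "integrable M (\<lambda>\<omega>. (dsum s (\<Delta> / real L) r L \<omega> - dsum s (\<Delta> / real (L * N)) r (L * N) \<omega>)\<^sup>2)"
    and "expectation (\<lambda>\<omega>. (dsum s (\<Delta> / real L) r L \<omega> - dsum s (\<Delta> / real (L * N)) r (L * N) \<omega>)\<^sup>2)
      \<le> refine_const (length r) / real L"
    unfolding eq by auto
qed

text \<open>Along the meshes \<open>\<Delta> / 4 ^ k\<close> the increments are summable in \<open>L\<^sup>1\<close>, so the limit exists almost
  surely; being pathwise, it is measurable with respect to both \<open>future s\<close> and \<open>past (s + \<Delta>)\<close>.\<close>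

definition mint :: "'m option list \<Rightarrow> real \<Rightarrow> real \<Rightarrow> 'a \<Rightarrow> real" where
  "mint js s \<Delta> \<omega> = lim (\<lambda>k. dsum s (\<Delta> / real (4 ^ k)) (rev js) (4 ^ k) \<omega>)"

lemma mint_future_measurable: "0 \<le> \<Delta> \<Longrightarrow> mint js s \<Delta> \<in> borel_measurable (future s)"
  unfolding mint_def[abs_def] by (intro borel_measurable_lim_metric dsum_future_measurable) auto

lemma mint_past_measurable:
  assumes "0 \<le> s" "0 \<le> \<Delta>"
  shows "mint js s \<Delta> \<in> borel_measurable (past (s + \<Delta>))"
  unfolding mint_def[abs_def]
proof (intro borel_measurable_lim_metric)
  fix k
  show "dsum s (\<Delta> / real (4 ^ k)) (rev js) (4 ^ k) \<in> borel_measurable (past (s + \<Delta>))"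
    using dsum_past_measurable[of s "\<Delta> / real (4 ^ k)" "rev js" "4^k"] assms by simp
qed

lemma mint_measurable [measurable]: "mint js s \<Delta> \<in> borel_measurable M"
  unfolding mint_def[abs_def] by measurable

lemma mint_single: "mint [j] s \<Delta> \<omega> = incr j W s (s + \<Delta>) \<omega>"
proof -
  have "dsum s (\<Delta> / real (4 ^ k)) [j] (4 ^ k) \<omega> = incr j W s (s + \<Delta>) \<omega>" for k
    using sum_incr[where f="\<lambda>m. s + real m * (\<Delta> / real (4 ^ k))" and m=0 and n="4^k" and j=j and \<omega>=\<omega>]
    by (simp add: lessThan_atLeast0)
  then show ?thesis by (simp add: mint_def del: dsum.simps)
qed

lemma AE_mint:
  assumes "0 \<le> s" "0 < \<Delta>" "\<Delta> \<le> 1"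
  shows "AE \<omega> in M. (\<lambda>k. dsum s (\<Delta> / real (4 ^ k)) (rev js) (4 ^ k) \<omega>) \<longlonglongrightarrow> mint js s \<Delta> \<omega>"
proof -
  let ?X = "\<lambda>k. dsum s (\<Delta> / real (4 ^ k)) (rev js) (4 ^ k)"
  have "AE \<omega> in M. convergent (\<lambda>k. ?X k \<omega>)"
  proof (rule AE_convergent_of_square_increments)
    fix k
    have "(4::nat) ^ Suc k = 4 ^ k * 4" by simp
    then show "integrable M (\<lambda>\<omega>. (?X (Suc k) \<omega> - ?X k \<omega>)\<^sup>2)"
      "expectation (\<lambda>\<omega>. (?X (Suc k) \<omega> - ?X k \<omega>)\<^sup>2) \<le> refine_const (length js) / 4 ^ k"
      using dsum_refine_unit[OF assms, of "4^k" 4 "rev js"]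
      unfolding power2_commute[of "?X (Suc k) _" "?X k _"] by (simp_all add: mult.commute)
  qed measurable
  then show ?thesis
    by eventually_elim (auto simp: mint_def convergent_LIMSEQ_iff)
qed

lemma mint_second_moment:
  assumes "0 \<le> s" "0 < \<Delta>" "\<Delta> \<le> 1"
  shows "integrable M (\<lambda>\<omega>. (mint js s \<Delta> \<omega>)\<^sup>2)"
    and "expectation (\<lambda>\<omega>. (mint js s \<Delta> \<omega>)\<^sup>2) \<le> \<Delta> ^ length js"
proof -
  have "integrable M (\<lambda>\<omega>. (dsum s (\<Delta> / real (4 ^ k)) (rev js) (4 ^ k) \<omega>)\<^sup>2)"
    "expectation (\<lambda>\<omega>. (dsum s (\<Delta> / real (4 ^ k)) (rev js) (4 ^ k) \<omega>)\<^sup>2) \<le> \<Delta> ^ length js" for k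
    using dsum_second_moment[OF assms(1), of "\<Delta> / real (4 ^ k)" "4^k" "rev js"] assms by simp_all
  from square_expectation_lim[OF _ _ AE_mint[OF assms, of js] this]
  show "integrable M (\<lambda>\<omega>. (mint js s \<Delta> \<omega>)\<^sup>2)"
    and "expectation (\<lambda>\<omega>. (mint js s \<Delta> \<omega>)\<^sup>2) \<le> \<Delta> ^ length js" by simp_all
qed

text \<open>A mesh with \<open>N\<close> pieces need not belong to the sequence with
  \<open>4 ^ k\<close> pieces that defines \<open>mint\<close>; both are compared with their common
  refinement, and the bound passes to the limit.\<close>

lemma dsum_mint_error:
  assumes "0 \<le> s" "0 < \<Delta>" "\<Delta> \<le> 1" "0 < N"
  shows "integrable M (\<lambda>\<omega>. (dsum s (\<Delta> / real N) (rev js) N \<omega> - mint js s \<Delta> \<omega>)\<^sup>2)"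
    and "expectation (\<lambda>\<omega>. (dsum s (\<Delta> / real N) (rev js) N \<omega> - mint js s \<Delta> \<omega>)\<^sup>2)
      \<le> 4 * refine_const (length js) / real N"
proof -
  let ?d = "\<lambda>L. dsum s (\<Delta> / real L) (rev js) L" and ?c = "refine_const (length js)"
  \<comment> \<open>The shift of the exponent by \<open>N\<close> ensures
    \<open>N \<le> 4 ^ (k + N)\<close> for every \<open>k\<close>, so the finer grid's own error is
    also at most of order \<open>1 / N\<close>; two such errors, doubled by squaring a sum, give the
    factor 4.\<close>
  define X where "X = (\<lambda>k \<omega>. ?d N \<omega> - ?d (4 ^ (k + N)) \<omega>)"
  have X: "integrable M (\<lambda>\<omega>. (X k \<omega>)\<^sup>2) \<and> expectation (\<lambda>\<omega>. (X k \<omega>)\<^sup>2) \<le> 4 * ?c / real N" for k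
  proof -
    let ?L = "4 ^ (k + N) :: nat"
    have eq: "X k \<omega> = (?d N \<omega> - ?d (N * ?L) \<omega>) + (- (?d ?L \<omega> - ?d (?L * N) \<omega>))" for \<omega>
      by (simp add: X_def mult.commute)
    note 1 = dsum_refine_unit[OF assms(1-4), of ?L "rev js"]
    note 2 = dsum_refine_unit[OF assms(1-3) _ assms(4), of ?L "rev js"]
    have "N \<le> ?L"
      using less_exp[of N] power_mono[of "2::nat" 4 N] power_increasing[of N "k + N" "4::nat"] by linarith
    then have "?c / real ?L \<le> ?c / real N"
      using assms refine_const_nonneg by (intro divide_left_mono) auto
    moreover have "integrable M (\<lambda>\<omega>. (X k \<omega>)\<^sup>2)"
      unfolding eq by (rule integrable_square_add) (use 1 2 in \<open>auto simp: power2_commute\<close>)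
    moreover have "expectation (\<lambda>\<omega>. (X k \<omega>)\<^sup>2) \<le> 2 * expectation (\<lambda>\<omega>. (?d N \<omega> - ?d (N * ?L) \<omega>)\<^sup>2) +
        2 * expectation (\<lambda>\<omega>. (- (?d ?L \<omega> - ?d (?L * N) \<omega>))\<^sup>2)"
      unfolding eq by (rule square_sum_expectation) (use 1 2 in \<open>auto simp: power2_commute\<close>)
    ultimately show ?thesis
      using 1(2) 2(2) by (simp add: power2_commute)
  qed
  have "AE \<omega> in M. (\<lambda>k. X k \<omega>) \<longlonglongrightarrow> ?d N \<omega> - mint js s \<Delta> \<omega>"
    using AE_mint[OF assms(1-3), of js]
  proof eventually_elim
    fix \<omega> assume "(\<lambda>k. ?d (4 ^ k) \<omega>) \<longlonglongrightarrow> mint js s \<Delta> \<omega>"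
    from LIMSEQ_ignore_initial_segment[OF this, of N]
    show "(\<lambda>k. X k \<omega>) \<longlonglongrightarrow> ?d N \<omega> - mint js s \<Delta> \<omega>"
      unfolding X_def by (intro tendsto_intros)
  qed
  from square_expectation_lim[OF _ _ this, of "4 * ?c / real N"] X
  show "integrable M (\<lambda>\<omega>. (?d N \<omega> - mint js s \<Delta> \<omega>)\<^sup>2)"
    and "expectation (\<lambda>\<omega>. (?d N \<omega> - mint js s \<Delta> \<omega>)\<^sup>2) \<le> 4 * ?c / real N"
    by (simp_all add: X_def)
qed

end

section \<open>Multiple integrals at random times\<close>

lemma measurable_finite_valued_compose:
  fixes f :: "'a \<Rightarrow> real"
  assumes "f \<in> borel_measurable M" "\<And>\<omega>. \<omega> \<in> space M \<Longrightarrow> f \<omega> \<in> A" "finite A"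
    and "\<And>a. a \<in> A \<Longrightarrow> g a \<in> M \<rightarrow>\<^sub>M N"
  shows "(\<lambda>\<omega>. g (f \<omega>) \<omega>) \<in> M \<rightarrow>\<^sub>M N"
proof (rule measurable_compose_countable'[where I = A])
  show "f \<in> M \<rightarrow>\<^sub>M count_space A"
    using assms(1-3) by (subst measurable_count_space_eq2) (auto intro: measurable_sets)
qed (use assms in \<open>auto simp: countable_finite\<close>)

lemma (in prob_space) conv_in_prob_AE_unique:
  assumes [measurable]: "\<And>N. Y N \<in> borel_measurable M" "Z1 \<in> borel_measurable M" "Z2 \<in> borel_measurable M"
    and 1: "conv_in_prob M Y Z1" and 2: "conv_in_prob M Y Z2"
  shows "AE \<omega> in M. Z1 \<omega> = Z2 \<omega>"
proof -
  have "AE \<omega> in M. \<bar>Z1 \<omega> - Z2 \<omega>\<bar> \<le> 2 * \<epsilon>" if "0 < \<epsilon>" for \<epsilon> :: real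
  proof -
    let ?D = "{\<omega>\<in>space M. 2 * \<epsilon> < \<bar>Z1 \<omega> - Z2 \<omega>\<bar>}"
    let ?E = "\<lambda>Z N. {\<omega>\<in>space M. \<epsilon> < \<bar>Y N \<omega> - Z \<omega>\<bar>}"
    have le: "prob ?D \<le> prob (?E Z1 N) + prob (?E Z2 N)" for N
    proof -
      have "prob ?D \<le> prob (?E Z1 N \<union> ?E Z2 N)"
        by (rule finite_measure_mono) auto
      also have "\<dots> \<le> prob (?E Z1 N) + prob (?E Z2 N)"
        by (rule measure_Un_le) auto
      finally show ?thesis .
    qed
    have "(\<lambda>N. prob (?E Z1 N) + prob (?E Z2 N)) \<longlonglongrightarrow> 0 + 0"
      using 1 2 that unfolding conv_in_prob_def by (intro tendsto_add) auto
    from LIMSEQ_le_const[OF this, of "prob ?D"] le have "prob ?D \<le> 0" by auto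
    then have "prob ?D = 0" by (simp add: measure_le_0_iff)
    then have "emeasure M ?D = 0" by (simp add: emeasure_eq_measure)
    then have "?D \<in> null_sets M" by auto
    then show ?thesis
      by (rule AE_I') auto
  qed
  from this[of "1 / real (Suc _)"] have "AE \<omega> in M. \<forall>n. \<bar>Z1 \<omega> - Z2 \<omega>\<bar> \<le> 2 * (1 / real (Suc n))"
    unfolding AE_all_countable by (simp del: of_nat_Suc)
  then show ?thesis
  proof eventually_elim
    fix \<omega> assume *: "\<forall>n. \<bar>Z1 \<omega> - Z2 \<omega>\<bar> \<le> 2 * (1 / real (Suc n))"
    have "(\<lambda>n. 2 * (1 / real (Suc n))) \<longlonglongrightarrow> 2 * 0"
      using LIMSEQ_inverse_real_of_nat by (intro tendsto_mult tendsto_const) (simp add: inverse_eq_divide)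
    from LIMSEQ_le_const[OF this, of "\<bar>Z1 \<omega> - Z2 \<omega>\<bar>"] * show "Z1 \<omega> = Z2 \<omega>" by auto
  qed
qed

context brownian
begin

lemma prob_dsum_mint_error:
  assumes "0 \<le> s" "0 < \<Delta>" "\<Delta> \<le> 1" "0 < N" "0 < \<epsilon>"
  shows "prob {\<omega>\<in>space M. \<epsilon> < \<bar>dsum s (\<Delta> / real N) (rev js) N \<omega> - mint js s \<Delta> \<omega>\<bar>}
    \<le> 4 * refine_const (length js) / \<epsilon>\<^sup>2 / real N"
proof -
  let ?X = "\<lambda>\<omega>. dsum s (\<Delta> / real N) (rev js) N \<omega> - mint js s \<Delta> \<omega>"
  note * = dsum_mint_error[OF assms(1-4), of js]
  have "prob {\<omega>\<in>space M. \<epsilon> < \<bar>?X \<omega>\<bar>} \<le> prob {\<omega>\<in>space M. \<epsilon>\<^sup>2 \<le> (?X \<omega>)\<^sup>2}"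
  proof (rule finite_measure_mono)
    show "{\<omega>\<in>space M. \<epsilon> < \<bar>?X \<omega>\<bar>} \<subseteq> {\<omega>\<in>space M. \<epsilon>\<^sup>2 \<le> (?X \<omega>)\<^sup>2}"
      using assms(5) by (auto simp: abs_le_square_iff[symmetric])
  qed measurable
  also have "\<dots> \<le> expectation (\<lambda>\<omega>. (?X \<omega>)\<^sup>2) / \<epsilon>\<^sup>2"
    by (rule integral_Markov_inequality_measure[where A="space M"]) (use * assms in auto)
  also have "\<dots> \<le> (4 * refine_const (length js) / real N) / \<epsilon>\<^sup>2"
    using * by (intro divide_right_mono) auto
  finally show ?thesis by (simp add: field_simps)
qed

text \<open>\<open>itoI\<close> is some limit in probability, and such limits agree almost surely,
  so it suffices that \<open>mint\<close>, evaluated at the random arguments, is one as well. These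
  take finitely many values, hence the error event lies in a finite union of deterministic error
  events, each of probability of order \<open>1 / N\<close>.\<close>

lemma itoI_eq_mint:
  assumes [measurable]: "s \<in> borel_measurable M" "\<Delta> \<in> borel_measurable M"
    and A: "finite A" "\<And>\<omega>. \<omega> \<in> space M \<Longrightarrow> s \<omega> \<in> A" "A \<subseteq> {0..}"
    and B: "finite B" "\<And>\<omega>. \<omega> \<in> space M \<Longrightarrow> \<Delta> \<omega> \<in> B" "B \<subseteq> {0<..1}"
  shows "itoI M W js s \<Delta> \<in> borel_measurable M"
    and "AE \<omega> in M. itoI M W js s \<Delta> \<omega> = mint js (s \<omega>) (\<Delta> \<omega>) \<omega>"
proof -
  define Z where "Z = (\<lambda>\<omega>. mint js (s \<omega>) (\<Delta> \<omega>) \<omega>)"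
  define Y where "Y = (\<lambda>N. rsum W s \<Delta> N (rev js) N)"
  have comp: "(\<lambda>\<omega>. g (s \<omega>) (\<Delta> \<omega>) \<omega>) \<in> borel_measurable M"
    if "\<And>a b. a \<in> A \<Longrightarrow> b \<in> B \<Longrightarrow> g a b \<in> borel_measurable M" for g :: "real \<Rightarrow> real \<Rightarrow> 'a \<Rightarrow> real"
    by (rule measurable_finite_valued_compose[OF assms(1) A(2,1)], assumption)
       (rule measurable_finite_valued_compose[OF assms(2) B(2,1)], auto intro: that)
  have Z[measurable]: "Z \<in> borel_measurable M"
    unfolding Z_def by (rule comp) auto
  have Y_eq: "Y N = (\<lambda>\<omega>. dsum (s \<omega>) (\<Delta> \<omega> / real N) (rev js) N \<omega>)" for N
    by (auto simp: Y_def rsum_eq_dsum)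
  have Y[measurable]: "Y N \<in> borel_measurable M" for N
    unfolding Y_eq by (rule comp[of "\<lambda>s \<Delta>. dsum s (\<Delta> / real N) (rev js) N"]) auto
  have conv: "conv_in_prob M Y Z"
    unfolding conv_in_prob_def
  proof (intro allI impI)
    fix \<epsilon> :: real assume \<epsilon>: "0 < \<epsilon>"
    let ?c = "real (card (A \<times> B)) * (4 * refine_const (length js) / \<epsilon>\<^sup>2)"
    let ?E = "\<lambda>N (a, b). {\<omega>\<in>space M. \<epsilon> < \<bar>dsum a (b / real N) (rev js) N \<omega> - mint js a b \<omega>\<bar>}"
    have le: "prob {\<omega>\<in>space M. \<epsilon> < \<bar>Y N \<omega> - Z \<omega>\<bar>} \<le> ?c / real N" if "0 < N" for N
    proof -
      have "prob {\<omega>\<in>space M. \<epsilon> < \<bar>Y N \<omega> - Z \<omega>\<bar>} \<le> prob (\<Union>p\<in>A \<times> B. ?E N p)"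
      proof (rule finite_measure_mono, clarify)
        fix \<omega> assume "\<omega> \<in> space M" "\<epsilon> < \<bar>Y N \<omega> - Z \<omega>\<bar>"
        then show "\<omega> \<in> (\<Union>p\<in>A \<times> B. ?E N p)"
          using A(2) B(2) by (intro UN_I[of "(s \<omega>, \<Delta> \<omega>)"]) (auto simp: Y_eq Z_def)
      qed (use A B in auto)
      also have "\<dots> \<le> (\<Sum>p\<in>A \<times> B. prob (?E N p))"
        by (rule finite_measure_subadditive_finite) (use A B in auto)
      also have "\<dots> \<le> (\<Sum>p\<in>A \<times> B. 4 * refine_const (length js) / \<epsilon>\<^sup>2 / real N)"
      proof (rule sum_mono)
        fix p assume "p \<in> A \<times> B"
        then obtain a b where p: "p = (a, b)" "a \<in> A" "b \<in> B" by auto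
        with A(3) B(3) have "0 \<le> a" "0 < b" "b \<le> 1" by auto
        then show "prob (?E N p) \<le> 4 * refine_const (length js) / \<epsilon>\<^sup>2 / real N"
          using prob_dsum_mint_error[of a b N \<epsilon> js] \<epsilon> that p by simp
      qed
      also have "\<dots> = ?c / real N" by simp
      finally show ?thesis .
    qed
    show "(\<lambda>N. prob {\<omega>\<in>space M. \<epsilon> < \<bar>Y N \<omega> - Z \<omega>\<bar>}) \<longlonglongrightarrow> 0"
    proof (rule tendsto_sandwich[where f="\<lambda>_. 0" and h="\<lambda>N. ?c / real N"])
      show "(\<lambda>N. ?c / real N) \<longlonglongrightarrow> 0" by (rule lim_const_over_n)
      show "\<forall>\<^sub>F N in sequentially. prob {\<omega>\<in>space M. \<epsilon> < \<bar>Y N \<omega> - Z \<omega>\<bar>} \<le> ?c / real N"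
        using eventually_gt_at_top[of 0] by eventually_elim (rule le)
    qed auto
  qed
  have "itoI M W js s \<Delta> \<in> borel_measurable M \<and> conv_in_prob M Y (itoI M W js s \<Delta>)"
  proof -
    have "\<exists>Z. Z \<in> borel_measurable M \<and> conv_in_prob M Y Z" using Z conv by blast
    from someI_ex[OF this] show ?thesis unfolding itoI_def Y_def .
  qed
  then show m: "itoI M W js s \<Delta> \<in> borel_measurable M"
    and "AE \<omega> in M. itoI M W js s \<Delta> \<omega> = mint js (s \<omega>) (\<Delta> \<omega>) \<omega>"
    using conv_in_prob_AE_unique[OF Y _ Z _ conv, of "itoI M W js s \<Delta>"] by (auto simp: Z_def)
qed

end

section \<open>Moments of one step\<close>

context prob_space
begin

text \<open>The joint law is a product measure, so by Fubini's theorem \<open>X\<close> may be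
  frozen. Independence is assumed in its rectangle form, which lets \<open>X\<close> and
  \<open>Z\<close> take values in different types.\<close>

lemma expectation_nonneg_indep:
  fixes f :: "'b \<times> 'c \<Rightarrow> real"
  assumes X[measurable]: "X \<in> M \<rightarrow>\<^sub>M S" and Z[measurable]: "Z \<in> M \<rightarrow>\<^sub>M T"
    and ind: "\<And>A B. A \<in> sets S \<Longrightarrow> B \<in> sets T \<Longrightarrow>
      prob ((X -` A \<inter> space M) \<inter> (Z -` B \<inter> space M)) = prob (X -` A \<inter> space M) * prob (Z -` B \<inter> space M)"
    and f[measurable]: "f \<in> borel_measurable (S \<Otimes>\<^sub>M T)"
    and bnd: "\<And>p. \<bar>f p\<bar> \<le> B"
    and pos: "\<And>x. x \<in> space S \<Longrightarrow> 0 \<le> expectation (\<lambda>\<omega>. f (x, Z \<omega>))"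
  shows "0 \<le> expectation (\<lambda>\<omega>. f (X \<omega>, Z \<omega>))"
proof -
  interpret PX: prob_space "distr M S X" by (rule prob_space_distr) simp
  interpret PZ: prob_space "distr M T Z" by (rule prob_space_distr) simp
  interpret P: pair_prob_space "distr M S X" "distr M T Z" ..
  have eq: "distr M S X \<Otimes>\<^sub>M distr M T Z = distr M (S \<Otimes>\<^sub>M T) (\<lambda>x. (X x, Z x))"
  proof (rule pair_measure_eqI)
    show "sigma_finite_measure (distr M S X)" "sigma_finite_measure (distr M T Z)" by unfold_locales
    show "sets (distr M S X \<Otimes>\<^sub>M distr M T Z) = sets (distr M (S \<Otimes>\<^sub>M T) (\<lambda>x. (X x, Z x)))"
      by (simp cong: sets_pair_measure_cong)
    fix A B assume "A \<in> sets (distr M S X)" "B \<in> sets (distr M T Z)"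
    then have AB[measurable]: "A \<in> sets S" "B \<in> sets T" by auto
    have "(\<lambda>x. (X x, Z x)) -` (A \<times> B) \<inter> space M = (X -` A \<inter> space M) \<inter> (Z -` B \<inter> space M)" by auto
    then show "emeasure (distr M S X) A * emeasure (distr M T Z) B =
        emeasure (distr M (S \<Otimes>\<^sub>M T) (\<lambda>x. (X x, Z x))) (A \<times> B)"
      by (simp add: emeasure_distr emeasure_eq_measure ind[OF AB] ennreal_mult)
  qed
  have int: "integrable (distr M S X \<Otimes>\<^sub>M distr M T Z) f"
    by (rule P.integrable_const_bound[where B=B]) (use bnd in auto)
  have "expectation (\<lambda>\<omega>. f (X \<omega>, Z \<omega>)) = integral\<^sup>L (distr M (S \<Otimes>\<^sub>M T) (\<lambda>x. (X x, Z x))) f"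
    by (subst integral_distr) auto
  also have "\<dots> = (\<integral>x. (\<integral>z. f (x, z) \<partial>distr M T Z) \<partial>distr M S X)"
    unfolding eq[symmetric] by (rule P.integral_fst'[OF int, symmetric])
  also have "\<dots> \<ge> 0"
  proof (rule integral_nonneg_AE, rule AE_I2)
    fix x assume "x \<in> space (distr M S X)"
    then have x: "x \<in> space S" by simp
    have [measurable]: "(\<lambda>z. f (x, z)) \<in> borel_measurable T" using f x by measurable
    have "(\<integral>z. f (x, z) \<partial>distr M T Z) = expectation (\<lambda>\<omega>. f (x, Z \<omega>))"
      by (rule integral_distr) auto
    with pos[OF x] show "0 \<le> (\<integral>z. f (x, z) \<partial>distr M T Z)" by simp
  qed
  finally show ?thesis .
qed

end

context brownian
begin

lemma increment_cross:
  assumes "0 \<le> s" "s < t" "i \<noteq> j"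
  shows "expectation (\<lambda>\<omega>. (W t \<omega> $ i - W s \<omega> $ i) * (W t \<omega> $ j - W s \<omega> $ j)) = 0"
proof -
  let ?X = "\<lambda>(j, k) \<omega>. W ([s, t] ! Suc k) \<omega> $ j - W ([s, t] ! k) \<omega> $ j"
  have "indep_vars (\<lambda>_. borel) ?X (UNIV \<times> {k. Suc k < length [s, t]})"
    by (rule increments_indep) (use assms in auto)
  then have "indep_vars (\<lambda>_. borel) ?X {(i, 0), (j, 0)}"
    by (rule indep_vars_subset) auto
  then have "expectation (\<lambda>\<omega>. \<Prod>p\<in>{(i, 0), (j, 0)}. ?X p \<omega>) = (\<Prod>p\<in>{(i, 0), (j, 0)}. expectation (?X p))"
    using increment_moments(1)[OF assms(1,2), of _ 1]
    by (intro indep_vars_lebesgue_integral) auto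
  with assms(3) increment_moments(2)[OF assms(1,2)] show ?thesis by simp
qed

definition dW :: "real \<Rightarrow> real \<Rightarrow> 'a \<Rightarrow> real^'m" where
  "dW s \<tau> \<omega> = W (s + \<tau>) \<omega> - W s \<omega>"

lemma dW_measurable [measurable]: "dW s \<tau> \<in> borel_measurable M"
  unfolding dW_def[abs_def] by measurable

lemma dW_moments:
  assumes "0 \<le> s" "0 < \<tau>"
  shows "integrable M (\<lambda>\<omega>. dW s \<tau> \<omega> $ j)" "expectation (\<lambda>\<omega>. dW s \<tau> \<omega> $ j) = 0"
    "integrable M (\<lambda>\<omega>. (dW s \<tau> \<omega> $ j)\<^sup>2)" "expectation (\<lambda>\<omega>. (dW s \<tau> \<omega> $ j)\<^sup>2) = \<tau>"
    "integrable M (\<lambda>\<omega>. (dW s \<tau> \<omega> $ j)^4)" "expectation (\<lambda>\<omega>. (dW s \<tau> \<omega> $ j)^4) = 3 * \<tau>\<^sup>2"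
    "integrable M (\<lambda>\<omega>. dW s \<tau> \<omega> $ i * dW s \<tau> \<omega> $ j)"
    "i \<noteq> j \<Longrightarrow> expectation (\<lambda>\<omega>. dW s \<tau> \<omega> $ i * dW s \<tau> \<omega> $ j) = 0"
proof -
  have lt: "s < s + \<tau>" using assms by simp
  note m = increment_moments[OF assms(1) lt]
  show sq: "integrable M (\<lambda>\<omega>. (dW s \<tau> \<omega> $ j)\<^sup>2)" for j using m(1)[of j 2] by (simp add: dW_def)
  show "integrable M (\<lambda>\<omega>. dW s \<tau> \<omega> $ j)" "expectation (\<lambda>\<omega>. dW s \<tau> \<omega> $ j) = 0"
    "expectation (\<lambda>\<omega>. (dW s \<tau> \<omega> $ j)\<^sup>2) = \<tau>"
    "integrable M (\<lambda>\<omega>. (dW s \<tau> \<omega> $ j)^4)" "expectation (\<lambda>\<omega>. (dW s \<tau> \<omega> $ j)^4) = 3 * \<tau>\<^sup>2"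
    using m(1)[of j 1] m(1)[of j 4] m(2-)[of j] by (simp_all add: dW_def)
  show "integrable M (\<lambda>\<omega>. dW s \<tau> \<omega> $ i * dW s \<tau> \<omega> $ j)"
    by (intro integrable_mult_of_squares sq) auto
  show "expectation (\<lambda>\<omega>. dW s \<tau> \<omega> $ i * dW s \<tau> \<omega> $ j) = 0" if "i \<noteq> j"
    using increment_cross[OF assms(1) lt that] by (simp add: dW_def)
qed

lemma linear_dW_moments:
  assumes "0 \<le> s" "0 < \<tau>"
  shows "integrable M (\<lambda>\<omega>. \<Sum>j\<in>UNIV. \<beta> j * dW s \<tau> \<omega> $ j)"
    "expectation (\<lambda>\<omega>. \<Sum>j\<in>UNIV. \<beta> j * dW s \<tau> \<omega> $ j) = 0"
    "integrable M (\<lambda>\<omega>. (\<Sum>j\<in>UNIV. \<beta> j * dW s \<tau> \<omega> $ j)\<^sup>2)"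
    "expectation (\<lambda>\<omega>. (\<Sum>j\<in>UNIV. \<beta> j * dW s \<tau> \<omega> $ j)\<^sup>2) = \<tau> * (\<Sum>j\<in>UNIV. (\<beta> j)\<^sup>2)"
proof -
  note m = dW_moments[OF assms]
  show "integrable M (\<lambda>\<omega>. \<Sum>j\<in>UNIV. \<beta> j * dW s \<tau> \<omega> $ j)"
    "expectation (\<lambda>\<omega>. \<Sum>j\<in>UNIV. \<beta> j * dW s \<tau> \<omega> $ j) = 0"
    using m by simp_all
  have sq: "(\<Sum>j\<in>UNIV. \<beta> j * dW s \<tau> \<omega> $ j)\<^sup>2 =
      (\<Sum>i\<in>UNIV. \<Sum>j\<in>UNIV. (\<beta> i * \<beta> j) * (dW s \<tau> \<omega> $ i * dW s \<tau> \<omega> $ j))" for \<omega>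
    by (simp add: power2_eq_square sum_product mult_ac)
  show "integrable M (\<lambda>\<omega>. (\<Sum>j\<in>UNIV. \<beta> j * dW s \<tau> \<omega> $ j)\<^sup>2)"
    unfolding sq using m(7) by auto
  have "expectation (\<lambda>\<omega>. (\<Sum>j\<in>UNIV. \<beta> j * dW s \<tau> \<omega> $ j)\<^sup>2) =
      (\<Sum>i\<in>UNIV. \<Sum>j\<in>UNIV. (\<beta> i * \<beta> j) * expectation (\<lambda>\<omega>. dW s \<tau> \<omega> $ i * dW s \<tau> \<omega> $ j))"
    unfolding sq using m(7) by simp
  also have "\<dots> = (\<Sum>i\<in>UNIV. \<Sum>j\<in>UNIV. if j = i then (\<beta> i)\<^sup>2 * \<tau> else 0)"
  proof (intro sum.cong refl)
    fix i j
    show "(\<beta> i * \<beta> j) * expectation (\<lambda>\<omega>. dW s \<tau> \<omega> $ i * dW s \<tau> \<omega> $ j) = (if j = i then (\<beta> i)\<^sup>2 * \<tau> else 0)"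
      using m(8)[of i j] m(4)[of i] by (auto simp: power2_eq_square)
  qed
  also have "\<dots> = \<tau> * (\<Sum>j\<in>UNIV. (\<beta> j)\<^sup>2)" by (simp add: sum_distrib_left mult.commute)
  finally show "expectation (\<lambda>\<omega>. (\<Sum>j\<in>UNIV. \<beta> j * dW s \<tau> \<omega> $ j)\<^sup>2) = \<tau> * (\<Sum>j\<in>UNIV. (\<beta> j)\<^sup>2)" .
qed

definition dW_sq :: "real \<Rightarrow> real \<Rightarrow> 'a \<Rightarrow> real" where
  "dW_sq s \<tau> \<omega> = (\<Sum>j\<in>UNIV. (dW s \<tau> \<omega> $ j)\<^sup>2)"

lemma dW_sq_measurable [measurable]: "dW_sq s \<tau> \<in> borel_measurable M"
  unfolding dW_sq_def[abs_def] by measurable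

lemma dW_sq_moments:
  assumes "0 \<le> s" "0 < \<tau>"
  shows "integrable M (dW_sq s \<tau>)" "expectation (dW_sq s \<tau>) = real CARD('m) * \<tau>"
    "integrable M (\<lambda>\<omega>. (dW_sq s \<tau> \<omega>)\<^sup>2)" "expectation (\<lambda>\<omega>. (dW_sq s \<tau> \<omega>)\<^sup>2) \<le> 3 * (real CARD('m))\<^sup>2 * \<tau>\<^sup>2"
proof -
  note m = dW_moments[OF assms]
  show "integrable M (dW_sq s \<tau>)" "expectation (dW_sq s \<tau>) = real CARD('m) * \<tau>"
    unfolding dW_sq_def[abs_def] using m by simp_all
  have i1: "integrable M (\<lambda>\<omega>. real CARD('m) * (\<Sum>j\<in>UNIV. (dW s \<tau> \<omega> $ j)^4))" using m(5) by simp
  have le: "(dW_sq s \<tau> \<omega>)\<^sup>2 \<le> real CARD('m) * (\<Sum>j\<in>UNIV. (dW s \<tau> \<omega> $ j)^4)" for \<omega>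
    using sum_squared_le_sum_of_squares[of "\<lambda>j. (dW s \<tau> \<omega> $ j)\<^sup>2" UNIV]
    by (simp add: dW_sq_def mult.commute flip: power_mult)
  show i2: "integrable M (\<lambda>\<omega>. (dW_sq s \<tau> \<omega>)\<^sup>2)"
    by (rule Bochner_Integration.integrable_bound[OF i1]) (use order_trans[OF le abs_ge_self] in auto)
  have "expectation (\<lambda>\<omega>. (dW_sq s \<tau> \<omega>)\<^sup>2) \<le> expectation (\<lambda>\<omega>. real CARD('m) * (\<Sum>j\<in>UNIV. (dW s \<tau> \<omega> $ j)^4))"
    by (rule integral_mono[OF i2 i1 le])
  also have "\<dots> = 3 * (real CARD('m))\<^sup>2 * \<tau>\<^sup>2" using m(5,6) by (simp add: power2_eq_square)
  finally show "expectation (\<lambda>\<omega>. (dW_sq s \<tau> \<omega>)\<^sup>2) \<le> 3 * (real CARD('m))\<^sup>2 * \<tau>\<^sup>2" .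
qed

lemma sum_mint_moments:
  assumes s: "0 \<le> s" "0 < \<tau>" "\<tau> \<le> 1" and J: "finite J" "\<And>js. js \<in> J \<Longrightarrow> 2 \<le> length js"
  defines "S \<equiv> \<lambda>\<omega>. \<tau> + (\<Sum>js\<in>J. \<bar>mint js s \<tau> \<omega>\<bar>)"
  shows "integrable M S" "expectation S \<le> (1 + real (card J)) * \<tau>"
    "integrable M (\<lambda>\<omega>. (S \<omega>)\<^sup>2)" "expectation (\<lambda>\<omega>. (S \<omega>)\<^sup>2) \<le> 2 * (1 + (real (card J))\<^sup>2) * \<tau>\<^sup>2"
proof -
  let ?I = "\<lambda>js \<omega>. mint js s \<tau> \<omega>"
  have sq: "integrable M (\<lambda>\<omega>. (?I js \<omega>)\<^sup>2)" "expectation (\<lambda>\<omega>. (?I js \<omega>)\<^sup>2) \<le> \<tau>\<^sup>2" if "js \<in> J" for js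
  proof -
    have "\<tau> ^ length js \<le> \<tau>\<^sup>2" using J(2)[OF that] s by (intro power_decreasing) auto
    with mint_second_moment[OF s, of js]
    show "integrable M (\<lambda>\<omega>. (?I js \<omega>)\<^sup>2)" "expectation (\<lambda>\<omega>. (?I js \<omega>)\<^sup>2) \<le> \<tau>\<^sup>2" by auto
  qed
  have int: "integrable M (\<lambda>\<omega>. \<bar>?I js \<omega>\<bar>)" if "js \<in> J" for js
    using integrable_of_square[OF mint_measurable sq(1)[OF that]] by simp
  have E: "expectation (\<lambda>\<omega>. \<bar>?I js \<omega>\<bar>) \<le> \<tau>" if js: "js \<in> J" for js
  proof -
    \<comment> \<open>Weighted so that both terms are of order \<open>\<tau>\<close> when the second
      moment is at most \<open>\<tau>^2\<close>.\<close>
    have "\<bar>y\<bar> \<le> (\<tau> + y\<^sup>2 / \<tau>) / 2" for y :: real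
    proof -
      have "0 \<le> (\<tau> - \<bar>y\<bar>)\<^sup>2 / \<tau>" using s by simp
      also have "\<dots> = \<tau> + y\<^sup>2 / \<tau> - 2 * \<bar>y\<bar>" using s by (simp add: power2_diff field_simps power2_eq_square)
      finally show ?thesis by simp
    qed
    then have "expectation (\<lambda>\<omega>. \<bar>?I js \<omega>\<bar>) \<le> expectation (\<lambda>\<omega>. (\<tau> + (?I js \<omega>)\<^sup>2 / \<tau>) / 2)"
      using int[OF js] sq(1)[OF js] by (intro integral_mono) auto
    also have "\<dots> = (\<tau> + expectation (\<lambda>\<omega>. (?I js \<omega>)\<^sup>2) / \<tau>) / 2"
      using sq(1)[OF js] by (simp add: prob_space)
    also have "\<dots> \<le> (\<tau> + \<tau>\<^sup>2 / \<tau>) / 2"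
      using sq(2)[OF js] s by (intro divide_right_mono add_left_mono) auto
    finally show ?thesis using s by (simp add: power2_eq_square)
  qed
  show i1: "integrable M S" unfolding S_def using int by auto
  have "expectation S = \<tau> + (\<Sum>js\<in>J. expectation (\<lambda>\<omega>. \<bar>?I js \<omega>\<bar>))"
    unfolding S_def using int by (simp add: prob_space)
  also have "\<dots> \<le> \<tau> + (\<Sum>js\<in>J. \<tau>)" using E by (intro add_left_mono sum_mono)
  finally show "expectation S \<le> (1 + real (card J)) * \<tau>" by (simp add: algebra_simps)
  have le: "(S \<omega>)\<^sup>2 \<le> 2 * \<tau>\<^sup>2 + 2 * (real (card J) * (\<Sum>js\<in>J. (?I js \<omega>)\<^sup>2))" for \<omega>
  proof -
    have "(S \<omega>)\<^sup>2 \<le> 2 * \<tau>\<^sup>2 + 2 * (\<Sum>js\<in>J. \<bar>?I js \<omega>\<bar>)\<^sup>2"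
      unfolding S_def using zero_le_power2[of "\<tau> - (\<Sum>js\<in>J. \<bar>?I js \<omega>\<bar>)"] by (simp add: power2_sum power2_diff)
    moreover have "(\<Sum>js\<in>J. \<bar>?I js \<omega>\<bar>)\<^sup>2 \<le> real (card J) * (\<Sum>js\<in>J. (?I js \<omega>)\<^sup>2)"
      using sum_squared_le_sum_of_squares[of "\<lambda>js. \<bar>?I js \<omega>\<bar>" J] by (simp add: mult.commute)
    ultimately show ?thesis by linarith
  qed
  have i2: "integrable M (\<lambda>\<omega>. 2 * \<tau>\<^sup>2 + 2 * (real (card J) * (\<Sum>js\<in>J. (?I js \<omega>)\<^sup>2)))" using sq by auto
  have [measurable]: "S \<in> borel_measurable M" unfolding S_def by measurable
  show i3: "integrable M (\<lambda>\<omega>. (S \<omega>)\<^sup>2)"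
    by (rule Bochner_Integration.integrable_bound[OF i2]) (use order_trans[OF le abs_ge_self] in auto)
  have "expectation (\<lambda>\<omega>. (S \<omega>)\<^sup>2) \<le> expectation (\<lambda>\<omega>. 2 * \<tau>\<^sup>2 + 2 * (real (card J) * (\<Sum>js\<in>J. (?I js \<omega>)\<^sup>2)))"
    by (rule integral_mono[OF i3 i2 le])
  also have "\<dots> = 2 * \<tau>\<^sup>2 + 2 * (real (card J) * (\<Sum>js\<in>J. expectation (\<lambda>\<omega>. (?I js \<omega>)\<^sup>2)))"
    using sq by (simp add: prob_space)
  also have "\<dots> \<le> 2 * \<tau>\<^sup>2 + 2 * (real (card J) * (\<Sum>js\<in>J. \<tau>\<^sup>2))"
    using sq by (intro add_left_mono mult_left_mono sum_mono) auto
  finally show "expectation (\<lambda>\<omega>. (S \<omega>)\<^sup>2) \<le> 2 * (1 + (real (card J))\<^sup>2) * \<tau>\<^sup>2"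
    by (simp add: algebra_simps power2_eq_square)
qed

end

section \<open>The barrier along one step\<close>

locale sde_domain = brownian M W + smooth_coefficients a b
  for M :: "'a measure" and W :: "real \<Rightarrow> 'a \<Rightarrow> real^'m::finite"
    and a :: "real^'d::finite \<Rightarrow> real^'d" and b :: "real^'d \<Rightarrow> real^'m^'d" +
  fixes D :: "(real^'d) set" and R cb :: real
  assumes D_open: "open D" and D_bounded: "bounded D" and D_exterior: "ball_exterior D R"
    and cb_pos: "0 < cb"
    and elliptic: "\<And>x \<xi>. x \<in> D \<Longrightarrow> cb * (norm \<xi>)\<^sup>2 \<le> \<xi> \<bullet> ((b x ** transpose (b x)) *v \<xi>)"
begin

abbreviation bd_dist :: "real^'d \<Rightarrow> real" where
  "bd_dist x \<equiv> infdist x (frontier D)"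

definition next_pos :: "real^'d \<Rightarrow> real \<Rightarrow> real \<Rightarrow> 'a \<Rightarrow> real^'d" where
  "next_pos x s \<tau> \<omega> = taylor15 a b x \<tau> (\<lambda>js. mint js s \<tau> \<omega>)"

lemma mint_eq_dW: "(\<chi> j. mint [Some j] s \<tau> \<omega>) = dW s \<tau> \<omega>"
  by (simp add: vec_eq_iff mint_single incr_def dW_def)

lemma next_pos_measurable [measurable]: "next_pos x s \<tau> \<in> borel_measurable M"
  unfolding next_pos_def[abs_def] by (rule taylor15_measurable) auto

lemma inner_diffusion_sq:
  assumes "x \<in> D" "norm n = 1"
  shows "cb \<le> (\<Sum>j\<in>UNIV. ((n v* b x) $ j)\<^sup>2)"
proof -
  have "cb \<le> n \<bullet> (b x *v (transpose (b x) *v n))"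
    using elliptic[OF assms(1), of n] unfolding matrix_vector_mul_assoc assms(2) by simp
  also have "\<dots> = (n v* b x) \<bullet> (n v* b x)"
    by (simp add: dot_lmul_matrix[symmetric])
  also have "\<dots> = (\<Sum>j\<in>UNIV. ((n v* b x) $ j)\<^sup>2)"
    by (simp add: inner_vec_def power2_eq_square)
  finally show ?thesis .
qed

text \<open>\<open>pot_lower_bound\<close> is integrated. The linear Gaussian term has mean zero,
  its square contributes at least \<open>cb * \<tau>\<close> by ellipticity, and the errors are
  first replaced by multiples of \<open>V\<close>, \<open>V^2\<close> and \<open>N^2\<close>, so
  that the minorant \<open>F\<close> is integrable with explicit moments.\<close>

lemma step_expectation:
  obtains C1 C2 C3 where "0 < C1" "0 < C2" "0 < C3"
    "\<And>\<delta> K x s \<tau>. 0 < \<delta> \<Longrightarrow> 0 < K \<Longrightarrow> 0 < \<tau> \<Longrightarrow> \<tau> \<le> 1 \<Longrightarrow> 0 \<le> s \<Longrightarrow> x \<in> D \<Longrightarrow>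
      bd_dist x < K \<Longrightarrow>
      (let z = \<delta> + bd_dist x in
        pot D \<delta> K x - C1 * \<tau> / z^2 + cb * \<tau> / (4 * z^3) - C2 * \<tau>^2 / z^3 - C3 * \<tau>^2 / z^5)
      \<le> expectation (\<lambda>\<omega>. pot D \<delta> K (next_pos x s \<tau> \<omega>))"
proof -
  have R: "0 < R" using D_exterior by (simp add: ball_exterior_def)
  obtain B where B: "1 \<le> B" "\<And>x. x \<in> D \<Longrightarrow> remainder_bound x \<le> B"
    "\<And>x. x \<in> D \<Longrightarrow> (\<Sum>i\<in>UNIV. \<Sum>j\<in>UNIV. \<bar>b x $ i $ j\<bar>) \<le> B"
    using coefficient_bound[OF D_bounded] by metis
  define m where "m = real CARD('m)"
  define H where "H = real (card higher)"
  have m: "0 < m" by (simp add: m_def)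
  have H: "0 \<le> H" by (simp add: H_def)
  \<comment> \<open>\<open>c1\<close> joins the curvature of the exterior ball to the bound of the
    Taylor remainder, so that \<open>U \<le> c1 * V\<close>; \<open>c2\<close> and \<open>c3\<close>
    are the factors of \<open>\<tau>\<close> and \<open>\<tau>^2\<close> in the first and second
    moment of \<open>V\<close>.\<close>
  define c1 where "c1 = B\<^sup>2 * m / (2 * R) + B"
  have c1: "0 < c1" using B R m by (simp add: c1_def add_nonneg_pos)
  define c2 where "c2 = m + 1 + H"
  define c3 where "c3 = 6 * m\<^sup>2 + 4 * (1 + H\<^sup>2)"
  show thesis
  proof (rule that[of "c1 * c2" "29 * c1\<^sup>2 * c3" "448 * (B\<^sup>2 * m)\<^sup>2 * (3 * m\<^sup>2)"])
    show "0 < c1 * c2" using c1 m H by (simp add: c2_def)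
    show "0 < 29 * c1\<^sup>2 * c3" using c1 m by (simp add: c3_def add_pos_nonneg)
    show "0 < 448 * (B\<^sup>2 * m)\<^sup>2 * (3 * m\<^sup>2)" using B m by simp
    fix \<delta> K :: real and x :: "real^'d" and s \<tau> :: real
    assume \<delta>: "0 < \<delta>" and K: "0 < K" and \<tau>: "0 < \<tau>" "\<tau> \<le> 1" and s: "0 \<le> s"
      and x: "x \<in> D" "bd_dist x < K"
    define z where "z = \<delta> + bd_dist x"
    have z: "0 < z" using \<delta> infdist_nonneg[of x "frontier D"] by (simp add: z_def)
    obtain n where n: "norm n = 1" and low:
      "\<And>y u. let z = \<delta> + bd_dist x; G = n \<bullet> y; U = (norm y)\<^sup>2 / (2 * R) + norm u in
        pot D \<delta> K x - (G + U) / z^2 + G^2 / (4 * z^3) - 29 * U^2 / z^3 - 448 * G^4 / z^5 \<le> pot D \<delta> K (x + y + u)"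
      using pot_lower_bound[OF D_exterior D_open D_bounded x(1) \<delta> K x(2)] by metis
    define G where "G = (\<lambda>\<omega>. \<Sum>j\<in>UNIV. (n v* b x) $ j * dW s \<tau> \<omega> $ j)"
    define S where "S = (\<lambda>\<omega>. \<tau> + (\<Sum>js\<in>higher. \<bar>mint js s \<tau> \<omega>\<bar>))"
    define N where "N = dW_sq s \<tau>"
    define V where "V = (\<lambda>\<omega>. N \<omega> + S \<omega>)"
    define F where "F = (\<lambda>\<omega>. pot D \<delta> K x - (G \<omega> + c1 * V \<omega>) / z^2 + (G \<omega>)^2 / (4 * z^3)
      - 29 * c1\<^sup>2 * (V \<omega>)^2 / z^3 - 448 * (B\<^sup>2 * m)\<^sup>2 * (N \<omega>)^2 / z^5)"
    have le: "F \<omega> \<le> pot D \<delta> K (next_pos x s \<tau> \<omega>)" for \<omega>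
    proof -
      \<comment> \<open>The displacement splits as required by \<open>pot_lower_bound\<close>:
        \<open>y\<close> is the Gaussian part and \<open>u\<close> everything else.\<close>
      define w where "w = dW s \<tau> \<omega>"
      define y where "y = b x *v w"
      define u where "u = next_pos x s \<tau> \<omega> - x - y"
      define U where "U = (norm y)\<^sup>2 / (2 * R) + norm u"
      have Geq: "n \<bullet> y = G \<omega>"
        unfolding y_def dot_lmul_matrix[symmetric] by (simp add: G_def w_def inner_vec_def)
      have N0: "0 \<le> N \<omega>" by (auto simp: N_def dW_sq_def intro!: sum_nonneg)
      have S0: "0 \<le> S \<omega>" using \<tau> by (auto simp: S_def intro!: add_nonneg_nonneg sum_nonneg)
      have "norm y \<le> B * (\<Sum>j\<in>UNIV. \<bar>w $ j\<bar>)"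
        unfolding y_def using diffusion_bound[of x w] B(3)[OF x(1)]
        by (rule order_trans[OF _ mult_right_mono]) (auto intro: sum_nonneg)
      then have "(norm y)\<^sup>2 \<le> (B * (\<Sum>j\<in>UNIV. \<bar>w $ j\<bar>))\<^sup>2" by (intro power_mono) auto
      also have "\<dots> \<le> B\<^sup>2 * (m * N \<omega>)"
        unfolding power_mult_distrib
        using sum_squared_le_sum_of_squares[of "\<lambda>j. \<bar>w $ j\<bar>" UNIV]
        by (intro mult_left_mono) (auto simp: N_def dW_sq_def w_def m_def mult.commute)
      finally have y2: "(norm y)\<^sup>2 \<le> B\<^sup>2 * m * N \<omega>" by (simp add: mult.assoc)
      have u: "norm u \<le> B * S \<omega>"
      proof -
        have "norm u \<le> remainder_bound x * S \<omega>"
          using taylor15_remainder[of \<tau> x "\<lambda>js. mint js s \<tau> \<omega>"] \<tau>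
          by (simp add: u_def next_pos_def y_def w_def mint_eq_dW S_def)
        also have "\<dots> \<le> B * S \<omega>" using B(2)[OF x(1)] S0 by (rule mult_right_mono)
        finally show ?thesis .
      qed
      have U0: "0 \<le> U" using R by (simp add: U_def)
      have U: "U \<le> c1 * V \<omega>"
      proof -
        have "U \<le> (B\<^sup>2 * m * N \<omega>) / (2 * R) + B * S \<omega>"
          unfolding U_def using y2 u R by (intro add_mono divide_right_mono) auto
        also have "\<dots> = (B\<^sup>2 * m / (2 * R)) * N \<omega> + B * S \<omega>" by simp
        also have "\<dots> \<le> c1 * N \<omega> + c1 * S \<omega>"
          using N0 S0 B R m by (intro add_mono mult_right_mono) (auto simp: c1_def)
        finally show ?thesis by (simp add: V_def distrib_left)
      qed
      have U2: "U^2 \<le> c1\<^sup>2 * (V \<omega>)^2"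
        using power_mono[OF U U0, of 2] by (simp add: power_mult_distrib)
      have G4: "(G \<omega>)^4 \<le> (B\<^sup>2 * m)\<^sup>2 * (N \<omega>)^2"
      proof -
        have "\<bar>G \<omega>\<bar> \<le> norm y" using Cauchy_Schwarz_ineq2[of n y] n by (simp add: Geq)
        then have "(G \<omega>)\<^sup>2 \<le> (norm y)\<^sup>2" by (simp add: abs_le_square_iff[symmetric])
        also note y2
        finally have "((G \<omega>)\<^sup>2)\<^sup>2 \<le> (B\<^sup>2 * m * N \<omega>)\<^sup>2" by (rule power_mono) simp
        then show ?thesis by (simp add: power_mult_distrib flip: power_mult)
      qed
      have "F \<omega> \<le> pot D \<delta> K x - (G \<omega> + U) / z^2 + (G \<omega>)^2 / (4 * z^3) - 29 * U^2 / z^3 - 448 * (G \<omega>)^4 / z^5"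
      proof -
        have "(G \<omega> + U) / z^2 \<le> (G \<omega> + c1 * V \<omega>) / z^2" using U z by (intro divide_right_mono) auto
        moreover have "29 * U^2 / z^3 \<le> 29 * c1\<^sup>2 * (V \<omega>)^2 / z^3"
          using U2 z by (intro divide_right_mono) auto
        moreover have "448 * (G \<omega>)^4 / z^5 \<le> 448 * (B\<^sup>2 * m)\<^sup>2 * (N \<omega>)^2 / z^5"
          using G4 z by (intro divide_right_mono) auto
        ultimately show ?thesis unfolding F_def by linarith
      qed
      also have "\<dots> \<le> pot D \<delta> K (x + y + u)"
        using low[of y u] by (simp add: Let_def z_def[symmetric] Geq U_def[symmetric])
      also have "x + y + u = next_pos x s \<tau> \<omega>" by (simp add: u_def)
      finally show ?thesis .
    qed
    have G: "integrable M G" "expectation G = 0" "integrable M (\<lambda>\<omega>. (G \<omega>)\<^sup>2)"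
      "cb * \<tau> \<le> expectation (\<lambda>\<omega>. (G \<omega>)\<^sup>2)"
      using linear_dW_moments[OF s \<tau>(1), of "\<lambda>j. (n v* b x) $ j"] inner_diffusion_sq[OF x(1) n] \<tau>
      by (simp_all add: G_def mult.commute)
    have J: "finite (higher :: 'm option list set)" "\<And>js :: 'm option list. js \<in> higher \<Longrightarrow> 2 \<le> length js"
      using finite_higher by (auto simp: higher_def)
    have Sm: "integrable M S" "expectation S \<le> (1 + H) * \<tau>"
      "integrable M (\<lambda>\<omega>. (S \<omega>)\<^sup>2)" "expectation (\<lambda>\<omega>. (S \<omega>)\<^sup>2) \<le> 2 * (1 + H\<^sup>2) * \<tau>\<^sup>2"
      using sum_mint_moments[OF s \<tau> J] by (simp_all add: S_def H_def)
    have Nm: "integrable M N" "expectation N = m * \<tau>"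
      "integrable M (\<lambda>\<omega>. (N \<omega>)\<^sup>2)" "expectation (\<lambda>\<omega>. (N \<omega>)\<^sup>2) \<le> 3 * m\<^sup>2 * \<tau>\<^sup>2"
      using dW_sq_moments[OF s \<tau>(1)] by (simp_all add: N_def m_def)
    have [measurable]: "S \<in> borel_measurable M" "N \<in> borel_measurable M"
      using Sm(1) Nm(1) by auto
    have V: "integrable M V" "expectation V \<le> c2 * \<tau>" "integrable M (\<lambda>\<omega>. (V \<omega>)\<^sup>2)"
      "expectation (\<lambda>\<omega>. (V \<omega>)\<^sup>2) \<le> c3 * \<tau>\<^sup>2"
    proof -
      show "integrable M V" "expectation V \<le> c2 * \<tau>"
        using Sm Nm by (simp_all add: V_def c2_def algebra_simps)
      show "integrable M (\<lambda>\<omega>. (V \<omega>)\<^sup>2)"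
        unfolding V_def using Sm Nm by (intro integrable_square_add) auto
      have "expectation (\<lambda>\<omega>. (V \<omega>)\<^sup>2) \<le> 2 * expectation (\<lambda>\<omega>. (N \<omega>)\<^sup>2) + 2 * expectation (\<lambda>\<omega>. (S \<omega>)\<^sup>2)"
        unfolding V_def using Sm Nm by (intro square_sum_expectation) auto
      also have "\<dots> \<le> c3 * \<tau>\<^sup>2" using Sm(4) Nm(4) by (simp add: c3_def algebra_simps)
      finally show "expectation (\<lambda>\<omega>. (V \<omega>)\<^sup>2) \<le> c3 * \<tau>\<^sup>2" .
    qed
    have F: "integrable M F" "expectation F = pot D \<delta> K x - c1 * expectation V / z^2
        + expectation (\<lambda>\<omega>. (G \<omega>)\<^sup>2) / (4 * z^3) - 29 * c1\<^sup>2 * expectation (\<lambda>\<omega>. (V \<omega>)^2) / z^3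
        - 448 * (B\<^sup>2 * m)\<^sup>2 * expectation (\<lambda>\<omega>. (N \<omega>)^2) / z^5"
      unfolding F_def using G V Nm by (simp_all add: prob_space)
    have "integrable M (\<lambda>\<omega>. pot D \<delta> K (next_pos x s \<tau> \<omega>))"
    proof (rule integrable_const_bound[where B="2 / \<delta>"])
      show "AE \<omega> in M. norm (pot D \<delta> K (next_pos x s \<tau> \<omega>)) \<le> 2 / \<delta>"
        using pot_bounds[OF \<delta> K, of D] by (intro AE_I2) simp
      show "(\<lambda>\<omega>. pot D \<delta> K (next_pos x s \<tau> \<omega>)) \<in> borel_measurable M"
        using measurable_compose[OF next_pos_measurable pot_measurable[OF D_open]] .
    qed
    from integral_mono[OF F(1) this le]
    have E: "expectation F \<le> expectation (\<lambda>\<omega>. pot D \<delta> K (next_pos x s \<tau> \<omega>))" .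
    have "c1 * expectation V / z^2 \<le> c1 * c2 * \<tau> / z^2"
      using V(2) c1 z by (intro divide_right_mono) (auto simp: mult.assoc)
    moreover have "cb * \<tau> / (4 * z^3) \<le> expectation (\<lambda>\<omega>. (G \<omega>)\<^sup>2) / (4 * z^3)"
      using G(4) z by (intro divide_right_mono) auto
    moreover have "29 * c1\<^sup>2 * expectation (\<lambda>\<omega>. (V \<omega>)^2) / z^3 \<le> 29 * c1\<^sup>2 * c3 * \<tau>^2 / z^3"
      using V(4) z c1 by (intro divide_right_mono) (auto simp: mult.assoc)
    moreover have "448 * (B\<^sup>2 * m)\<^sup>2 * expectation (\<lambda>\<omega>. (N \<omega>)^2) / z^5 \<le> 448 * (B\<^sup>2 * m)\<^sup>2 * (3 * m\<^sup>2) * \<tau>^2 / z^5"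
      using Nm(4) z B(1) m by (intro divide_right_mono) (auto simp: mult_ac)
    ultimately show "(let z = \<delta> + bd_dist x in
        pot D \<delta> K x - c1 * c2 * \<tau> / z^2 + cb * \<tau> / (4 * z^3) - 29 * c1\<^sup>2 * c3 * \<tau>^2 / z^3
        - 448 * (B\<^sup>2 * m)\<^sup>2 * (3 * m\<^sup>2) * \<tau>^2 / z^5)
      \<le> expectation (\<lambda>\<omega>. pot D \<delta> K (next_pos x s \<tau> \<omega>))"
      using E F(2) unfolding Let_def z_def[symmetric] by linarith
  qed
qed

text \<open>The constants are uniform in the position, the time and both length scales: the property
  is used for two strips and before \<open>h\<close> is fixed. Smallness of \<open>\<tau>\<close> is
  restricted to distances below \<open>K\<close> because the inner strip is surrounded by a region
  of much larger steps.\<close>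

definition barrier_gains :: "real \<Rightarrow> real \<Rightarrow> bool" where
  "barrier_gains \<rho> \<epsilon> \<longleftrightarrow> (\<forall>\<delta> K x s \<tau>. 0 < \<delta> \<longrightarrow> \<delta> \<le> K \<longrightarrow> K \<le> \<rho> \<longrightarrow> 0 < \<tau> \<longrightarrow> \<tau> \<le> 1 \<longrightarrow> 0 \<le> s \<longrightarrow>
      x \<in> D \<longrightarrow> (bd_dist x < K \<longrightarrow> \<tau> \<le> \<epsilon> * \<delta>\<^sup>2) \<longrightarrow>
      pot D \<delta> K x + (if bd_dist x \<le> \<delta> \<and> \<delta> < K then cb / 128 * \<tau> / \<delta>^3 else 0)
      \<le> expectation (\<lambda>\<omega>. pot D \<delta> K (next_pos x s \<tau> \<omega>)))"

lemma one_step: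
  obtains \<rho> \<epsilon> where "0 < \<rho>" "0 < \<epsilon>" "barrier_gains \<rho> \<epsilon>"
proof -
  obtain C1 C2 C3 where C: "0 < C1" "0 < C2" "0 < C3" and main:
    "\<And>\<delta> K x s \<tau>. 0 < \<delta> \<Longrightarrow> 0 < K \<Longrightarrow> 0 < \<tau> \<Longrightarrow> \<tau> \<le> 1 \<Longrightarrow> 0 \<le> s \<Longrightarrow> x \<in> D \<Longrightarrow>
      bd_dist x < K \<Longrightarrow>
      (let z = \<delta> + bd_dist x in
        pot D \<delta> K x - C1 * \<tau> / z^2 + cb * \<tau> / (4 * z^3) - C2 * \<tau>^2 / z^3 - C3 * \<tau>^2 / z^5)
      \<le> expectation (\<lambda>\<omega>. pot D \<delta> K (next_pos x s \<tau> \<omega>))"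
    by (rule step_expectation) blast
  \<comment> \<open>The second-order gain \<open>cb * \<tau> / (4 * z^3)\<close> is four times
    \<open>cb / 16 * \<tau> / z^3\<close>; each of the three error terms may consume one share. As
    \<open>z \<le> 2 * \<rho>\<close>, the choice of \<open>\<rho>\<close> controls the drift term;
    the two parts of \<open>\<epsilon>\<close> control the terms in \<open>\<tau>^2\<close>, the
    first with \<open>\<delta> \<le> 1\<close>, the second with
    \<open>\<delta> \<le> z\<close>.\<close>
  define \<rho> where "\<rho> = min 1 (cb / (32 * C1))"
  define \<epsilon> where "\<epsilon> = min (cb / (16 * C2)) (cb / (16 * C3))"
  have "0 < \<rho>" using C cb_pos by (simp add: \<rho>_def)
  moreover have \<epsilon>0: "0 < \<epsilon>" using C cb_pos by (simp add: \<epsilon>_def)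
  moreover have "barrier_gains \<rho> \<epsilon>"
    unfolding barrier_gains_def
  proof (intro allI impI)
    fix \<delta> K :: real and x :: "real^'d" and s \<tau> :: real
    assume as: "0 < \<delta>" "\<delta> \<le> K" "K \<le> \<rho>" "0 < \<tau>" "\<tau> \<le> 1" "0 \<le> s" "x \<in> D"
      and small: "bd_dist x < K \<longrightarrow> \<tau> \<le> \<epsilon> * \<delta>\<^sup>2"
    let ?r = "bd_dist x"
    have K: "0 < K" using as by simp
    show "pot D \<delta> K x + (if ?r \<le> \<delta> \<and> \<delta> < K then cb / 128 * \<tau> / \<delta>^3 else 0)
      \<le> expectation (\<lambda>\<omega>. pot D \<delta> K (next_pos x s \<tau> \<omega>))"
    proof (cases "?r < K")
      case False
      then have "pot D \<delta> K x = 1 / (\<delta> + K)" using as(7) by (simp add: pot_def)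
      with pot_min[OF as(1) K, of D] have le: "pot D \<delta> K x \<le> pot D \<delta> K y" for y by simp
      have "integrable M (\<lambda>\<omega>. pot D \<delta> K (next_pos x s \<tau> \<omega>))"
        using pot_bounds[OF as(1) K, of D]
        by (intro integrable_const_bound[where B="2 / \<delta>"])
           (auto intro!: measurable_compose[OF next_pos_measurable pot_measurable[OF D_open]])
      then have "expectation (\<lambda>\<omega>. pot D \<delta> K x) \<le> expectation (\<lambda>\<omega>. pot D \<delta> K (next_pos x s \<tau> \<omega>))"
        using le by (intro integral_mono) auto
      with False show ?thesis by (simp add: prob_space)
    next
      case True
      define z where "z = \<delta> + ?r"
      have z: "0 < z" "\<delta> \<le> z" "z \<le> 2 * \<rho>" using as True infdist_nonneg[of x "frontier D"] by (auto simp: z_def)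
      have sm: "\<tau> \<le> \<epsilon> * \<delta>\<^sup>2" using small True by blast
      have "C1 * \<tau> / z^2 \<le> cb / 16 * \<tau> / z^3"
      proof -
        have "z \<le> 2 * (cb / (32 * C1))" using z(3) by (simp add: \<rho>_def)
        then have "z \<le> cb / (16 * C1)" by simp
        then have "C1 * z \<le> cb / 16" using C by (simp add: field_simps)
        then have "C1 * z * \<tau> / z^3 \<le> cb / 16 * \<tau> / z^3"
          using as z by (intro divide_right_mono mult_right_mono) auto
        then show ?thesis using z by (simp add: power2_eq_square power3_eq_cube)
      qed
      moreover have "C2 * \<tau>^2 / z^3 \<le> cb / 16 * \<tau> / z^3"
      proof -
        have "\<delta>\<^sup>2 \<le> 1" using as by (intro power_le_one) (auto simp: \<rho>_def)
        then have "\<epsilon> * \<delta>\<^sup>2 \<le> \<epsilon>" using \<epsilon>0 by (simp add: mult_left_le)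
        then have "\<tau> \<le> cb / (16 * C2)" using sm by (simp add: \<epsilon>_def)
        then have "C2 * \<tau> \<le> cb / 16" using C by (simp add: field_simps)
        then have "C2 * \<tau> * \<tau> / z^3 \<le> cb / 16 * \<tau> / z^3"
          using as z by (intro divide_right_mono mult_right_mono) auto
        then show ?thesis by (simp add: power2_eq_square mult.assoc)
      qed
      moreover have "C3 * \<tau>^2 / z^5 \<le> cb / 16 * \<tau> / z^3"
      proof -
        have "\<epsilon> * \<delta>\<^sup>2 \<le> cb / (16 * C3) * z\<^sup>2"
          using z as cb_pos C by (intro mult_mono power_mono) (auto simp: \<epsilon>_def)
        then have "\<tau> \<le> cb / (16 * C3) * z\<^sup>2" using sm by linarith
        then have "C3 * \<tau> \<le> cb / 16 * z\<^sup>2" using C by (simp add: field_simps)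
        then have "C3 * \<tau> * \<tau> / z^5 \<le> cb / 16 * z\<^sup>2 * \<tau> / z^5"
          using as z by (intro divide_right_mono mult_right_mono) auto
        also have "\<dots> = cb / 16 * \<tau> / z^3" using z by (simp add: eval_nat_numeral)
        finally show ?thesis by (simp add: power2_eq_square mult.assoc)
      qed
      moreover have "pot D \<delta> K x - C1 * \<tau> / z^2 + cb * \<tau> / (4 * z^3) - C2 * \<tau>^2 / z^3 - C3 * \<tau>^2 / z^5
        \<le> expectation (\<lambda>\<omega>. pot D \<delta> K (next_pos x s \<tau> \<omega>))"
        using main[OF as(1) K as(4-7) True] by (simp add: Let_def z_def)
      moreover have "cb * \<tau> / (4 * z^3) = 4 * (cb / 16 * \<tau> / z^3)" by simp
      ultimately have *: "pot D \<delta> K x + cb / 16 * \<tau> / z^3 \<le> expectation (\<lambda>\<omega>. pot D \<delta> K (next_pos x s \<tau> \<omega>))"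
        by linarith
      have "0 \<le> cb / 16 * \<tau> / z^3" using cb_pos as z by simp
      \<comment> \<open>Inside the strip \<open>z \<le> 2 * \<delta>\<close>, and
        \<open>16 * 2^3 = 128\<close>.\<close>
      moreover have "cb / 128 * \<tau> / \<delta>^3 \<le> cb / 16 * \<tau> / z^3" if "?r \<le> \<delta>"
      proof -
        have "z \<le> 2 * \<delta>" using that by (simp add: z_def)
        then have "z^3 \<le> (2 * \<delta>)^3" using z by (intro power_mono) auto
        then have "cb / 16 * \<tau> / (2 * \<delta>)^3 \<le> cb / 16 * \<tau> / z^3"
          using cb_pos as z by (intro divide_left_mono) auto
        then show ?thesis by (simp add: power_mult_distrib)
      qed
      ultimately show ?thesis using * by auto
    qed
  qed
  ultimately show thesis by (rule that)
qed

end

section \<open>Adaptedness of the scheme\<close>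

locale order15 = sde_domain M W a b D R cb
  for M :: "'a measure" and W :: "real \<Rightarrow> 'a \<Rightarrow> real^'m::finite"
    and a :: "real^'d::finite \<Rightarrow> real^'d" and b :: "real^'d \<Rightarrow> real^'m^'d"
    and D :: "(real^'d) set" and R cb :: real +
  fixes Cb :: real and x0 :: "real^'d" and h :: real
  assumes h: "0 < h" "h < 1" and x0: "x0 \<in> D"
begin

abbreviation step :: "real^'d \<Rightarrow> real" where
  "step \<equiv> stepsize D Cb h"

definition steps :: "real set" where
  "steps = {h, h^2, h^3}"

lemma step_in_steps: "step x \<in> steps"
  by (auto simp: stepsize_def steps_def Let_def)

lemma finite_steps: "finite steps"
  by (simp add: steps_def)

lemma steps_bounds:
  assumes "\<tau> \<in> steps"
  shows "0 < \<tau>" "\<tau> \<le> h" "h^3 \<le> \<tau>" "\<tau> \<le> 1"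
proof -
  have "h^2 \<le> h^1" "h^3 \<le> h^2" "0 < h^3"
    using h power_decreasing[of 1 2 h] power_decreasing[of 2 3 h] by auto
  moreover have "\<tau> = h \<or> \<tau> = h^2 \<or> \<tau> = h^3" using assms by (simp add: steps_def)
  ultimately show "0 < \<tau>" "\<tau> \<le> h" "h^3 \<le> \<tau>" "\<tau> \<le> 1"
    using h unfolding power_one_right by linarith+
qed

lemmas step_bounds = steps_bounds[OF step_in_steps]

lemma step_measurable [measurable]: "step \<in> borel_measurable borel"
proof -
  have [measurable]: "(\<lambda>x. infdist x (frontier D)) \<in> borel_measurable borel"
    by (intro borel_measurable_continuous_onI continuous_intros)
  show ?thesis unfolding stepsize_def[abs_def] Let_def by measurable
qed

text \<open>The scheme with every \<^const>\<open>itoI\<close>, an arbitrary member of its almost sure class, replaced by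
  the adapted version \<open>mint\<close>.\<close>

fun chain :: "nat \<Rightarrow> 'a \<Rightarrow> real \<times> (real^'d)" where
  "chain 0 \<omega> = (0, x0)"
| "chain (Suc n) \<omega> = (fst (chain n \<omega>) + step (snd (chain n \<omega>)),
     next_pos (snd (chain n \<omega>)) (fst (chain n \<omega>)) (step (snd (chain n \<omega>))) \<omega>)"

abbreviation tm :: "nat \<Rightarrow> 'a \<Rightarrow> real" where "tm n \<omega> \<equiv> fst (chain n \<omega>)"
abbreviation pos :: "nat \<Rightarrow> 'a \<Rightarrow> real^'d" where "pos n \<omega> \<equiv> snd (chain n \<omega>)"

text \<open>A finite superset of the possible n-th grid times. Finiteness replaces a strong Markov
  argument by sums over deterministic times.\<close>

fun times :: "nat \<Rightarrow> real set" where
  "times 0 = {0}"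
| "times (Suc n) = (\<lambda>(t, \<tau>). t + \<tau>) ` (times n \<times> steps)"

lemma finite_times: "finite (times n)"
  by (induction n) (auto simp: finite_steps)

lemma times_nonneg: "t \<in> times n \<Longrightarrow> 0 \<le> t"
  by (induction n arbitrary: t) (auto dest!: steps_bounds(1) intro!: add_nonneg_nonneg)

lemma tm_in_times: "tm n \<omega> \<in> times n"
proof (induction n)
  case (Suc n)
  then show ?case using step_in_steps[of "pos n \<omega>"] by (auto intro!: image_eqI[of _ _ "(tm n \<omega>, step (pos n \<omega>))"])
qed simp

lemma tm_nonneg: "0 \<le> tm n \<omega>"
  using tm_in_times times_nonneg by blast

abbreviation sch :: "nat \<Rightarrow> 'a \<Rightarrow> real \<times> (real^'d)" where
  "sch n \<equiv> scheme M W a b D Cb x0 h n"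

lemma fst_scheme_Suc: "fst (sch (Suc n) \<omega>) = fst (sch n \<omega>) + step (snd (sch n \<omega>))"
  by (simp add: Let_def)

lemma scheme_in_times: "fst (sch n \<omega>) \<in> times n"
proof (induction n)
  case (Suc n)
  then show ?case unfolding fst_scheme_Suc
    using step_in_steps[of "snd (sch n \<omega>)"] by (auto intro!: image_eqI[of _ _ "(fst (sch n \<omega>), step (snd (sch n \<omega>)))"])
qed simp

text \<open>There are countably many index lists, so one null set per step serves all integrals.
  Measurability of the scheme is carried along because \<open>itoI_eq_mint\<close> asks for
  measurable times and step sizes.\<close>

lemma scheme_eq_chain:
  "(\<lambda>\<omega>. fst (sch n \<omega>)) \<in> borel_measurable M \<and> (\<lambda>\<omega>. snd (sch n \<omega>)) \<in> borel_measurable M \<and>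
   (AE \<omega> in M. sch n \<omega> = chain n \<omega>)"
proof (induction n)
  case 0
  then show ?case by simp
next
  case (Suc n)
  let ?s = "\<lambda>\<omega>. fst (sch n \<omega>)" and ?x = "\<lambda>\<omega>. snd (sch n \<omega>)"
  let ?\<Delta> = "\<lambda>\<omega>. step (?x \<omega>)"
  have s[measurable]: "?s \<in> borel_measurable M" and x[measurable]: "?x \<in> borel_measurable M"
    and IH: "AE \<omega> in M. sch n \<omega> = chain n \<omega>"
    using Suc by auto
  have \<Delta>[measurable]: "?\<Delta> \<in> borel_measurable M" by measurable
  note ito = itoI_eq_mint[OF s \<Delta> finite_times[of n] scheme_in_times _ finite_steps step_in_steps]
  have sub: "times n \<subseteq> {0..}" "steps \<subseteq> {0<..1}" using times_nonneg steps_bounds by auto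
  have m: "itoI M W js ?s ?\<Delta> \<in> borel_measurable M" for js by (rule ito(1)[OF sub])
  have "AE \<omega> in M. \<forall>js. itoI M W js ?s ?\<Delta> \<omega> = mint js (?s \<omega>) (?\<Delta> \<omega>) \<omega>"
    unfolding AE_all_countable using ito(2)[OF sub] by blast
  with IH have "AE \<omega> in M. sch (Suc n) \<omega> = chain (Suc n) \<omega>"
    by eventually_elim (simp add: Let_def next_pos_def)
  moreover have "(\<lambda>\<omega>. fst (sch (Suc n) \<omega>)) \<in> borel_measurable M"
    unfolding fst_scheme_Suc by measurable
  moreover have "(\<lambda>\<omega>. snd (sch (Suc n) \<omega>)) \<in> borel_measurable M"
    using taylor15_measurable[OF x \<Delta> m] by (simp add: Let_def)
  ultimately show ?case by blast
qed

section \<open>The scheme observed at a fixed time\<close>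

definition outside :: "real^'d" where
  "outside = (SOME x. x \<notin> D)"

lemma outside_notin: "outside \<notin> D"
proof -
  have "D \<noteq> UNIV" using D_bounded by auto
  then have "\<exists>x. x \<notin> D" by auto
  then show ?thesis unfolding outside_def by (rule someI_ex)
qed

text \<open>Fixing the value \<open>s\<close> of the random time \<open>tm n\<close> turns adaptedness into plain \<open>past s\<close>-measurability.\<close>

definition at_time :: "nat \<Rightarrow> real \<Rightarrow> 'a \<Rightarrow> real^'d" where
  "at_time n s \<omega> = (if tm n \<omega> = s \<and> (\<forall>k<n. pos k \<omega> \<in> D) then pos n \<omega> else outside)"

lemma at_time_in_D:
  "at_time n s \<omega> \<in> D \<longleftrightarrow> tm n \<omega> = s \<and> (\<forall>k\<le>n. pos k \<omega> \<in> D)"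
  using outside_notin by (auto simp: at_time_def le_less)

lemma at_time_eq: "at_time n s \<omega> \<in> D \<Longrightarrow> at_time n s \<omega> = pos n \<omega>"
  using outside_notin by (auto simp: at_time_def split: if_splits)

text \<open>The last step has one of three sizes, so the value at time \<open>s\<close> is computed
  from the value at one of three earlier times. The step size of the actual predecessor is unique,
  so at most one case applies.\<close>

lemma at_time_Suc:
  fixes n s
  defines "A \<equiv> \<lambda>\<tau> \<omega>. at_time n (s - \<tau>) \<omega> \<in> D \<and> step (at_time n (s - \<tau>) \<omega>) = \<tau>"
    and "V \<equiv> \<lambda>\<tau> \<omega>. next_pos (at_time n (s - \<tau>) \<omega>) (s - \<tau>) \<tau> \<omega>"
  shows "at_time (Suc n) s \<omega> = (if A h \<omega> then V h \<omega> else if A (h^2) \<omega> then V (h^2) \<omega>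
    else if A (h^3) \<omega> then V (h^3) \<omega> else outside)"
proof (cases "tm (Suc n) \<omega> = s \<and> (\<forall>k<Suc n. pos k \<omega> \<in> D)")
  case True
  let ?\<tau> = "step (pos n \<omega>)"
  have "tm n \<omega> = s - ?\<tau>" using True by auto
  moreover have "\<forall>k\<le>n. pos k \<omega> \<in> D" using True by (simp add: less_Suc_eq_le)
  ultimately have D: "at_time n (s - ?\<tau>) \<omega> \<in> D" by (simp add: at_time_in_D)
  note eq = at_time_eq[OF D]
  have A: "A ?\<tau> \<omega>" using D eq by (simp add: A_def)
  have V: "V ?\<tau> \<omega> = at_time (Suc n) s \<omega>"
    using True eq \<open>tm n \<omega> = s - ?\<tau>\<close> by (simp add: V_def at_time_def)
  have "\<tau> = ?\<tau>" if "A \<tau> \<omega>" for \<tau>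
    using that \<open>tm n \<omega> = s - ?\<tau>\<close> by (auto simp: A_def at_time_in_D)
  moreover have "?\<tau> = h \<or> ?\<tau> = h^2 \<or> ?\<tau> = h^3"
    using step_in_steps[of "pos n \<omega>"] by (auto simp: steps_def)
  ultimately show ?thesis using A V by metis
next
  case False
  have "\<not> A \<tau> \<omega>" for \<tau>
  proof
    assume A: "A \<tau> \<omega>"
    then have D: "at_time n (s - \<tau>) \<omega> \<in> D" by (simp add: A_def)
    have "step (pos n \<omega>) = \<tau>" using A at_time_eq[OF D] by (simp add: A_def)
    moreover have "tm n \<omega> = s - \<tau>" "\<forall>k\<le>n. pos k \<omega> \<in> D" using D by (simp_all add: at_time_in_D)
    ultimately show False using False by (auto simp: less_Suc_eq_le)
  qed
  then show ?thesis using False by (auto simp: at_time_def)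
qed

lemma D_borel [measurable]: "D \<in> sets borel"
  using D_open by simp

lemma at_time_past_measurable: "at_time n s \<in> past s \<rightarrow>\<^sub>M borel"
proof (induction n arbitrary: s)
  case 0
  have "at_time 0 s = (\<lambda>_. if 0 = s then x0 else outside)" by (auto simp: at_time_def)
  then show ?case by simp
next
  case (Suc n)
  define A where "A = (\<lambda>\<tau> \<omega>. at_time n (s - \<tau>) \<omega> \<in> D \<and> step (at_time n (s - \<tau>) \<omega>) = \<tau>)"
  \<comment> \<open>The guard keeps the starting time of the integrals nonnegative, as their
    measurability requires; it holds automatically whenever \<open>A \<tau>\<close> does.\<close>
  define V where "V = (\<lambda>\<tau> \<omega>. if 0 \<le> s - \<tau> then next_pos (at_time n (s - \<tau>) \<omega>) (s - \<tau>) \<tau> \<omega> else outside)"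
  have eq: "at_time (Suc n) s = (\<lambda>\<omega>. if A h \<omega> then V h \<omega> else if A (h^2) \<omega> then V (h^2) \<omega>
    else if A (h^3) \<omega> then V (h^3) \<omega> else outside)"
  proof
    fix \<omega>
    have "0 \<le> s - \<tau>" if "A \<tau> \<omega>" for \<tau>
      using that tm_nonneg[of n \<omega>] by (simp add: A_def at_time_in_D)
    then show "at_time (Suc n) s \<omega> = (if A h \<omega> then V h \<omega> else if A (h^2) \<omega> then V (h^2) \<omega>
      else if A (h^3) \<omega> then V (h^3) \<omega> else outside)"
      unfolding at_time_Suc[of n s] A_def V_def by simp
  qed
  have Y: "at_time n (s - \<tau>) \<in> past s \<rightarrow>\<^sub>M borel" if "0 < \<tau>" for \<tau>
    using measurable_past_mono[OF _ Suc.IH] that by simp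
  have A: "Measurable.pred (past s) (A \<tau>)" if "0 < \<tau>" for \<tau>
  proof -
    note Y[OF that, measurable]
    show ?thesis unfolding A_def by measurable
  qed
  have V: "V \<tau> \<in> past s \<rightarrow>\<^sub>M borel" if "0 < \<tau>" for \<tau>
  proof (cases "0 \<le> s - \<tau>")
    case True
    have "mint js (s - \<tau>) \<tau> \<in> borel_measurable (past s)" for js
      using mint_past_measurable[OF True, of \<tau> js] that by simp
    then have "(\<lambda>\<omega>. next_pos (at_time n (s - \<tau>) \<omega>) (s - \<tau>) \<tau> \<omega>) \<in> past s \<rightarrow>\<^sub>M borel"
      unfolding next_pos_def by (intro taylor15_measurable Y that) auto
    then show ?thesis using True by (simp add: V_def)
  qed (simp add: V_def)
  have p: "0 < h" "0 < h^2" "0 < h^3" using h by auto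
  note [measurable] = A[OF p(1)] A[OF p(2)] A[OF p(3)] V[OF p(1)] V[OF p(2)] V[OF p(3)]
  show ?case unfolding eq by measurable
qed

lemma at_time_measurable [measurable]: "at_time n s \<in> M \<rightarrow>\<^sub>M borel"
  by (rule measurable_past_M[OF at_time_past_measurable])

text \<open>The conditional submartingale inequality at a deterministic time:
  \<open>at_time n s\<close> depends on the past of \<open>s\<close>, the integrals of the next step
  on later increments, so the position can be frozen and the gain assumed for fixed \<open>x\<close>
  applies.\<close>

lemma gain_expectation:
  fixes g :: "real^'d \<Rightarrow> real" and n :: nat
  assumes s: "0 \<le> s" and \<tau>: "\<tau> \<in> steps" and \<delta>: "0 < \<delta>" "0 < K"
    and g[measurable]: "g \<in> borel_measurable borel" and gB: "\<And>x. \<bar>g x\<bar> \<le> B"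
    and gain: "\<And>x. x \<in> D \<Longrightarrow> step x = \<tau> \<Longrightarrow>
      pot D \<delta> K x + g x \<le> expectation (\<lambda>\<omega>. pot D \<delta> K (next_pos x s \<tau> \<omega>))"
  defines "\<phi> \<equiv> \<lambda>\<omega>. if at_time n s \<omega> \<in> D \<and> step (at_time n s \<omega>) = \<tau>
      then pot D \<delta> K (next_pos (at_time n s \<omega>) s \<tau> \<omega>) - pot D \<delta> K (at_time n s \<omega>) - g (at_time n s \<omega>) else 0"
  shows "integrable M \<phi>" "0 \<le> expectation \<phi>"
proof -
  note [measurable] = pot_measurable[OF D_open, of \<delta> K]
  note pb = pot_bounds[OF \<delta>, of D]
  let ?T = "PiM UNIV (\<lambda>_. borel) :: ('m option list \<Rightarrow> real) measure"
  \<comment> \<open>All integrals of the step form one random function of the index list, so that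
    independence of the past is used for the whole family at once.\<close>
  define Z where "Z = (\<lambda>\<omega> js. mint js s \<tau> \<omega>)"
  define f where "f = (\<lambda>(x, z). if x \<in> D \<and> step x = \<tau>
      then pot D \<delta> K (taylor15 a b x \<tau> z) - pot D \<delta> K x - g x else 0)"
  have Zf: "Z \<in> future s \<rightarrow>\<^sub>M ?T"
    unfolding Z_def
    by (rule measurable_PiM_single') (use mint_future_measurable[of \<tau>] steps_bounds[OF \<tau>] in auto)
  have ZM: "Z \<in> M \<rightarrow>\<^sub>M ?T" by (rule measurable_future_M[OF Zf])
  have [measurable]: "(\<lambda>p. taylor15 a b (fst p) \<tau> (snd p)) \<in> borel \<Otimes>\<^sub>M ?T \<rightarrow>\<^sub>M borel"
  proof -
    have "(\<lambda>p. taylor15 a b (fst p) \<tau> (\<lambda>js. snd p js)) \<in> borel \<Otimes>\<^sub>M ?T \<rightarrow>\<^sub>M borel"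
      by (rule taylor15_measurable) measurable
    then show ?thesis by simp
  qed
  have f[measurable]: "f \<in> borel_measurable (borel \<Otimes>\<^sub>M ?T)"
    unfolding f_def case_prod_beta by measurable
  have fB: "\<bar>f p\<bar> \<le> 2 / \<delta> + 2 / \<delta> + B" for p
  proof -
    have "\<bar>u - v - w\<bar> \<le> 2 / \<delta> + 2 / \<delta> + B" if "0 \<le> u" "u \<le> 2 / \<delta>" "0 \<le> v" "v \<le> 2 / \<delta>" "\<bar>w\<bar> \<le> B" for u v w
      using that by linarith
    moreover have "0 \<le> 2 / \<delta> + 2 / \<delta> + B" using gB[of 0] \<delta> by (simp add: add_nonneg_nonneg)
    ultimately show ?thesis using pb gB by (auto simp: f_def split: prod.splits)
  qed
  have eq: "\<phi> \<omega> = f (at_time n s \<omega>, Z \<omega>)" for \<omega>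
    by (simp add: \<phi>_def f_def Z_def next_pos_def)
  have [measurable]: "\<phi> \<in> borel_measurable M"
    unfolding eq[abs_def] using ZM by measurable
  show "integrable M \<phi>"
    by (rule integrable_const_bound[where B="2 / \<delta> + 2 / \<delta> + B"]) (use fB eq in auto)
  have "0 \<le> expectation (\<lambda>\<omega>. f (at_time n s \<omega>, Z \<omega>))"
  proof (rule expectation_nonneg_indep[OF at_time_measurable ZM _ f fB])
    fix A B assume "A \<in> sets (borel :: (real^'d) measure)" "B \<in> sets ?T"
    then have "at_time n s -` A \<inter> space M \<in> sets (past s)" "Z -` B \<inter> space M \<in> sets (future s)"
      using measurable_sets[OF at_time_past_measurable, of A n s] measurable_sets[OF Zf, of B] by auto
    then show "prob ((at_time n s -` A \<inter> space M) \<inter> (Z -` B \<inter> space M)) =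
        prob (at_time n s -` A \<inter> space M) * prob (Z -` B \<inter> space M)"
      by (rule indep_setD[OF indep_set_past_future[OF s]])
  next
    fix x
    show "0 \<le> expectation (\<lambda>\<omega>. f (x, Z \<omega>))"
    proof (cases "x \<in> D \<and> step x = \<tau>")
      case True
      have "integrable M (\<lambda>\<omega>. pot D \<delta> K (next_pos x s \<tau> \<omega>))"
        by (rule integrable_const_bound[where B="2 / \<delta>"]) (use pb in auto)
      then have "expectation (\<lambda>\<omega>. f (x, Z \<omega>)) =
          expectation (\<lambda>\<omega>. pot D \<delta> K (next_pos x s \<tau> \<omega>)) - pot D \<delta> K x - g x"
        using True by (simp add: f_def Z_def next_pos_def[symmetric] prob_space)
      with gain[of x] True show ?thesis by simp
    qed (auto simp: f_def)
  qed
  then show "0 \<le> expectation \<phi>" by (simp add: eq[abs_def])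
qed

end

section \<open>Occupation times and cost\<close>

text \<open>Once \<open>P\<close> fails it fails forever, so the sum telescopes to
  \<open>p m - p 0\<close> with \<open>m\<close> the stopping index or \<open>N\<close>. It serves
  both for the barrier and for elapsed time.\<close>

lemma stopped_telescope_le:
  fixes p :: "nat \<Rightarrow> real"
  assumes anti: "\<And>n. P (Suc n) \<Longrightarrow> P n" and p: "\<And>n. 0 \<le> p n" "\<And>n. p n \<le> B"
  shows "(\<Sum>n<N. if P n then p (Suc n) - p n else 0) \<le> B"
proof -
  have anti': "\<not> P n" if "\<not> P k" "k \<le> n" for k n
    using that(2,1) by (induction n rule: dec_induct) (use anti in auto)
  let ?S = "\<lambda>N. \<Sum>n<N. if P n then p (Suc n) - p n else 0"
  have "((\<forall>n<N. P n) \<longrightarrow> ?S N = p N - p 0) \<and> (\<not> (\<forall>n<N. P n) \<longrightarrow> (\<exists>m. ?S N = p m - p 0))"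
  proof (induction N)
    case (Suc N)
    show ?case
    proof (cases "\<forall>n<N. P n")
      case True
      with Suc show ?thesis by (auto simp: less_Suc_eq)
    next
      case False
      then have "\<not> P N" using anti' by (meson less_imp_le)
      with Suc False show ?thesis by (auto simp: less_Suc_eq)
    qed
  qed simp
  then obtain m where "?S N = p m - p 0" by auto
  with p(1)[of 0] p(2)[of m] show ?thesis by simp
qed

text \<open>A step of length \<open>\<tau> n\<close> carries the density \<open>1 / \<tau> n\<close>
  and contributes exactly 1.\<close>

lemma step_function_cost:
  fixes t :: "nat \<Rightarrow> real" and f :: "real \<Rightarrow> real"
  assumes t0: "t 0 = 0" and \<tau>: "\<And>n. t (Suc n) = t n + \<tau> n" "\<And>n. 0 < \<tau> n"
    and f: "\<And>n u. t n \<le> u \<Longrightarrow> u < t (Suc n) \<Longrightarrow> f u = 1 / \<tau> n"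
  shows "(f has_integral real n) {0..t n}"
proof (induction n)
  case 0
  then show ?case by (simp add: t0 has_integral_refl)
next
  case (Suc n)
  have le: "t n \<le> t (Suc n)" using \<tau>[of n] by simp
  have nonneg: "0 \<le> t k" for k
    by (induction k) (use t0 \<tau> in \<open>auto simp: less_imp_le add_nonneg_nonneg\<close>)
  have c: "((\<lambda>_. 1 / \<tau> n) has_integral 1) {t n..t (Suc n)}"
    using has_integral_const_real[of "1 / \<tau> n" "t n" "t (Suc n)"] \<tau>(1)[of n] \<tau>(2)[of n] by simp
  \<comment> \<open>At the right end \<open>f\<close> already takes the value of the next step; a
    single point does not affect the integral.\<close>
  have "(f has_integral 1) {t n..t (Suc n)}"
    by (rule has_integral_spike_finite[where S="{t (Suc n)}", OF _ _ c]) (use f in auto)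
  from has_integral_combine[OF nonneg le Suc.IH this]
  show ?case by (simp add: add.commute)
qed

context order15
begin

definition active :: "real \<Rightarrow> nat \<Rightarrow> 'a \<Rightarrow> bool" where
  "active T n \<omega> \<longleftrightarrow> (\<forall>k\<le>n. pos k \<omega> \<in> D) \<and> tm n \<omega> < T"

lemma active_Suc: "active T (Suc n) \<omega> \<Longrightarrow> active T n \<omega>"
  using step_bounds(1)[of "pos n \<omega>"] by (auto simp: active_def)

text \<open>Splitting by the value of the n-th time leaves at most one nonzero summand. Each summand
  is a function of \<open>at_time n s\<close>, from which measurability follows.\<close>

lemma active_sum:
  fixes G :: "real^'d \<Rightarrow> real"
  shows "(if active T n \<omega> then G (pos n \<omega>) else 0) =
    (\<Sum>s\<in>times n \<inter> {..<T}. if at_time n s \<omega> \<in> D then G (at_time n s \<omega>) else 0)"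
proof -
  have "(\<Sum>s\<in>times n \<inter> {..<T}. if at_time n s \<omega> \<in> D then G (at_time n s \<omega>) else 0) =
      (\<Sum>s\<in>times n \<inter> {..<T}. if s = tm n \<omega> then (if \<forall>k\<le>n. pos k \<omega> \<in> D then G (pos n \<omega>) else 0) else 0)"
    by (intro sum.cong refl) (auto simp: at_time_in_D at_time_eq)
  also have "\<dots> = (if active T n \<omega> then G (pos n \<omega>) else 0)"
    using tm_in_times[of n \<omega>] finite_times[of n] by (subst sum.delta) (auto simp: active_def)
  finally show ?thesis by simp
qed

lemma active_measurable [measurable]:
  assumes [measurable]: "G \<in> borel_measurable borel"
  shows "(\<lambda>\<omega>. if active T n \<omega> then G (pos n \<omega>) else 0 :: real) \<in> borel_measurable M"
  unfolding active_sum by measurable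

lemma active_integrable:
  fixes G :: "real^'d \<Rightarrow> real"
  assumes "G \<in> borel_measurable borel" "\<And>x. \<bar>G x\<bar> \<le> B"
  shows "integrable M (\<lambda>\<omega>. if active T n \<omega> then G (pos n \<omega>) else 0)"
proof (rule integrable_const_bound[where B=B])
  have "0 \<le> B" using assms(2)[of 0] by linarith
  then show "AE \<omega> in M. norm (if active T n \<omega> then G (pos n \<omega>) else 0) \<le> B"
    using assms(2) by (intro AE_I2) auto
qed (rule active_measurable[OF assms(1)])

text \<open>\<open>\<Phi> n\<close> is the barrier increment minus the claimed gain over an active
  step; split by starting time and step size, it has nonnegative expectation by
  \<open>gain_expectation\<close>. Pathwise, gains plus all \<open>\<Phi> n\<close> telescope and
  stay below the supremum \<open>2 / \<delta>\<close> of the barrier, so the bound does not depend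
  on \<open>N\<close>.\<close>

lemma occupation:
  fixes g :: "real^'d \<Rightarrow> real"
  assumes \<delta>: "0 < \<delta>" "0 < K" and g[measurable]: "g \<in> borel_measurable borel" and gB: "\<And>x. \<bar>g x\<bar> \<le> B"
    and gain: "\<And>s \<tau> x. 0 \<le> s \<Longrightarrow> x \<in> D \<Longrightarrow> step x = \<tau> \<Longrightarrow>
      pot D \<delta> K x + g x \<le> expectation (\<lambda>\<omega>. pot D \<delta> K (next_pos x s \<tau> \<omega>))"
  shows "expectation (\<lambda>\<omega>. \<Sum>n<N. if active T n \<omega> then g (pos n \<omega>) else 0) \<le> 2 / \<delta>"
proof -
  note pb = pot_bounds[OF \<delta>, of D]
  define \<phi> where "\<phi> = (\<lambda>n s \<tau> \<omega>. if at_time n s \<omega> \<in> D \<and> step (at_time n s \<omega>) = \<tau>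
      then pot D \<delta> K (next_pos (at_time n s \<omega>) s \<tau> \<omega>) - pot D \<delta> K (at_time n s \<omega>) - g (at_time n s \<omega>) else 0)"
  define \<Phi> where "\<Phi> = (\<lambda>n \<omega>. \<Sum>s\<in>times n \<inter> {..<T}. \<Sum>\<tau>\<in>steps. \<phi> n s \<tau> \<omega>)"
  have \<Phi>_eq: "\<Phi> n \<omega> = (if active T n \<omega>
      then pot D \<delta> K (pos (Suc n) \<omega>) - pot D \<delta> K (pos n \<omega>) - g (pos n \<omega>) else 0)" for n \<omega>
  proof -
    let ?v = "pot D \<delta> K (pos (Suc n) \<omega>) - pot D \<delta> K (pos n \<omega>) - g (pos n \<omega>)"
    have "(\<Sum>\<tau>\<in>steps. \<phi> n s \<tau> \<omega>) = (if s = tm n \<omega> then (if \<forall>k\<le>n. pos k \<omega> \<in> D then ?v else 0) else 0)" for s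
    proof -
      have "(\<Sum>\<tau>\<in>steps. \<phi> n s \<tau> \<omega>) = (\<Sum>\<tau>\<in>steps. if \<tau> = step (pos n \<omega>)
          then (if s = tm n \<omega> \<and> (\<forall>k\<le>n. pos k \<omega> \<in> D) then ?v else 0) else 0)"
      proof (intro sum.cong refl)
        fix \<tau>
        show "\<phi> n s \<tau> \<omega> = (if \<tau> = step (pos n \<omega>)
          then (if s = tm n \<omega> \<and> (\<forall>k\<le>n. pos k \<omega> \<in> D) then ?v else 0) else 0)"
        proof (cases "at_time n s \<omega> \<in> D")
          case True
          then show ?thesis using at_time_in_D[of n s \<omega>] at_time_eq[OF True] by (auto simp: \<phi>_def)
        next
          case False
          then show ?thesis using at_time_in_D[of n s \<omega>] by (auto simp: \<phi>_def)
        qed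
      qed
      also have "\<dots> = (if s = tm n \<omega> \<and> (\<forall>k\<le>n. pos k \<omega> \<in> D) then ?v else 0)"
        using step_in_steps finite_steps by (subst sum.delta) auto
      finally show ?thesis by auto
    qed
    then have "\<Phi> n \<omega> = (\<Sum>s\<in>times n \<inter> {..<T}. if s = tm n \<omega> then (if \<forall>k\<le>n. pos k \<omega> \<in> D then ?v else 0) else 0)"
      unfolding \<Phi>_def by (intro sum.cong refl)
    also have "\<dots> = (if active T n \<omega> then ?v else 0)"
      using tm_in_times[of n \<omega>] finite_times[of n] by (subst sum.delta) (auto simp: active_def)
    finally show ?thesis .
  qed
  have \<phi>: "integrable M (\<phi> n s \<tau>)" "0 \<le> expectation (\<phi> n s \<tau>)" if "s \<in> times n" "\<tau> \<in> steps" for n s \<tau>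
    using gain_expectation[OF times_nonneg[OF that(1)] that(2) \<delta> g gB gain[OF times_nonneg[OF that(1)]], of n]
    unfolding \<phi>_def by auto
  have \<Phi>: "integrable M (\<Phi> n)" "0 \<le> expectation (\<Phi> n)" for n
  proof -
    show "integrable M (\<Phi> n)" unfolding \<Phi>_def using \<phi> by auto
    have "expectation (\<Phi> n) = (\<Sum>s\<in>times n \<inter> {..<T}. \<Sum>\<tau>\<in>steps. expectation (\<phi> n s \<tau>))"
      unfolding \<Phi>_def using \<phi> by simp
    also have "\<dots> \<ge> 0" using \<phi> by (intro sum_nonneg) auto
    finally show "0 \<le> expectation (\<Phi> n)" .
  qed
  let ?u = "\<lambda>\<omega>. \<Sum>n<N. if active T n \<omega> then g (pos n \<omega>) else 0"
  have le: "?u \<omega> \<le> 2 / \<delta> - (\<Sum>n<N. \<Phi> n \<omega>)" for \<omega>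
  proof -
    have "?u \<omega> + (\<Sum>n<N. \<Phi> n \<omega>) =
      (\<Sum>n<N. if active T n \<omega> then pot D \<delta> K (pos (Suc n) \<omega>) - pot D \<delta> K (pos n \<omega>) else 0)"
      unfolding sum.distrib[symmetric] by (intro sum.cong refl) (auto simp: \<Phi>_eq)
    also have "\<dots> \<le> 2 / \<delta>"
      by (rule stopped_telescope_le[where p="\<lambda>n. pot D \<delta> K (pos n \<omega>)"]) (use pb active_Suc in auto)
    finally show ?thesis by simp
  qed
  have "expectation ?u \<le> expectation (\<lambda>\<omega>. 2 / \<delta> - (\<Sum>n<N. \<Phi> n \<omega>))"
    using active_integrable[OF g gB] \<Phi> le by (intro integral_mono) auto
  also have "\<dots> = 2 / \<delta> - (\<Sum>n<N. expectation (\<Phi> n))"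
    using \<Phi> by (simp add: prob_space)
  also have "\<dots> \<le> 2 / \<delta>" using \<Phi> by (simp add: sum_nonneg)
  finally show ?thesis .
qed

lemma active_time_le:
  assumes "0 < T"
  shows "(\<Sum>n<N. if active T n \<omega> then step (pos n \<omega>) else 0) \<le> T + 1"
proof -
  \<comment> \<open>Truncation at \<open>T + 1\<close> makes the time bounded without changing an
    active increment: it starts before \<open>T\<close> and has length at most 1.\<close>
  have "(\<Sum>n<N. if active T n \<omega> then step (pos n \<omega>) else 0) =
    (\<Sum>n<N. if active T n \<omega> then min (tm (Suc n) \<omega>) (T + 1) - min (tm n \<omega>) (T + 1) else 0)"
  proof (intro sum.cong refl)
    fix n
    show "(if active T n \<omega> then step (pos n \<omega>) else 0) =
      (if active T n \<omega> then min (tm (Suc n) \<omega>) (T + 1) - min (tm n \<omega>) (T + 1) else 0)"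
      using step_bounds(4)[of "pos n \<omega>"] by (auto simp: active_def)
  qed
  also have "\<dots> \<le> T + 1"
    by (rule stopped_telescope_le) (use active_Suc tm_nonneg assms in \<open>auto simp del: chain.simps\<close>)
  finally show ?thesis .
qed

text \<open>The integrand is nonnegative, so the integral may be extended to the first grid time not
  below the exit, where it equals the number of steps made. All of these start before the exit and
  before \<open>T\<close>; there are at most \<open>N\<close> of them because every step has length
  at least \<open>h^3\<close>.\<close>

lemma cost_le_count:
  assumes T: "0 < T" and N: "T \<le> real N * h^3"
  shows "cost M W a b D Cb x0 T h \<omega> \<le>
    (\<Sum>n<N. if (\<forall>k\<le>n. snd (sch k \<omega>) \<in> D) \<and> fst (sch n \<omega>) < T then 1 else 0)"
proof -
  define t where "t = (\<lambda>n. fst (sch n \<omega>))"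
  define x where "x = (\<lambda>n. snd (sch n \<omega>))"
  define \<nu> where "\<nu> = num_exit M W a b D Cb x0 T h \<omega>"
  define f where "f = (\<lambda>u. 1 / step (Xbar M W a b D Cb x0 h u \<omega>))"
  have t0: "t 0 = 0" by (simp add: t_def)
  have tS: "t (Suc n) = t n + step (x n)" for n unfolding t_def x_def by (rule fst_scheme_Suc)
  have mono: "t m \<le> t n" if "m \<le> n" for m n
    using that by (rule lift_Suc_mono_le[of t, rotated]) (use tS step_bounds(1) in \<open>auto intro: less_imp_le\<close>)
  have grow: "real n * h^3 \<le> t n" for n
  proof (induction n)
    case (Suc n)
    then show ?case using tS[of n] step_bounds(3)[of "x n"] by (simp add: algebra_simps)
  qed (simp add: t0)
  have f: "f u = 1 / step (x n)" if "t n \<le> u" "u < t (Suc n)" for n u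
  proof -
    have "(LEAST k. u < t (Suc k)) = n"
    proof (rule Least_equality[of "\<lambda>k. u < t (Suc k)"])
      fix k assume "u < t (Suc k)"
      show "n \<le> k"
      proof (rule ccontr)
        assume "\<not> n \<le> k"
        then have "t (Suc k) \<le> t n" by (intro mono) simp
        with \<open>u < t (Suc k)\<close> that show False by simp
      qed
    qed (use that in auto)
    moreover have "Xbar M W a b D Cb x0 h u \<omega> = x (LEAST k. u < t (Suc k))"
      by (simp only: Xbar_def x_def t_def)
    ultimately show ?thesis by (simp add: f_def)
  qed
  have int: "(f has_integral real n) {0..t n}" for n
    by (rule step_function_cost[where \<tau>="\<lambda>n. step (x n)"]) (use t0 tS step_bounds(1) f in auto)
  have "\<nu> \<le> T" by (auto simp: \<nu>_def num_exit_def)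
  also have "T \<le> t N" using N grow[of N] by simp
  finally have \<nu>N: "\<nu> \<le> t N" .
  define n0 where "n0 = (LEAST n. \<nu> \<le> t n)"
  have n0: "\<nu> \<le> t n0" "n0 \<le> N" unfolding n0_def using \<nu>N by (auto intro: LeastI Least_le)
  have act: "(\<forall>k\<le>n. x k \<in> D) \<and> t n < T" if "n < n0" for n
  proof -
    have "t n < \<nu>" using that not_less_Least[of n "\<lambda>n. \<nu> \<le> t n"] by (auto simp: n0_def not_le)
    moreover have "x k \<in> D" if "k \<le> n" for k
    proof (rule ccontr)
      assume "x k \<notin> D"
      then have "\<nu> \<le> t (LEAST n. x n \<notin> D)" unfolding \<nu>_def num_exit_def t_def x_def by auto
      also have "\<dots> \<le> t k" by (rule mono) (rule Least_le, fact)
      also have "\<dots> \<le> t n" by (rule mono[OF that])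
      finally show False using \<open>t n < \<nu>\<close> by simp
    qed
    ultimately show ?thesis using \<open>\<nu> \<le> T\<close> by auto
  qed
  have "cost M W a b D Cb x0 T h \<omega> = integral {0..\<nu>} f"
    by (simp add: cost_def \<nu>_def f_def)
  also have "\<dots> \<le> integral {0..t n0} f"
  proof (rule integral_subset_le)
    show "{0..\<nu>} \<subseteq> {0..t n0}" using n0 by auto
    show i: "f integrable_on {0..t n0}" using int by blast
    show "f integrable_on {0..\<nu>}"
      by (rule integrable_subinterval_real[OF i]) (use n0 in auto)
    show "\<forall>u\<in>{0..t n0}. 0 \<le> f u" using step_bounds(1) by (simp add: f_def less_imp_le)
  qed
  also have "\<dots> = real n0" using int by (rule integral_unique)
  also have "\<dots> = (\<Sum>n<n0. 1)" by simp
  also have "\<dots> \<le> (\<Sum>n<n0. if (\<forall>k\<le>n. x k \<in> D) \<and> t n < T then 1 else 0)"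
    using act by (intro sum_mono) auto
  also have "\<dots> \<le> (\<Sum>n<N. if (\<forall>k\<le>n. x k \<in> D) \<and> t n < T then 1 else 0)"
    using n0(2) by (intro sum_mono2) auto
  finally show ?thesis by (simp add: x_def t_def)
qed

lemma expected_cost_le:
  assumes T: "0 < T" and N: "T \<le> real N * h^3"
  shows "(\<integral>\<^sup>+ \<omega>. ennreal (cost M W a b D Cb x0 T h \<omega>) \<partial>M)
    \<le> ennreal (expectation (\<lambda>\<omega>. \<Sum>n<N. if active T n \<omega> then 1 else 0))"
proof -
  have "AE \<omega> in M. \<forall>n. sch n \<omega> = chain n \<omega>"
    unfolding AE_all_countable using scheme_eq_chain by blast
  then have "(\<integral>\<^sup>+ \<omega>. ennreal (cost M W a b D Cb x0 T h \<omega>) \<partial>M)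
    \<le> (\<integral>\<^sup>+ \<omega>. ennreal (\<Sum>n<N. if active T n \<omega> then 1 else 0) \<partial>M)"
  proof (intro nn_integral_mono_AE, eventually_elim)
    fix \<omega> assume "\<forall>n. sch n \<omega> = chain n \<omega>"
    with cost_le_count[OF T N, of \<omega>]
    show "ennreal (cost M W a b D Cb x0 T h \<omega>) \<le> ennreal (\<Sum>n<N. if active T n \<omega> then 1 else 0)"
      by (intro ennreal_leI) (simp only: active_def)
  qed
  also have "\<dots> = ennreal (expectation (\<lambda>\<omega>. \<Sum>n<N. if active T n \<omega> then 1 else 0))"
    using active_integrable[of "\<lambda>_. 1" 1 T]
    by (intro nn_integral_eq_integral) (auto intro!: sum_nonneg)
  finally show ?thesis .
qed

text \<open>Each step is charged by its own length to the region that explains its size: one of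
  \<open>step x / h\<close>, \<open>g \<delta>1 x / h^2\<close>, \<open>g \<delta>2 x / h^3\<close>
  equals 1 and the others are nonnegative.\<close>

lemma expected_count_le:
  fixes \<delta>1 \<delta>2 :: real
  assumes T: "0 < T" and step: "\<And>x. step x = (if \<delta>1 < bd_dist x then h
         else if \<delta>2 < bd_dist x then h^2 else h^3)"
    and o1: "expectation (\<lambda>\<omega>. \<Sum>n<N. if active T n \<omega> then
      (if bd_dist (pos n \<omega>) \<le> \<delta>1 then step (pos n \<omega>) else 0) else 0) \<le> O1"
    and o2: "expectation (\<lambda>\<omega>. \<Sum>n<N. if active T n \<omega> then
      (if bd_dist (pos n \<omega>) \<le> \<delta>2 then step (pos n \<omega>) else 0) else 0) \<le> O2"
  shows "expectation (\<lambda>\<omega>. \<Sum>n<N. if active T n \<omega> then 1 else 0) \<le> (T + 1) / h + O1 / h^2 + O2 / h^3"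
proof -
  define g where "g = (\<lambda>\<delta> x. if bd_dist x \<le> \<delta> then step x else 0)"
  have [measurable]: "(\<lambda>x. bd_dist x) \<in> borel_measurable borel"
    by (intro borel_measurable_continuous_onI continuous_intros)
  have g[measurable]: "g \<delta> \<in> borel_measurable borel" for \<delta> unfolding g_def by measurable
  have g0: "0 \<le> g \<delta> x" "\<bar>g \<delta> x\<bar> \<le> 1" for \<delta> x using step_bounds(1,4)[of x] by (auto simp: g_def)
  let ?U = "\<lambda>\<delta> \<omega>. \<Sum>n<N. if active T n \<omega> then g \<delta> (pos n \<omega>) else 0"
  have le1: "1 \<le> step x / h + g \<delta>1 x / h^2 + g \<delta>2 x / h^3" for x
  proof -
    have "0 \<le> step x / h" "0 \<le> g \<delta>1 x / h^2" "0 \<le> g \<delta>2 x / h^3"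
      using h g0 step_bounds(1)[of x] by auto
    moreover have "step x / h = 1 \<or> g \<delta>1 x / h^2 = 1 \<or> g \<delta>2 x / h^3 = 1"
      using h by (auto simp: step g_def)
    ultimately show ?thesis by linarith
  qed
  have le: "(\<Sum>n<N. if active T n \<omega> then 1 else 0) \<le> (T + 1) / h + ?U \<delta>1 \<omega> / h^2 + ?U \<delta>2 \<omega> / h^3" for \<omega>
  proof -
    have "(\<Sum>n<N. if active T n \<omega> then 1 else 0) \<le> (\<Sum>n<N. (if active T n \<omega> then step (pos n \<omega>) else 0) / h
        + (if active T n \<omega> then g \<delta>1 (pos n \<omega>) else 0) / h^2 + (if active T n \<omega> then g \<delta>2 (pos n \<omega>) else 0) / h^3)"
      using le1 by (intro sum_mono) auto
    also have "\<dots> = (\<Sum>n<N. if active T n \<omega> then step (pos n \<omega>) else 0) / h + ?U \<delta>1 \<omega> / h^2 + ?U \<delta>2 \<omega> / h^3"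
      by (simp add: sum.distrib sum_divide_distrib)
    also have "(\<Sum>n<N. if active T n \<omega> then step (pos n \<omega>) else 0) / h \<le> (T + 1) / h"
      using active_time_le[OF T] h by (intro divide_right_mono) auto
    finally show ?thesis by simp
  qed
  have int: "integrable M (?U \<delta>)" for \<delta>
    using active_integrable[OF g g0(2)] by auto
  have "expectation (\<lambda>\<omega>. \<Sum>n<N. if active T n \<omega> then 1 else 0)
    \<le> expectation (\<lambda>\<omega>. (T + 1) / h + ?U \<delta>1 \<omega> / h^2 + ?U \<delta>2 \<omega> / h^3)"
    using active_integrable[of "\<lambda>_. 1" 1 T] int le by (intro integral_mono) auto
  also have "\<dots> = (T + 1) / h + expectation (?U \<delta>1) / h^2 + expectation (?U \<delta>2) / h^3"
    using int by (simp add: prob_space)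
  also have "\<dots> \<le> (T + 1) / h + O1 / h^2 + O2 / h^3"
    using o1 o2 h unfolding g_def by (intro add_mono divide_right_mono) auto
  finally show ?thesis .
qed

text \<open>\<open>K\<close> stays free because the two strips need different caps. The barrier
  gains at rate \<open>\<gamma>\<close> per unit of time in the strip, and its range
  \<open>2 / \<delta>\<close> divided by \<open>\<gamma>\<close> is the bound.\<close>

lemma strip_occupation:
  assumes \<delta>: "0 < \<delta>" "\<delta> < K" "K \<le> \<rho>" and small: "\<And>x. bd_dist x < K \<Longrightarrow> step x \<le> \<epsilon> * \<delta>\<^sup>2"
    and gains: "barrier_gains \<rho> \<epsilon>"
  shows "expectation (\<lambda>\<omega>. \<Sum>n<N. if active T n \<omega> then
      (if bd_dist (pos n \<omega>) \<le> \<delta> then step (pos n \<omega>) else 0) else 0) \<le> 256 / cb * \<delta>\<^sup>2"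
proof -
  define \<gamma> where "\<gamma> = cb / 128 / \<delta>^3"
  have \<gamma>: "0 < \<gamma>" using cb_pos \<delta> by (simp add: \<gamma>_def)
  define g where "g = (\<lambda>x. if bd_dist x \<le> \<delta> then step x else 0)"
  have [measurable]: "(\<lambda>x. bd_dist x) \<in> borel_measurable borel"
    by (intro borel_measurable_continuous_onI continuous_intros)
  have g[measurable]: "g \<in> borel_measurable borel" unfolding g_def by measurable
  have gB: "\<bar>\<gamma> * g x\<bar> \<le> \<gamma>" for x
    using step_bounds(1,4)[of x] \<gamma> by (auto simp: g_def abs_mult)
  have "expectation (\<lambda>\<omega>. \<Sum>n<N. if active T n \<omega> then \<gamma> * g (pos n \<omega>) else 0) \<le> 2 / \<delta>"
  proof (rule occupation[of \<delta> K])
    fix s \<tau> :: real and x assume *: "0 \<le> s" "x \<in> D" "step x = \<tau>"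
    have "\<gamma> * g x = (if bd_dist x \<le> \<delta> \<and> \<delta> < K then cb / 128 * \<tau> / \<delta>^3 else 0)"
      using * \<delta> by (simp add: \<gamma>_def g_def)
    then show "pot D \<delta> K x + \<gamma> * g x \<le> expectation (\<lambda>\<omega>. pot D \<delta> K (next_pos x s \<tau> \<omega>))"
      using gains[unfolded barrier_gains_def, rule_format, of \<delta> K \<tau> s x] * \<delta> small[of x] step_bounds[of x]
      by simp
  qed (use \<delta> gB in auto)
  also have "(\<lambda>\<omega>. \<Sum>n<N. if active T n \<omega> then \<gamma> * g (pos n \<omega>) else 0) =
      (\<lambda>\<omega>. \<gamma> * (\<Sum>n<N. if active T n \<omega> then g (pos n \<omega>) else 0))"
    by (auto simp: sum_distrib_left intro!: sum.cong)
  finally have "expectation (\<lambda>\<omega>. \<Sum>n<N. if active T n \<omega> then g (pos n \<omega>) else 0) \<le> 2 / \<delta> / \<gamma>"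
    using \<gamma> by (simp add: pos_le_divide_eq mult.commute del: divide_divide_eq_left)
  also have "2 / \<delta> / \<gamma> = 256 / cb * \<delta>\<^sup>2"
    using \<delta> cb_pos by (simp add: \<gamma>_def field_simps eval_nat_numeral)
  finally show ?thesis by (simp only: g_def)
qed

end

theorem mainTheorem4:
  fixes D :: "(real^'d::finite) set"
    and a :: "real^'d \<Rightarrow> real^'d"
    and b :: "real^'d \<Rightarrow> real^'m::finite^'d"
    and M :: "'a measure"
    and W :: "real \<Rightarrow> 'a \<Rightarrow> real^'m"
    and x0 :: "real^'d"
    and T Rbar cb Cb :: real
  assumes domain: "Ck_domain 4 D"
    and reach_pos: "reach D > 0"
    and B1a: "\<forall>i. Ck_bounded 3 (\<lambda>x. a x $ i)"
    and B1b: "\<forall>i j. Ck_bounded 3 (\<lambda>x. b x $ i $ j)"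
    and B2: "0 < Rbar" "Rbar < reach D / 2" "cb > 0"
      "\<forall>x\<in>enlarge D Rbar. \<forall>\<xi>. \<xi> \<bullet> ((b x ** transpose (b x)) *v \<xi>) \<ge> cb * (norm \<xi>)\<^sup>2"
    and B3: "Cb > 0" "\<forall>x \<xi>. \<xi> \<bullet> ((b x ** transpose (b x)) *v \<xi>) \<le> Cb * (norm \<xi>)\<^sup>2"
    and W: "wiener M W"
    and x0: "x0 \<in> D"
    and T: "T > 0"
  shows "\<exists>C h0. C > 0 \<and> 0 < h0 \<and> h0 < 1 \<and>
     (\<forall>h. 0 < h \<and> h < h0 \<longrightarrow>
        (\<integral>\<^sup>+ \<omega>. ennreal (cost M W a b D Cb x0 T h \<omega>) \<partial>M) \<le> ennreal (C * (1 / h) * ln (1 / h)))"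
proof -
  obtain R where R: "ball_exterior D R" using domain by (rule Ck_domain_ball_exterior)
  have "prob_space M" using W by (simp add: wiener_def)
  then interpret prob_space M .
  interpret sde_domain M W a b D R cb
  proof
    show "wiener M W" by (rule W)
    show "Ck_on 3 UNIV (\<lambda>x. a x $ i)" for i using B1a by (auto simp: Ck_bounded_def)
    show "Ck_on 3 UNIV (\<lambda>x. b x $ i $ j)" for i j using B1b by (auto simp: Ck_bounded_def)
    show "open D" "bounded D" using domain by (auto simp: Ck_domain_def)
    show "ball_exterior D R" by (rule R)
    show "0 < cb" by (rule B2)
    show "cb * (norm \<xi>)\<^sup>2 \<le> \<xi> \<bullet> ((b x ** transpose (b x)) *v \<xi>)" if "x \<in> D" for x \<xi>
      using B2 that by (auto simp: enlarge_def)
  qed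
  obtain \<rho> \<epsilon> where \<rho>: "0 < \<rho>" "0 < \<epsilon>" and gains: "barrier_gains \<rho> \<epsilon>"
    by (rule one_step)
  define q where "q = Cb * real CARD('d)"
  have q: "0 < q" using B3 by (simp add: q_def)
  \<comment> \<open>In this order: \<open>h < 1/2\<close> yields
    \<open>\<delta>2 < \<delta>1\<close>; a logarithm of at least 1 absorbs the term
    \<open>(T + 1) / h\<close>; the third condition says that
    \<open>h \<le> \<epsilon> * \<delta>1^2\<close>, and it implies the analogue for
    \<open>h^2\<close> and \<open>\<delta>2\<close>; the last says
    \<open>\<delta>1 < \<rho>\<close>.\<close>
  have "eventually (\<lambda>h. h < 1/2 \<and> 1 \<le> ln (1 / h) \<and> 1 / (\<epsilon> * (12 * q)) \<le> ln (1 / h) \<and>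
      12 * q * (h * ln (1 / h)) < \<rho>\<^sup>2) (at_right (0::real))"
  proof (intro eventually_conj)
    show "eventually (\<lambda>h. h < 1/2) (at_right (0::real))" by real_asymp
    have lim: "filterlim (\<lambda>h::real. ln (1 / h)) at_top (at_right 0)" by real_asymp
    show "eventually (\<lambda>h. 1 \<le> ln (1 / h)) (at_right (0::real))"
      "eventually (\<lambda>h. 1 / (\<epsilon> * (12 * q)) \<le> ln (1 / h)) (at_right (0::real))"
      using lim by (simp_all add: filterlim_at_top)
    have "((\<lambda>h::real. h * ln (1 / h)) \<longlongrightarrow> 0) (at_right 0)" by real_asymp
    then have "((\<lambda>h::real. 12 * q * (h * ln (1 / h))) \<longlongrightarrow> 12 * q * 0) (at_right 0)"
      by (intro tendsto_intros)
    then show "eventually (\<lambda>h. 12 * q * (h * ln (1 / h)) < \<rho>\<^sup>2) (at_right (0::real))"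
      by (rule order_tendstoD) (use \<rho> in simp)
  qed
  then obtain h1 where h1: "0 < h1" and small: "\<And>h. 0 < h \<Longrightarrow> h < h1 \<Longrightarrow>
      h < 1/2 \<and> 1 \<le> ln (1 / h) \<and> 1 / (\<epsilon> * (12 * q)) \<le> ln (1 / h) \<and> 12 * q * (h * ln (1 / h)) < \<rho>\<^sup>2"
    unfolding eventually_at_right_field by auto
  \<comment> \<open>\<open>28 = 12 + 16\<close>: the factors of \<open>\<delta>1^2\<close> and
    \<open>\<delta>2^2\<close> add up, since both strips contribute at the same order.\<close>
  define C where "C = T + 1 + 256 / cb * (28 * q)"
  have "(\<integral>\<^sup>+ \<omega>. ennreal (cost M W a b D Cb x0 T h \<omega>) \<partial>M) \<le> ennreal (C * (1 / h) * ln (1 / h))"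
    if h: "0 < h" "h < h1" for h
  proof -
    define l where "l = ln (1 / h)"
    have s: "h < 1/2" "1 \<le> l" "1 \<le> \<epsilon> * (12 * q) * l" "12 * q * h * l < \<rho>\<^sup>2"
      using small[OF h] q \<rho> by (auto simp: l_def pos_divide_le_eq mult_ac)
    interpret order15 M W a b D R cb Cb x0 h
      by unfold_locales (use h s x0 in auto)
    define \<delta>1 where "\<delta>1 = sqrt (12 * q * h * l)"
    define \<delta>2 where "\<delta>2 = sqrt (16 * q * h^2 * l)"
    have sq: "\<delta>1\<^sup>2 = 12 * q * h * l" "\<delta>2\<^sup>2 = 16 * q * h^2 * l" using q h s by (auto simp: \<delta>1_def \<delta>2_def)
    have step_eq: "step x = (if \<delta>1 < bd_dist x then h
         else if \<delta>2 < bd_dist x then h^2 else h^3)" for x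
      by (simp add: stepsize_def Let_def \<delta>1_def \<delta>2_def l_def q_def mult.assoc)
    have pos: "0 < \<delta>1" "0 < \<delta>2" using q h s by (auto simp: \<delta>1_def \<delta>2_def)
    have d1: "\<delta>1 < \<rho>" using s \<rho> unfolding \<delta>1_def by (intro real_less_lsqrt) auto
    have d2: "\<delta>2 < \<delta>1"
    proof -
      have "16 * q * h^2 * l = (12 * q * h * l) * (4/3 * h)" by (simp add: power2_eq_square)
      also have "\<dots> < (12 * q * h * l) * 1" using q h s by (intro mult_strict_left_mono) auto
      finally show ?thesis by (simp add: \<delta>1_def \<delta>2_def)
    qed
    \<comment> \<open>All steps are at most \<open>h\<close>, which is small compared with
      \<open>\<delta>1^2\<close> at every distance, so the cap can be the fixed
      \<open>\<rho>\<close>.\<close>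
    have o1: "expectation (\<lambda>\<omega>. \<Sum>n<N. if active T n \<omega> then
      (if bd_dist (pos n \<omega>) \<le> \<delta>1 then step (pos n \<omega>) else 0) else 0) \<le> 256 / cb * \<delta>1\<^sup>2" for N
    proof (rule strip_occupation[OF pos(1) d1 order_refl _ gains])
      fix x
      have "step x \<le> h" by (rule step_bounds)
      also have "\<dots> \<le> h * (\<epsilon> * (12 * q) * l)" using s(3) h by simp
      finally show "step x \<le> \<epsilon> * \<delta>1\<^sup>2" by (simp add: sq mult_ac)
    qed
    \<comment> \<open>Beyond \<open>\<delta>1\<close> steps of size \<open>h\<close> occur, too
      large compared with \<open>\<delta>2^2\<close>; hence the cap is
      \<open>\<delta>1\<close>.\<close>
    have o2: "expectation (\<lambda>\<omega>. \<Sum>n<N. if active T n \<omega> then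
      (if bd_dist (pos n \<omega>) \<le> \<delta>2 then step (pos n \<omega>) else 0) else 0) \<le> 256 / cb * \<delta>2\<^sup>2" for N
    proof (rule strip_occupation[OF pos(2) d2 less_imp_le[OF d1] _ gains])
      fix x assume "bd_dist x < \<delta>1"
      moreover have "h^3 \<le> h^2" using h s by (intro power_decreasing) auto
      ultimately have "step x \<le> h^2" by (simp add: step_eq)
      also have "\<dots> \<le> h^2 * (\<epsilon> * (12 * q) * l)" using s(3) h by simp
      also have "\<dots> \<le> h^2 * (\<epsilon> * (16 * q) * l)" using h \<rho> q s by (intro mult_left_mono mult_right_mono) auto
      finally show "step x \<le> \<epsilon> * \<delta>2\<^sup>2" by (simp add: sq mult_ac)
    qed
    obtain N :: nat where "T / h^3 \<le> real N" using real_arch_simple by blast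
    then have N: "T \<le> real N * h^3" using h by (simp add: pos_divide_le_eq)
    have "(\<integral>\<^sup>+ \<omega>. ennreal (cost M W a b D Cb x0 T h \<omega>) \<partial>M)
        \<le> ennreal (expectation (\<lambda>\<omega>. \<Sum>n<N. if active T n \<omega> then 1 else 0))"
      by (rule expected_cost_le[OF T N])
    also have "\<dots> \<le> ennreal (C * (1 / h) * ln (1 / h))"
    proof (rule ennreal_leI)
      have "expectation (\<lambda>\<omega>. \<Sum>n<N. if active T n \<omega> then 1 else 0)
          \<le> (T + 1) / h + 256 / cb * \<delta>1\<^sup>2 / h^2 + 256 / cb * \<delta>2\<^sup>2 / h^3"
        by (rule expected_count_le[OF T step_eq o1 o2])
      also have "\<dots> = ((T + 1) + 256 / cb * (28 * q) * l) / h"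
        unfolding sq using h cb_pos by (simp add: divide_simps power2_eq_square power3_eq_cube)
      also have "\<dots> \<le> ((T + 1) * l + 256 / cb * (28 * q) * l) / h"
        using T s h by (intro divide_right_mono add_right_mono) auto
      also have "\<dots> = C * (1 / h) * ln (1 / h)" by (simp add: C_def l_def distrib_right add_divide_distrib)
      finally show "expectation (\<lambda>\<omega>. \<Sum>n<N. if active T n \<omega> then 1 else 0) \<le> C * (1 / h) * ln (1 / h)" .
    qed
    finally show ?thesis .
  qed
  moreover have "0 < C" using T q B2 by (simp add: C_def add_pos_pos)
  ultimately show ?thesis
    using h1 by (intro exI[of _ C] exI[of _ "min h1 (1/2)"]) auto
qed

end
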